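(* Let $\chi$ be a character of the hyperoctahedral group $B_n$ and let $\mathcal{B}$ be a finite set endowed with a map $\mathrm{sDes}:\mathcal{B}\to\Sigma^B(n)$. Then $\mathcal{B}$ is a fine set for $\chi$ if and only if $$\mathrm{ch}(\chi)=\sum_{b\in\mathcal{B}}F_{\mathrm{sDes}(b)}(x,y).$$ In particular, the distribution of the signed descent set over $\mathcal{B}$ (i.e. the numbers $|\{b\in\mathcal{B}:\mathrm{sDes}(b)=\sigma\}|$, $\sigma\in\Sigma^B(n)$) is uniquely determined by $\chi$.
   Context: $[n]=\{1,\dots,n\}$. $B_n$ is the group of signed permutations. A signed set is a pair $\sigma=(S,\varepsilon)$ with $n\in S\subseteq[n]$ and $\varepsilon:S\to\{-,+\}$; $\Sigma^B(n)$ denotes the set of signed sets. Writing $S=\{s_1<\dots<s_k=n\}$ and $s_0=0$, the sign vector $\tilde\varepsilon:[n]\to\{-,+\}$ is $\tilde\varepsilon(j)=\varepsilon(s_i)$ for $s_{i-1}<j\le s_i$. Signed sets correspond bijectively to signed compositions of $n$ (compositions $(\gamma_1,\dots,\gamma_k)$ of $n$ some of whose parts are barred): $S(\gamma)$ is the set of partial sums $r_i=\gamma_1+\dots+\gamma_i$ and the sign of $r_i$ is $-$ iff the $i$-th part is barred. Let ${\rm wDes}(\sigma)$ be the set of $s_i\in S$, $i<k$, such that either $\varepsilon(s_i)=\varepsilon(s_{i+1})$, or $\varepsilon(s_i)=+$ and $\varepsilon(s_{i+1})=-$. With commuting variables $x=(x_1,x_2,\dots)$, $y=(y_1,y_2,\dots)$,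 define $$F_\sigma(x,y)=\sum_{\substack{i_1\le\dots\le i_n\\ j\in{\rm wDes}(\sigma)\Rightarrow i_j<i_{j+1}}} z_{i_1}\cdots z_{i_n},$$ where the $j$-th factor $z_{i_j}$ is $x_{i_j}$ if $\tilde\varepsilon(j)=+$ and $y_{i_j}$ if $\tilde\varepsilon(j)=-$. Weights: let $\gamma$ be a signed composition with partial sums $r_0=0<r_1<\dots<r_k=n$ and blocks $I_i=\{r_{i-1}+1,\dots,r_i\}$. Then $\sigma=(S,\varepsilon)$ is $\gamma$-unimodal if for each $i$, $S\cap\{r_{i-1}+1,\dots,r_i-1\}$ is an initial segment (possibly empty) of $\{r_{i-1}+1,\dots,r_i-1\}$. Set $\mathrm{wt}_\gamma(\sigma)=0$ if $\sigma$ is not $\gamma$-unimodal or if $\tilde\varepsilon$ is not constant on some block $I_i$; otherwise $\mathrm{wt}_\gamma(\sigma)=(-1)^{|S\setminus S(\gamma)|+n_\gamma(\sigma)}$, where $n_\gamma(\sigma)$ is the number of $i$ such that $\tilde\varepsilon$ is $-$ on $I_i$ and the $i$-th part of $\gamma$ is barred. Signed cycle type: viewing $w\in B_n$ as a permutation of $\Omega_n=\{1,\dots,n,\bar1,\dots,\bar n\}$, its cycles come either in pairs $c\ne\bar c$ (a positive cycle of length $|c|$) or as single cycles $c=\bar c$ (a negative cycle of length $|c|/2$); the signed cycle type is the bipartition $(\alpha,\beta)$ of lengths of positive and negative cycles. For a class function $\chi$ on $B_n$ and signed composition $\gamma$, $\chi(\gamma)$ is the value of $\chi$ at elements of signed cycle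 type $(\alpha,\beta)$ where $\alpha$ (resp. $\beta$) is the decreasing rearrangement of the unbarred (resp. barred) parts of $\gamma$. A set $\mathcal{B}$ with a map $\mathrm{sDes}:\mathcal{B}\to\Sigma^B(n)$ is a fine set for $\chi$ if $\chi(\gamma)=\sum_{b\in\mathcal{B}}\mathrm{wt}_\gamma(\mathrm{sDes}(b))$ for every signed composition $\gamma$ of $n$. Frobenius characteristic: $p^{\pm}_k=\sum_i(x_i^k\pm y_i^k)$, $p^\pm_\lambda=\prod_j p^\pm_{\lambda_j}$, and $\mathrm{ch}(\chi)=\frac{1}{2^nn!}\sum_{w\in B_n}\chi(w)\,p^+_\alpha(x,y)p^-_\beta(x,y)$, where $(\alpha,\beta)$ is the signed cycle type of $w$. A character means a non-virtual character. *)

theory Defs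
  imports
    "HOL-Library.Multiset"
    "HOL-Library.FuncSet"
    "HOL-Combinatorics.Orbits"
    "Jordan_Normal_Form.Matrix"
begin

section \<open>Formal power series in arbitrarily many commuting variables\<close>

text \<open>A monomial is the multiset of its variables; a series is its coefficient function.\<close>

typedef ('v, 'a) mps = "UNIV :: ('v multiset \<Rightarrow> 'a) set"
  morphisms mps_coeff Abs_mps ..

setup_lifting type_definition_mps

lemma mps_eqI: "(\<And>M. mps_coeff f M = mps_coeff g M) \<Longrightarrow> f = g"
  by (metis ext mps_coeff_inject)

lemma finite_submultisets: "finite {A. A \<subseteq># M}"
proof (induction M)
  case empty
  then show ?case by simp
next
  case (add x M)
  have "{A. A \<subseteq># add_mset x M} \<subseteq> {A. A \<subseteq># M} \<union> add_mset x ` {A. A \<subseteq># M}"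
  proof
    fix A assume "A \<in> {A. A \<subseteq># add_mset x M}"
    then have A: "A \<subseteq># add_mset x M" by simp
    show "A \<in> {A. A \<subseteq># M} \<union> add_mset x ` {A. A \<subseteq># M}"
    proof (cases "x \<in># A")
      case True
      then obtain A' where "A = add_mset x A'" by (meson multi_member_split)
      with A show ?thesis by auto
    next
      case False
      have "A \<subseteq># M"
      proof (rule mset_subset_eqI)
        fix a
        show "count A a \<le> count M a"
          using False mset_subset_eq_count[OF A, of a] by (cases "a = x") (auto simp: not_in_iff)
      qed
      then show ?thesis by simp
    qed
  qed
  with add show ?case using finite_subset by blast
qed

instantiation mps :: (type, comm_ring_1) comm_ring_1
begin

lift_definition zero_mps :: "('a, 'b) mps" is "\<lambda>_. 0" .

lift_definition one_mps :: "('a, 'b) mps" is "\<lambda>M. if M = {#} then 1 else 0" .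

lift_definition plus_mps :: "('a, 'b) mps \<Rightarrow> ('a, 'b) mps \<Rightarrow> ('a, 'b) mps"
  is "\<lambda>f g M. f M + g M" .

lift_definition minus_mps :: "('a, 'b) mps \<Rightarrow> ('a, 'b) mps \<Rightarrow> ('a, 'b) mps"
  is "\<lambda>f g M. f M - g M" .

lift_definition uminus_mps :: "('a, 'b) mps \<Rightarrow> ('a, 'b) mps"
  is "\<lambda>f M. - f M" .

lift_definition times_mps :: "('a, 'b) mps \<Rightarrow> ('a, 'b) mps \<Rightarrow> ('a, 'b) mps"
  is "\<lambda>f g M. \<Sum>A | A \<subseteq># M. f A * g (M - A)" .

instance
proof
  fix a b c :: "('a, 'b) mps"
  show "a * b * c = a * (b * c)"
  proof (rule mps_eqI)
    fix M
    let ?a = "mps_coeff a" and ?b = "mps_coeff b" and ?c = "mps_coeff c"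
    have "mps_coeff (a * b * c) M =
        (\<Sum>A | A \<subseteq># M. \<Sum>C | C \<subseteq># A. ?a C * ?b (A - C) * ?c (M - A))"
      by (simp add: times_mps.rep_eq sum_distrib_right)
    also have "\<dots> = (\<Sum>(A, C) \<in> (SIGMA A : {A. A \<subseteq># M}. {C. C \<subseteq># A}).
        ?a C * ?b (A - C) * ?c (M - A))"
      by (rule sum.Sigma) (auto simp: finite_submultisets)
    also have "\<dots> = (\<Sum>(C, D) \<in> (SIGMA C : {C. C \<subseteq># M}. {D. D \<subseteq># M - C}).
        ?a C * (?b D * ?c (M - C - D)))"
      by (rule sum.reindex_bij_witness[where i = "\<lambda>(C, D). (C + D, C)" and j = "\<lambda>(A, C). (C, A - C)"])
        (auto simp: mult.assoc subset_mset.le_iff_add add.assoc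
          simp flip: diff_diff_add_mset)
    also have "\<dots> = (\<Sum>C | C \<subseteq># M. \<Sum>D | D \<subseteq># M - C. ?a C * (?b D * ?c (M - C - D)))"
      by (rule sum.Sigma[symmetric]) (auto simp: finite_submultisets)
    also have "\<dots> = mps_coeff (a * (b * c)) M"
      by (simp add: times_mps.rep_eq sum_distrib_left)
    finally show "mps_coeff (a * b * c) M = mps_coeff (a * (b * c)) M" .
  qed
  show "a * b = b * a"
  proof (rule mps_eqI)
    fix M
    show "mps_coeff (a * b) M = mps_coeff (b * a) M"
      unfolding times_mps.rep_eq
      by (rule sum.reindex_bij_witness[where i = "\<lambda>A. M - A" and j = "\<lambda>A. M - A"])
        (auto simp: mult.commute subset_mset.le_iff_add)
  qed
  show "1 * a = a"
  proof (rule mps_eqI)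
    fix M
    have "mps_coeff (1 * a) M = (\<Sum>A | A \<subseteq># M. if A = {#} then mps_coeff a M else 0)"
      unfolding times_mps.rep_eq one_mps.rep_eq by (rule sum.cong) auto
    also have "\<dots> = mps_coeff a M"
      by (simp add: finite_submultisets)
    finally show "mps_coeff (1 * a) M = mps_coeff a M" .
  qed
  show "(a + b) * c = a * c + b * c"
    by (rule mps_eqI)
      (simp add: times_mps.rep_eq plus_mps.rep_eq distrib_right sum.distrib)
  show "(0 :: ('a, 'b) mps) \<noteq> 1"
  proof
    assume "(0 :: ('a, 'b) mps) = 1"
    then have "mps_coeff (0 :: ('a, 'b) mps) {#} = mps_coeff 1 {#}" by simp
    then show False by (simp add: zero_mps.rep_eq one_mps.rep_eq)
  qed
qed (auto intro!: mps_eqI simp: plus_mps.rep_eq minus_mps.rep_eq uminus_mps.rep_eq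
      zero_mps.rep_eq algebra_simps)

end

lift_definition mps_const :: "'a::comm_ring_1 \<Rightarrow> ('v, 'a) mps"
  is "\<lambda>c M. if M = {#} then c else 0" .

text \<open>
  The formal sum of the monomials \<open>m i\<close>, \<open>i \<in> I\<close>. The index set may be infinite; the sum is
  meaningful if every monomial occurs for finitely many \<open>i\<close> only.
\<close>

lift_definition monomial_sum :: "'i set \<Rightarrow> ('i \<Rightarrow> 'v multiset) \<Rightarrow> ('v, 'a::comm_ring_1) mps"
  is "\<lambda>I m M. of_nat (card {i \<in> I. m i = M})" .


section \<open>Signed sets and the series \<open>F\<close>\<close>

datatype sign = Plus | Minus

datatype var = X nat | Y nat

text \<open>The sign function is extensional, so that equal signed sets are equal pairs.\<close>

type_synonym signed_set = "nat set \<times> (nat \<Rightarrow> sign)"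

definition signed_sets :: "nat \<Rightarrow> signed_set set" where
  "signed_sets n = {(S, \<epsilon>). n \<in> S \<and> S \<subseteq> {1..n} \<and> \<epsilon> \<in> S \<rightarrow>\<^sub>E UNIV}"

definition sign_vector :: "signed_set \<Rightarrow> nat \<Rightarrow> sign" where
  "sign_vector \<sigma> j = (case \<sigma> of (S, \<epsilon>) \<Rightarrow> \<epsilon> (Min {s \<in> S. j \<le> s}))"

definition wDes :: "signed_set \<Rightarrow> nat set" where
  "wDes \<sigma> = (case \<sigma> of (S, \<epsilon>) \<Rightarrow>
     {s \<in> S. s \<noteq> Max S \<and>
        (let t = Min {t \<in> S. s < t} in \<epsilon> s = \<epsilon> t \<or> (\<epsilon> s = Plus \<and> \<epsilon> t = Minus))})"

definition signed_var :: "sign \<Rightarrow> nat \<Rightarrow> var" where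
  "signed_var e i = (case e of Plus \<Rightarrow> X i | Minus \<Rightarrow> Y i)"

definition F :: "nat \<Rightarrow> signed_set \<Rightarrow> (var, complex) mps" where
  "F n \<sigma> = monomial_sum
     {i \<in> {1..n} \<rightarrow>\<^sub>E {1..}.
        (\<forall>j\<in>{1..<n}. i j \<le> i (j + 1)) \<and> (\<forall>j\<in>wDes \<sigma>. i j < i (j + 1))}
     (\<lambda>i. image_mset (\<lambda>j. signed_var (sign_vector \<sigma> j) (i j)) (mset_set {1..n}))"


section \<open>Signed compositions and weights\<close>

text \<open>A part paired with \<open>Minus\<close> is a barred part. Parts are numbered from 0.\<close>

type_synonym signed_composition = "(nat \<times> sign) list"

definition signed_compositions :: "nat \<Rightarrow> signed_composition set" where
  "signed_compositions n = {\<gamma>. (\<forall>p\<in>set \<gamma>. 0 < fst p) \<and> sum_list (map fst \<gamma>) = n}"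

definition partial_sum :: "signed_composition \<Rightarrow> nat \<Rightarrow> nat" where
  "partial_sum \<gamma> i = sum_list (map fst (take i \<gamma>))"

definition partial_sums :: "signed_composition \<Rightarrow> nat set" where
  "partial_sums \<gamma> = partial_sum \<gamma> ` {1..length \<gamma>}"

definition block :: "signed_composition \<Rightarrow> nat \<Rightarrow> nat set" where
  "block \<gamma> i = {partial_sum \<gamma> i + 1..partial_sum \<gamma> (i + 1)}"

definition initial_segment :: "nat set \<Rightarrow> nat set \<Rightarrow> bool" where
  "initial_segment A P \<longleftrightarrow> A \<subseteq> P \<and> (\<forall>a\<in>A. \<forall>b\<in>P. b \<le> a \<longrightarrow> b \<in> A)"

definition unimodal :: "signed_composition \<Rightarrow> signed_set \<Rightarrow> bool" where
  "unimodal \<gamma> \<sigma> \<longleftrightarrow> (\<forall>i<length \<gamma>.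
     let P = {partial_sum \<gamma> i + 1..<partial_sum \<gamma> (i + 1)} in initial_segment (fst \<sigma> \<inter> P) P)"

definition wt :: "signed_composition \<Rightarrow> signed_set \<Rightarrow> int" where
  "wt \<gamma> \<sigma> =
     (if unimodal \<gamma> \<sigma> \<and> (\<forall>i<length \<gamma>. \<exists>e. \<forall>j\<in>block \<gamma> i. sign_vector \<sigma> j = e)
      then (- 1) ^ (card (fst \<sigma> - partial_sums \<gamma>) +
         card {i. i < length \<gamma> \<and> (\<forall>j\<in>block \<gamma> i. sign_vector \<sigma> j = Minus) \<and> snd (\<gamma> ! i) = Minus})
      else 0)"


section \<open>The hyperoctahedral group and its characters\<close>

text \<open>The barred letters are encoded as negative integers.\<close>

definition Omega :: "nat \<Rightarrow> int set" where
  "Omega n = {- int n..int n} - {0}"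

definition signed_perms :: "nat \<Rightarrow> (int \<Rightarrow> int) set" where
  "signed_perms n = {w. w permutes Omega n \<and> (\<forall>i\<in>Omega n. w (- i) = - w i)}"

text \<open>
  A cycle \<open>c\<close> is represented by its underlying orbit, and its conjugate by \<open>uminus ` c\<close>;
  this is faithful since signed permutations commute with negation. Partitions are multisets.
  Both members of a pair \<open>{c, uminus ` c}\<close> have the same cardinality.
\<close>

definition cycles :: "nat \<Rightarrow> (int \<Rightarrow> int) \<Rightarrow> int set set" where
  "cycles n w = orbit w ` Omega n"

definition positive_lengths :: "nat \<Rightarrow> (int \<Rightarrow> int) \<Rightarrow> nat multiset" where
  "positive_lengths n w = image_mset (\<lambda>P. the_elem (card ` P))
     (mset_set {{c, uminus ` c} | c. c \<in> cycles n w \<and> c \<noteq> uminus ` c})"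

definition negative_lengths :: "nat \<Rightarrow> (int \<Rightarrow> int) \<Rightarrow> nat multiset" where
  "negative_lengths n w = image_mset (\<lambda>c. card c div 2)
     (mset_set {c \<in> cycles n w. c = uminus ` c})"

definition signed_cycle_type :: "nat \<Rightarrow> (int \<Rightarrow> int) \<Rightarrow> nat multiset \<times> nat multiset" where
  "signed_cycle_type n w = (positive_lengths n w, negative_lengths n w)"

definition bipartition_of :: "signed_composition \<Rightarrow> nat multiset \<times> nat multiset" where
  "bipartition_of \<gamma> =
     (mset (map fst (filter (\<lambda>p. snd p = Plus) \<gamma>)), mset (map fst (filter (\<lambda>p. snd p = Minus) \<gamma>)))"

definition trace_mat :: "complex mat \<Rightarrow> complex" where
  "trace_mat A = (\<Sum>i<dim_row A. A $$ (i, i))"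

definition is_representation :: "nat \<Rightarrow> nat \<Rightarrow> ((int \<Rightarrow> int) \<Rightarrow> complex mat) \<Rightarrow> bool" where
  "is_representation n d \<rho> \<longleftrightarrow>
     (\<forall>w\<in>signed_perms n. \<rho> w \<in> carrier_mat d d) \<and> \<rho> id = 1\<^sub>m d \<and>
     (\<forall>v\<in>signed_perms n. \<forall>w\<in>signed_perms n. \<rho> (v \<circ> w) = \<rho> v * \<rho> w)"

definition is_character :: "nat \<Rightarrow> ((int \<Rightarrow> int) \<Rightarrow> complex) \<Rightarrow> bool" where
  "is_character n \<chi> \<longleftrightarrow>
     (\<exists>d \<rho>. is_representation n d \<rho> \<and> (\<forall>w\<in>signed_perms n. \<chi> w = trace_mat (\<rho> w)))"

definition value_at :: "nat \<Rightarrow> ((int \<Rightarrow> int) \<Rightarrow> complex) \<Rightarrow> signed_composition \<Rightarrow> complex" where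
  "value_at n \<chi> \<gamma> =
     \<chi> (SOME w. w \<in> signed_perms n \<and> signed_cycle_type n w = bipartition_of \<gamma>)"

definition fine_set ::
    "nat \<Rightarrow> ((int \<Rightarrow> int) \<Rightarrow> complex) \<Rightarrow> 'b set \<Rightarrow> ('b \<Rightarrow> signed_set) \<Rightarrow> bool" where
  "fine_set n \<chi> B sDes \<longleftrightarrow>
     (\<forall>\<gamma>\<in>signed_compositions n. value_at n \<chi> \<gamma> = (\<Sum>b\<in>B. of_int (wt \<gamma> (sDes b))))"


section \<open>The Frobenius characteristic\<close>

definition power_sum :: "sign \<Rightarrow> nat \<Rightarrow> (var, complex) mps" where
  "power_sum e k =
     (let px = monomial_sum {1..} (\<lambda>i. replicate_mset k (X i));
          py = monomial_sum {1..} (\<lambda>i. replicate_mset k (Y i))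
      in case e of Plus \<Rightarrow> px + py | Minus \<Rightarrow> px - py)"

definition power_sum_part :: "sign \<Rightarrow> nat multiset \<Rightarrow> (var, complex) mps" where
  "power_sum_part e \<mu> = (\<Prod>k\<in>#\<mu>. power_sum e k)"

definition ch :: "nat \<Rightarrow> ((int \<Rightarrow> int) \<Rightarrow> complex) \<Rightarrow> (var, complex) mps" where
  "ch n \<chi> = mps_const (1 / (2 ^ n * fact n)) *
     (\<Sum>w\<in>signed_perms n. case signed_cycle_type n w of (\<alpha>, \<beta>) \<Rightarrow>
        mps_const (\<chi> w) * power_sum_part Plus \<alpha> * power_sum_part Minus \<beta>)"

end

theory Submission
  imports Defs
begin

text \<open>
  Order the variables as \<open>Y 1 < X 1 < Y 2 < X 2 < \<dots>\<close>. The multiplicities and signs of the variables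
  of a monomial of degree \<open>n\<close>, read in this order, form a signed composition \<open>\<tau>\<close> of \<open>n\<close>. The
  coefficients of \<open>F n \<sigma>\<close> and of products of power sums depend on \<open>\<tau>\<close> only, so an equation between
  such series is an equation between functions of \<open>\<tau>\<close>.

  Each signed composition \<open>\<gamma>\<close> gives a linear functional on functions of \<open>\<tau>\<close>: it is multiplicative
  over the blocks of \<open>\<gamma>\<close>, and on a block of size \<open>k\<close> its coefficients are those of the power sum of
  degree \<open>k\<close> in the complete homogeneous basis. These functionals separate points, they send \<open>F n \<sigma>\<close>
  to \<open>wt \<gamma> \<sigma>\<close>, and they send the product of power sums attached to \<open>w\<close> to the number of ways of
  listing the cycles of \<open>w\<close>, each with a base point, such that their types form \<open>\<gamma>\<close>. The group acts
  simply transitively on the signed permutations with such a list, hence the functional of \<open>\<gamma>\<close> sends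
  \<open>ch n \<chi>\<close> to \<open>\<chi>(\<gamma>)\<close>. Uniqueness holds because the series \<open>F n \<sigma>\<close> are unitriangular in the
  monomial coefficients.
\<close>

section \<open>Functionals on signed compositions\<close>

lemma Nil_in_signed_compositions: "[] \<in> signed_compositions n \<longleftrightarrow> n = 0"
  by (auto simp: signed_compositions_def)

lemma Cons_in_signed_compositions:
  "(k, e) # \<gamma> \<in> signed_compositions n \<longleftrightarrow>
     0 < k \<and> k \<le> n \<and> \<gamma> \<in> signed_compositions (n - k)"
  by (auto simp: signed_compositions_def)

lemma append_in_signed_compositions:
  "\<gamma> \<in> signed_compositions m \<Longrightarrow> \<delta> \<in> signed_compositions n \<Longrightarrow> \<gamma> @ \<delta> \<in> signed_compositions (m + n)"
  by (auto simp: signed_compositions_def)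

lemma signed_compositions_0: "signed_compositions 0 = {[]}"
proof -
  have "\<gamma> = []" if "\<gamma> \<in> signed_compositions 0" for \<gamma>
    using that by (cases \<gamma>) (auto simp: signed_compositions_def)
  then show ?thesis
    by (auto simp: Nil_in_signed_compositions)
qed

definition compositions :: "nat \<Rightarrow> nat list set" where
  "compositions k = {c. (\<forall>t\<in>set c. 0 < t) \<and> sum_list c = k}"

lemma compositions_rec:
  assumes "0 < k"
  shows "compositions k = insert [k] (\<Union>t\<in>{1..<k}. (#) t ` compositions (k - t))"
proof (intro equalityI subsetI)
  fix c assume c: "c \<in> compositions k"
  with assms obtain t c' where t: "c = t # c'"
    by (cases c) (auto simp: compositions_def)
  show "c \<in> insert [k] (\<Union>t\<in>{1..<k}. (#) t ` compositions (k - t))"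
  proof (cases c')
    case Nil
    with c t show ?thesis by (simp add: compositions_def)
  next
    case Cons
    with c t have "t \<in> {1..<k}" "c' \<in> compositions (k - t)"
      by (auto simp: compositions_def)
    with t show ?thesis by blast
  qed
qed (use assms in \<open>auto simp: compositions_def\<close>)

lemma Nil_notin_compositions: "0 < k \<Longrightarrow> [] \<notin> compositions k"
  by (auto simp: compositions_def)

lemma finite_compositions: "finite (compositions k)"
proof (induction k rule: less_induct)
  case (less k)
  show ?case
  proof (cases "k = 0")
    case True
    have "c = []" if "c \<in> compositions 0" for c
      using that by (cases c) (auto simp: compositions_def)
    then have "compositions 0 \<subseteq> {[]}" by blast
    then show ?thesis using True finite_subset by auto
  next
    case False
    with less show ?thesis by (auto simp: compositions_rec[of k])
  qed
qed

lemma map_Pair_compositions: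
  "c \<in> compositions k \<Longrightarrow> map (\<lambda>t. (t, s)) c \<in> signed_compositions k"
  by (auto simp: compositions_def signed_compositions_def o_def)

text \<open>
  \<open>(- 1) ^ (length c - 1) * last c\<close> is the coefficient of the product of complete homogeneous
  functions indexed by \<open>c\<close> in the power sum of degree \<open>k\<close>.
\<close>

definition block_functional :: "nat \<Rightarrow> sign \<Rightarrow> (signed_composition \<Rightarrow> complex) \<Rightarrow> complex" where
  "block_functional k s g =
     (\<Sum>c\<in>compositions k. (- 1) ^ (length c - 1) * of_nat (last c) * g (map (\<lambda>t. (t, s)) c))"

lemma block_functional_rec:
  assumes "0 < k"
  shows "block_functional k s g =
    of_nat k * g [(k, s)] - (\<Sum>t\<in>{1..<k}. block_functional (k - t) s (\<lambda>c. g ((t, s) # c)))"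
proof -
  define f where
    "f = (\<lambda>c. (- 1) ^ (length c - 1) * of_nat (last c) * g (map (\<lambda>t. (t, s)) c))"
  have "[k] \<notin> (\<Union>t\<in>{1..<k}. (#) t ` compositions (k - t))" by auto
  then have "block_functional k s g =
      f [k] + (\<Sum>c\<in>(\<Union>t\<in>{1..<k}. (#) t ` compositions (k - t)). f c)"
    unfolding block_functional_def f_def[symmetric] compositions_rec[OF assms]
    by (intro sum.insert) (auto simp: finite_compositions)
  also have "(\<Sum>c\<in>(\<Union>t\<in>{1..<k}. (#) t ` compositions (k - t)). f c) =
      (\<Sum>t\<in>{1..<k}. \<Sum>c\<in>compositions (k - t). f (t # c))"
    by (subst sum.UNION_disjoint) (auto simp: finite_compositions sum.reindex)
  also have "\<dots> = (\<Sum>t\<in>{1..<k}. - block_functional (k - t) s (\<lambda>c. g ((t, s) # c)))"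
    unfolding block_functional_def sum_negf[symmetric]
  proof (intro sum.cong refl)
    fix t c assume "t \<in> {1..<k}" "c \<in> compositions (k - t)"
    then have "c \<noteq> []" using Nil_notin_compositions[of "k - t"] by auto
    then show "f (t # c) =
        - ((- 1) ^ (length c - 1) * of_nat (last c) * g ((t, s) # map (\<lambda>t. (t, s)) c))"
      by (cases c) (simp_all add: f_def)
  qed
  finally show ?thesis by (simp add: f_def sum_negf)
qed

lemma block_functional_linear:
  "block_functional k s (\<lambda>c. \<Sum>i\<in>I. a i * g i c) = (\<Sum>i\<in>I. a i * block_functional k s (g i))"
  unfolding block_functional_def sum_distrib_left
  by (subst sum.swap) (simp add: mult_ac)

lemma block_functional_scale:
  "block_functional k s (\<lambda>c. a * g c) = a * block_functional k s g"
  by (simp add: block_functional_def sum_distrib_left mult_ac)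

lemma block_functional_cong:
  assumes "\<And>c. c \<in> signed_compositions k \<Longrightarrow> g c = g' c"
  shows "block_functional k s g = block_functional k s g'"
  unfolding block_functional_def by (intro sum.cong) (auto intro: assms map_Pair_compositions)

lemma block_functional_eq_0:
  "(\<And>c. c \<in> signed_compositions k \<Longrightarrow> g c = 0) \<Longrightarrow> block_functional k s g = 0"
  by (simp add: block_functional_def map_Pair_compositions)

definition sign_pairing :: "sign \<Rightarrow> sign \<Rightarrow> complex" where
  "sign_pairing e s = (if e = Minus \<and> s = Minus then - 1 else 1)"

lemma UNIV_sign: "(UNIV :: sign set) = {Plus, Minus}"
  using sign.exhaust by auto

lemma sum_UNIV_sign: "(\<Sum>s\<in>UNIV. f s) = f Plus + f Minus"
  by (simp add: UNIV_sign)

lemma sign_pairing_orthogonal: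
  "(\<Sum>s\<in>UNIV. sign_pairing e s * sign_pairing e' s) = (if e = e' then 2 else 0)"
  unfolding sum_UNIV_sign by (cases e; cases e') (simp_all add: sign_pairing_def)

lemma sign_pairing_separates:
  assumes "\<And>e. (\<Sum>s\<in>UNIV. sign_pairing e s * f s) = 0"
  shows "f s = 0"
  using assms[of Plus] assms[of Minus]
  by (cases s) (simp_all add: sum_UNIV_sign sign_pairing_def)

fun weight_functional :: "signed_composition \<Rightarrow> (signed_composition \<Rightarrow> complex) \<Rightarrow> complex" where
  "weight_functional [] g = g []"
| "weight_functional ((k, e) # \<gamma>) g =
     (\<Sum>s\<in>UNIV. sign_pairing e s * block_functional k s (\<lambda>c. weight_functional \<gamma> (\<lambda>\<tau>. g (c @ \<tau>))))"

lemma weight_functional_linear: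
  "weight_functional \<gamma> (\<lambda>\<tau>. \<Sum>i\<in>I. a i * g i \<tau>) = (\<Sum>i\<in>I. a i * weight_functional \<gamma> (g i))"
proof (induction \<gamma> arbitrary: g)
  case (Cons p \<gamma>)
  obtain k e where p: "p = (k, e)" by force
  have "weight_functional (p # \<gamma>) (\<lambda>\<tau>. \<Sum>i\<in>I. a i * g i \<tau>) =
      (\<Sum>s\<in>UNIV. \<Sum>i\<in>I. sign_pairing e s *
         (a i * block_functional k s (\<lambda>c. weight_functional \<gamma> (\<lambda>\<tau>. g i (c @ \<tau>)))))"
    by (simp add: p Cons.IH block_functional_linear sum_distrib_left)
  also have "\<dots> = (\<Sum>i\<in>I. a i * weight_functional (p # \<gamma>) (g i))"
    by (subst sum.swap) (simp add: p sum_distrib_left mult.left_commute)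
  finally show ?case .
qed simp

lemma weight_functional_scale:
  "weight_functional \<gamma> (\<lambda>\<tau>. a * g \<tau>) = a * weight_functional \<gamma> g"
  using weight_functional_linear[of \<gamma> "\<lambda>_::unit. a" "\<lambda>_. g" UNIV] by simp

lemma weight_functional_sum:
  "weight_functional \<gamma> (\<lambda>\<tau>. \<Sum>i\<in>I. g i \<tau>) = (\<Sum>i\<in>I. weight_functional \<gamma> (g i))"
  using weight_functional_linear[of \<gamma> "\<lambda>_. 1" g I] by simp

lemma weight_functional_diff:
  "weight_functional \<gamma> (\<lambda>\<tau>. f \<tau> - g \<tau>) = weight_functional \<gamma> f - weight_functional \<gamma> g"
  using weight_functional_linear[of \<gamma> "\<lambda>b. if b then 1 else - 1" "\<lambda>b. if b then f else g" UNIV]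
  by (simp add: UNIV_bool)

lemma weight_functional_block_functional:
  "weight_functional \<gamma> (\<lambda>\<tau>. block_functional k s (\<lambda>c. f c \<tau>)) =
   block_functional k s (\<lambda>c. weight_functional \<gamma> (f c))"
  by (simp add: block_functional_def weight_functional_linear)

lemma weight_functional_cong:
  assumes "\<gamma> \<in> signed_compositions n"
    and "\<And>\<tau>. \<tau> \<in> signed_compositions n \<Longrightarrow> g \<tau> = g' \<tau>"
  shows "weight_functional \<gamma> g = weight_functional \<gamma> g'"
  using assms
proof (induction \<gamma> arbitrary: n g g')
  case Nil
  then show ?case by (simp add: Nil_in_signed_compositions signed_compositions_0)
next
  case (Cons p \<gamma>)
  obtain k e where p: "p = (k, e)" by force
  with Cons.prems have k: "k \<le> n" and \<gamma>: "\<gamma> \<in> signed_compositions (n - k)"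
    by (auto simp: Cons_in_signed_compositions)
  have "weight_functional \<gamma> (\<lambda>\<tau>. g (c @ \<tau>)) = weight_functional \<gamma> (\<lambda>\<tau>. g' (c @ \<tau>))"
    if "c \<in> signed_compositions k" for c
    using append_in_signed_compositions[OF that] k by (intro Cons.IH[OF \<gamma>] Cons.prems(2)) force
  then have "block_functional k s (\<lambda>c. weight_functional \<gamma> (\<lambda>\<tau>. g (c @ \<tau>))) =
      block_functional k s (\<lambda>c. weight_functional \<gamma> (\<lambda>\<tau>. g' (c @ \<tau>)))" for s
    by (rule block_functional_cong)
  then show ?case by (simp add: p)
qed

lemma block_functionals_separate:
  assumes block: "\<And>k s \<tau>. 0 < k \<Longrightarrow> k \<le> n \<Longrightarrow> \<tau> \<in> signed_compositions (n - k) \<Longrightarrow>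
      block_functional k s (\<lambda>c. g (c @ \<tau>)) = 0"
    and "0 < t" "t \<le> n" "\<tau> \<in> signed_compositions (n - t)"
  shows "g ((t, s) # \<tau>) = 0"
  using assms(2-)
proof (induction t arbitrary: \<tau> rule: less_induct)
  case (less t)
  have "block_functional (t - u) s (\<lambda>c. g ((u, s) # c @ \<tau>)) = 0" if u: "u \<in> {1..<t}" for u
  proof (rule block_functional_eq_0)
    fix c assume "c \<in> signed_compositions (t - u)"
    from append_in_signed_compositions[OF this less.prems(3)]
    show "g ((u, s) # c @ \<tau>) = 0"
      using u less.prems by (intro less.IH) auto
  qed
  then have "of_nat t * g ((t, s) # \<tau>) = block_functional t s (\<lambda>c. g (c @ \<tau>))"
    using less.prems by (simp add: block_functional_rec[of t])
  then show ?case
    using block[OF less.prems] less.prems by simp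
qed

text \<open>
  Pairing the two signs of a block is invertible, and after that the functionals are triangular with
  respect to refinement.
\<close>

lemma weight_functionals_separate:
  assumes "\<And>\<gamma>. \<gamma> \<in> signed_compositions n \<Longrightarrow> weight_functional \<gamma> g = 0"
    and "\<tau> \<in> signed_compositions n"
  shows "g \<tau> = 0"
  using assms
proof (induction n arbitrary: g \<tau> rule: less_induct)
  case (less n)
  have block: "block_functional k s (\<lambda>c. g (c @ \<tau>)) = 0"
    if k: "0 < k" "k \<le> n" and \<tau>: "\<tau> \<in> signed_compositions (n - k)" for k s \<tau>
  proof (rule sign_pairing_separates)
    fix e
    show "(\<Sum>s\<in>UNIV. sign_pairing e s * block_functional k s (\<lambda>c. g (c @ \<tau>))) = 0"
    proof (rule less.IH[OF _ _ \<tau>])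
      fix \<gamma> assume "\<gamma> \<in> signed_compositions (n - k)"
      then have "weight_functional ((k, e) # \<gamma>) g = 0"
        using k by (intro less.prems) (simp add: Cons_in_signed_compositions)
      then show "weight_functional \<gamma>
          (\<lambda>\<tau>. \<Sum>s\<in>UNIV. sign_pairing e s * block_functional k s (\<lambda>c. g (c @ \<tau>))) = 0"
        by (simp add: weight_functional_linear weight_functional_block_functional)
    qed (use k in auto)
  qed
  show ?case
  proof (cases \<tau>)
    case Nil
    with less.prems(2) have "n = 0" by (simp add: Nil_in_signed_compositions)
    with less.prems(1)[of "[]"] Nil show ?thesis by (simp add: Nil_in_signed_compositions)
  next
    case (Cons p \<tau>')
    obtain t s where "p = (t, s)" by force
    with less.prems(2) Cons show ?thesis
      by (auto simp: Cons_in_signed_compositions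
          intro: block_functionals_separate[where n = n] block)
  qed
qed

lemma weight_functional_eq_iff:
  "(\<forall>\<gamma>\<in>signed_compositions n. weight_functional \<gamma> f = weight_functional \<gamma> g) \<longleftrightarrow>
   (\<forall>\<tau>\<in>signed_compositions n. f \<tau> = g \<tau>)"
proof
  assume "\<forall>\<gamma>\<in>signed_compositions n. weight_functional \<gamma> f = weight_functional \<gamma> g"
  then have "weight_functional \<gamma> (\<lambda>\<tau>. f \<tau> - g \<tau>) = 0" if "\<gamma> \<in> signed_compositions n" for \<gamma>
    using that by (simp add: weight_functional_diff)
  then show "\<forall>\<tau>\<in>signed_compositions n. f \<tau> = g \<tau>"
    using weight_functionals_separate[of n "\<lambda>\<tau>. f \<tau> - g \<tau>"] by simp
qed (blast intro: weight_functional_cong)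

section \<open>Weights of signed sets\<close>

definition free_block :: "nat set \<Rightarrow> (nat \<Rightarrow> sign) \<Rightarrow> nat \<Rightarrow> nat \<Rightarrow> sign \<Rightarrow> bool" where
  "free_block S \<epsilon> a t s \<longleftrightarrow> (\<forall>j\<in>{a + 1..a + t}. \<epsilon> j = s) \<and> S \<inter> {a + 1..<a + t} = {}"

fun F_coeff :: "nat set \<Rightarrow> (nat \<Rightarrow> sign) \<Rightarrow> nat \<Rightarrow> signed_composition \<Rightarrow> complex" where
  "F_coeff S \<epsilon> a [] = 1"
| "F_coeff S \<epsilon> a ((t, s) # \<tau>) = of_bool (free_block S \<epsilon> a t s) * F_coeff S \<epsilon> (a + t) \<tau>"

lemma F_coeff_append:
  "F_coeff S \<epsilon> a (c @ \<tau>) = F_coeff S \<epsilon> a c * F_coeff S \<epsilon> (a + sum_list (map fst c)) \<tau>"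
  by (induction c arbitrary: a) (auto simp: add.assoc)

definition block_weight :: "nat set \<Rightarrow> (nat \<Rightarrow> sign) \<Rightarrow> nat \<Rightarrow> nat \<Rightarrow> sign \<Rightarrow> complex" where
  "block_weight S \<epsilon> a k s =
     (if (\<forall>j\<in>{a + 1..a + k}. \<epsilon> j = s) \<and> initial_segment (S \<inter> {a + 1..<a + k}) {a + 1..<a + k}
      then (- 1) ^ card (S \<inter> {a + 1..<a + k}) else 0)"

lemma interval_Suc_eq_insert:
  "{a + 1..a + Suc k} = insert (a + 1) {a + 1 + 1..a + 1 + k}"
  "0 < k \<Longrightarrow> {a + 1..<a + Suc k} = insert (a + 1) {a + 1 + 1..<a + 1 + k}"
  by auto

lemma free_block_Suc_0: "free_block S \<epsilon> a (Suc 0) s \<longleftrightarrow> \<epsilon> (Suc a) = s"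
  by (auto simp: free_block_def)

lemma free_block_Suc:
  assumes "0 < k"
  shows "free_block S \<epsilon> a (Suc k) s \<longleftrightarrow>
    \<epsilon> (a + 1) = s \<and> a + 1 \<notin> S \<and> free_block S \<epsilon> (a + 1) k s"
  unfolding free_block_def interval_Suc_eq_insert(1) interval_Suc_eq_insert(2)[OF assms] by auto

lemma block_weight_Suc_0: "block_weight S \<epsilon> a (Suc 0) s = of_bool (\<epsilon> (Suc a) = s)"
  by (auto simp: block_weight_def initial_segment_def)

lemma block_weight_Suc:
  assumes "0 < k"
  shows "block_weight S \<epsilon> a (Suc k) s =
    (if \<epsilon> (a + 1) \<noteq> s then 0
     else if a + 1 \<in> S then - block_weight S \<epsilon> (a + 1) k s
     else of_bool (free_block S \<epsilon> (a + 1) k s))"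
proof -
  let ?P = "{a + 1 + 1..<a + 1 + k}"
  note interval = interval_Suc_eq_insert(1)[of a k] interval_Suc_eq_insert(2)[OF assms, of a]
  have "card (insert (a + 1) (S \<inter> ?P)) = Suc (card (S \<inter> ?P))"
    by (subst card_insert_disjoint) auto
  moreover have "initial_segment (insert (a + 1) (S \<inter> ?P)) (insert (a + 1) ?P) \<longleftrightarrow>
      initial_segment (S \<inter> ?P) ?P"
    by (auto simp: initial_segment_def)
  moreover have "initial_segment (S \<inter> ?P) (insert (a + 1) ?P) \<longleftrightarrow> S \<inter> ?P = {}"
    by (auto simp: initial_segment_def)
  ultimately show ?thesis
    unfolding block_weight_def free_block_def interval
    by (cases "a + 1 \<in> S") simp_all
qed

lemma block_functional_F_coeff_rec:
  assumes "0 < k"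
  shows "block_functional k s (F_coeff S \<epsilon> a) =
    of_nat k * of_bool (free_block S \<epsilon> a k s) -
    (\<Sum>t\<in>{1..<k}. of_bool (free_block S \<epsilon> a t s) * block_functional (k - t) s (F_coeff S \<epsilon> (a + t)))"
  by (subst block_functional_rec[OF assms]) (simp add: block_functional_scale)

lemma block_functional_F_coeff_Suc:
  assumes "0 < k"
  shows "block_functional (Suc k) s (F_coeff S \<epsilon> a) =
    (if \<epsilon> (a + 1) \<noteq> s then 0
     else if a + 1 \<in> S then - block_functional k s (F_coeff S \<epsilon> (a + 1))
     else of_bool (free_block S \<epsilon> (a + 1) k s))"
proof -
  have split: "(\<Sum>t\<in>{1..<Suc k}. f t) = f 1 + (\<Sum>t\<in>{1..<k}. f (Suc t))" for f :: "nat \<Rightarrow> complex"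
    using assms by (simp add: sum.atLeast_Suc_lessThan sum.shift_bounds_Suc_ivl del: sum.op_ivl_Suc)
  have "block_functional (Suc k) s (F_coeff S \<epsilon> a) =
      of_nat (Suc k) * of_bool (free_block S \<epsilon> a (Suc k) s) -
      (of_bool (\<epsilon> (a + 1) = s) * block_functional k s (F_coeff S \<epsilon> (a + 1)) +
       (\<Sum>t\<in>{1..<k}. of_bool (free_block S \<epsilon> a (Suc t) s) *
          block_functional (k - t) s (F_coeff S \<epsilon> (a + 1 + t))))"
    by (subst block_functional_F_coeff_rec, simp, subst split)
      (simp only: free_block_Suc_0 diff_zero diff_Suc_Suc add_Suc_right add_Suc
          One_nat_def add_0_right)
  moreover have "block_functional k s (F_coeff S \<epsilon> (a + 1)) +
      (\<Sum>t\<in>{1..<k}. of_bool (free_block S \<epsilon> (a + 1) t s) *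
          block_functional (k - t) s (F_coeff S \<epsilon> (a + 1 + t))) =
      of_nat k * of_bool (free_block S \<epsilon> (a + 1) k s)"
    by (simp add: block_functional_F_coeff_rec[OF assms])
  ultimately show ?thesis
    using assms by (auto simp: free_block_Suc algebra_simps eq_neg_iff_add_eq_0)
qed

lemma block_functional_F_coeff:
  assumes "0 < k"
  shows "block_functional k s (F_coeff S \<epsilon> a) = block_weight S \<epsilon> a k s"
  using assms
proof (induction k arbitrary: a rule: nat_induct_non_zero)
  case 1
  show ?case
    by (simp add: block_functional_F_coeff_rec block_weight_Suc_0 free_block_Suc_0)
next
  case (Suc k)
  then show ?case
    by (simp add: block_functional_F_coeff_Suc block_weight_Suc)
qed

lemma weight_functional_F_coeff_Cons:
  assumes "0 < k"
  shows "weight_functional ((k, e) # \<gamma>) (F_coeff S \<epsilon> a) =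
    (\<Sum>s\<in>UNIV. sign_pairing e s * block_weight S \<epsilon> a k s) *
      weight_functional \<gamma> (F_coeff S \<epsilon> (a + k))"
proof -
  have "block_functional k s (\<lambda>c. weight_functional \<gamma> (\<lambda>\<tau>. F_coeff S \<epsilon> a (c @ \<tau>))) =
      block_functional k s (\<lambda>c. weight_functional \<gamma> (F_coeff S \<epsilon> (a + k)) * F_coeff S \<epsilon> a c)" for s
    by (intro block_functional_cong)
      (simp add: F_coeff_append weight_functional_scale signed_compositions_def)
  then have "block_functional k s (\<lambda>c. weight_functional \<gamma> (\<lambda>\<tau>. F_coeff S \<epsilon> a (c @ \<tau>))) =
      weight_functional \<gamma> (F_coeff S \<epsilon> (a + k)) * block_weight S \<epsilon> a k s" for s
    by (simp only: block_functional_scale block_functional_F_coeff[OF assms])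
  then show ?thesis
    by (simp add: sum_distrib_left mult_ac)
qed

lemma weight_functional_F_coeff:
  assumes "\<forall>p\<in>set \<gamma>. 0 < fst p"
  shows "weight_functional \<gamma> (F_coeff S \<epsilon> a) =
    (\<Prod>i<length \<gamma>. \<Sum>s\<in>UNIV. sign_pairing (snd (\<gamma> ! i)) s *
       block_weight S \<epsilon> (a + partial_sum \<gamma> i) (fst (\<gamma> ! i)) s)"
  using assms
proof (induction \<gamma> arbitrary: a)
  case (Cons p \<gamma>)
  then show ?case
    by (cases p)
      (simp add: weight_functional_F_coeff_Cons prod.lessThan_Suc_shift partial_sum_def add.assoc
        del: prod.lessThan_Suc weight_functional.simps)
qed simp

lemma partial_sum_0 [simp]: "partial_sum \<gamma> 0 = 0"
  by (simp add: partial_sum_def)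

lemma partial_sum_length: "\<gamma> \<in> signed_compositions n \<Longrightarrow> partial_sum \<gamma> (length \<gamma>) = n"
  by (simp add: partial_sum_def signed_compositions_def)

lemma partial_sum_Suc:
  "i < length \<gamma> \<Longrightarrow> partial_sum \<gamma> (Suc i) = partial_sum \<gamma> i + fst (\<gamma> ! i)"
  by (simp add: partial_sum_def take_Suc_conv_app_nth)

lemma partial_sum_mono: "mono (partial_sum \<gamma>)"
  unfolding mono_iff_le_Suc
proof
  fix i show "partial_sum \<gamma> i \<le> partial_sum \<gamma> (Suc i)"
    by (cases "i < length \<gamma>") (simp_all add: partial_sum_Suc, simp add: partial_sum_def)
qed

lemma crossing_step:
  fixes f :: "nat \<Rightarrow> 'a::linorder"
  assumes "f 0 < x" and "x \<le> f m"
  obtains i where "i < m" "f i < x" "x \<le> f (Suc i)"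
proof -
  have "\<exists>i<m. f i < x \<and> x \<le> f (Suc i)"
    using assms(2)
  proof (induction m)
    case 0
    with assms(1) show ?case by simp
  next
    case (Suc m)
    then show ?case by (cases "x \<le> f m") (auto intro: less_SucI)
  qed
  then show ?thesis using that by blast
qed

definition inner_block :: "signed_composition \<Rightarrow> nat \<Rightarrow> nat set" where
  "inner_block \<gamma> i = {partial_sum \<gamma> i + 1..<partial_sum \<gamma> (i + 1)}"

lemma partial_sum_notin_inner_block: "partial_sum \<gamma> m \<notin> inner_block \<gamma> i"
proof (cases "m \<le> i")
  case True
  from monoD[OF partial_sum_mono[of \<gamma>] this] show ?thesis by (simp add: inner_block_def)
next
  case False
  then have "i + 1 \<le> m" by simp
  from monoD[OF partial_sum_mono[of \<gamma>] this] show ?thesis by (simp add: inner_block_def)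
qed

lemma disjoint_inner_blocks: "i \<noteq> j \<Longrightarrow> inner_block \<gamma> i \<inter> inner_block \<gamma> j = {}"
proof (induction i j rule: linorder_wlog)
  case (le i j)
  then have "i + 1 \<le> j" by simp
  from monoD[OF partial_sum_mono[of \<gamma>] this] show ?case by (auto simp: inner_block_def)
qed (simp add: Int_commute)

lemma diff_partial_sums_eq_UN:
  assumes "\<gamma> \<in> signed_compositions n" and "S \<subseteq> {1..n}"
  shows "S - partial_sums \<gamma> = (\<Union>i<length \<gamma>. S \<inter> inner_block \<gamma> i)"
proof (intro equalityI subsetI)
  fix x assume x: "x \<in> S - partial_sums \<gamma>"
  then have "partial_sum \<gamma> 0 < x" "x \<le> partial_sum \<gamma> (length \<gamma>)"
    using assms by (auto simp: partial_sum_length)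
  then obtain i where i: "i < length \<gamma>" "partial_sum \<gamma> i < x" "x \<le> partial_sum \<gamma> (Suc i)"
    by (rule crossing_step)
  moreover from i(1) x have "x \<noteq> partial_sum \<gamma> (Suc i)"
    by (auto simp: partial_sums_def)
  ultimately have "x \<in> S \<inter> inner_block \<gamma> i"
    using x by (simp add: inner_block_def)
  with i(1) show "x \<in> (\<Union>i<length \<gamma>. S \<inter> inner_block \<gamma> i)" by blast
qed (use partial_sum_notin_inner_block in \<open>auto simp: partial_sums_def\<close>)

lemma card_diff_partial_sums:
  assumes "\<gamma> \<in> signed_compositions n" and "S \<subseteq> {1..n}"
  shows "card (S - partial_sums \<gamma>) = (\<Sum>i<length \<gamma>. card (S \<inter> inner_block \<gamma> i))"
  unfolding diff_partial_sums_eq_UN[OF assms]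
proof (rule card_UN_disjoint)
  show "\<forall>i\<in>{..<length \<gamma>}. finite (S \<inter> inner_block \<gamma> i)"
    by (simp add: inner_block_def)
  show "\<forall>i\<in>{..<length \<gamma>}. \<forall>j\<in>{..<length \<gamma>}. i \<noteq> j \<longrightarrow>
      S \<inter> inner_block \<gamma> i \<inter> (S \<inter> inner_block \<gamma> j) = {}"
    using disjoint_inner_blocks by blast
qed simp

lemma sum_sign_pairing_block_weight:
  assumes "0 < k"
  shows "(\<Sum>s\<in>UNIV. sign_pairing e s * block_weight S \<epsilon> a k s) =
    (if initial_segment (S \<inter> {a + 1..<a + k}) {a + 1..<a + k} \<and> (\<exists>s. \<forall>j\<in>{a + 1..a + k}. \<epsilon> j = s)
     then (- 1) ^ card (S \<inter> {a + 1..<a + k}) *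
       (if (\<forall>j\<in>{a + 1..a + k}. \<epsilon> j = Minus) \<and> e = Minus then - 1 else 1)
     else 0)"
proof (cases "\<exists>s. \<forall>j\<in>{a + 1..a + k}. \<epsilon> j = s")
  case True
  then obtain s where s: "\<forall>j\<in>{a + 1..a + k}. \<epsilon> j = s" by blast
  have "(\<forall>j\<in>{a + 1..a + k}. \<epsilon> j = s') \<longleftrightarrow> s = s'" for s'
    using s assms by (auto dest: bspec[of _ _ "a + 1"])
  with True show ?thesis
    unfolding block_weight_def sum_UNIV_sign
    by (cases s; cases e) (simp_all add: sign_pairing_def)
next
  case False
  then have "block_weight S \<epsilon> a k s = 0" for s
    by (auto simp: block_weight_def)
  with False show ?thesis by (subst if_not_P) simp_all
qed

lemma prod_if_else_0:
  fixes f :: "'i \<Rightarrow> 'a::comm_semiring_1"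
  assumes "finite I"
  shows "(\<Prod>i\<in>I. if P i then f i else 0) = (if \<forall>i\<in>I. P i then \<Prod>i\<in>I. f i else 0)"
  using assms by (auto intro!: prod_zero)

lemma weight_functional_eq_wt:
  assumes \<gamma>: "\<gamma> \<in> signed_compositions n" and \<sigma>: "\<sigma> \<in> signed_sets n"
  shows "weight_functional \<gamma> (F_coeff (fst \<sigma>) (sign_vector \<sigma>) 0) = of_int (wt \<gamma> \<sigma>)"
proof -
  define admissible where "admissible = (\<lambda>i.
    initial_segment (fst \<sigma> \<inter> inner_block \<gamma> i) (inner_block \<gamma> i) \<and>
    (\<exists>e. \<forall>j\<in>block \<gamma> i. sign_vector \<sigma> j = e))"
  define twice_negative where "twice_negative = (\<lambda>i.
    (\<forall>j\<in>block \<gamma> i. sign_vector \<sigma> j = Minus) \<and> snd (\<gamma> ! i) = Minus)"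
  have "weight_functional \<gamma> (F_coeff (fst \<sigma>) (sign_vector \<sigma>) 0) =
      (\<Prod>i<length \<gamma>. if admissible i
         then (- 1) ^ card (fst \<sigma> \<inter> inner_block \<gamma> i) *
               (if twice_negative i then - 1 else 1) else 0)"
    using \<gamma>
    by (subst weight_functional_F_coeff)
      (auto simp: signed_compositions_def sum_sign_pairing_block_weight partial_sum_Suc
        inner_block_def block_def admissible_def twice_negative_def intro!: prod.cong)
  also have "\<dots> = (if \<forall>i<length \<gamma>. admissible i
      then (- 1) ^ (\<Sum>i<length \<gamma>. card (fst \<sigma> \<inter> inner_block \<gamma> i)) *
        (- 1) ^ card {i. i < length \<gamma> \<and> twice_negative i} else 0)"
    by (simp add: prod_if_else_0 prod.distrib prod.If_cases power_sum lessThan_def Int_def)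
  also have "(\<Sum>i<length \<gamma>. card (fst \<sigma> \<inter> inner_block \<gamma> i)) = card (fst \<sigma> - partial_sums \<gamma>)"
    using \<sigma> by (subst card_diff_partial_sums[OF \<gamma>]) (auto simp: signed_sets_def)
  also have "(\<forall>i<length \<gamma>. admissible i) \<longleftrightarrow>
      unimodal \<gamma> \<sigma> \<and> (\<forall>i<length \<gamma>. \<exists>e. \<forall>j\<in>block \<gamma> i. sign_vector \<sigma> j = e)"
    by (auto simp: admissible_def unimodal_def inner_block_def Let_def)
  finally show ?thesis
    by (simp add: wt_def twice_negative_def power_add)
qed

section \<open>Coloring sums\<close>

lemma sum_Pow_insert:
  fixes f :: "'d set \<Rightarrow> 'a::comm_monoid_add"
  assumes "finite D" and "d \<notin> D"
  shows "(\<Sum>A\<in>Pow (insert d D). f A) = (\<Sum>A\<in>Pow D. f A) + (\<Sum>A\<in>Pow D. f (insert d A))"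
proof -
  have "inj_on (insert d) (Pow D)"
    using assms(2) by (auto intro!: inj_onI simp: insert_ident subset_iff)
  moreover have "Pow D \<inter> insert d ` Pow D = {}"
    using assms(2) by auto
  ultimately show ?thesis
    using assms(1) by (simp add: Pow_insert sum.union_disjoint sum.reindex)
qed

lemma sum_Pow_swap_subset:
  fixes f :: "'d set \<Rightarrow> 'd set \<Rightarrow> 'a::comm_monoid_add"
  assumes "finite D"
  shows "(\<Sum>A\<in>Pow D. \<Sum>B\<in>Pow (D - A). f A B) = (\<Sum>C\<in>Pow D. \<Sum>A\<in>Pow C. f A (C - A))"
proof -
  have "(\<Sum>A\<in>Pow D. \<Sum>B\<in>Pow (D - A). f A B) = (\<Sum>(A, B)\<in>(SIGMA A:Pow D. Pow (D - A)). f A B)"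
    using assms by (intro sum.Sigma) auto
  also have "\<dots> = (\<Sum>(C, A)\<in>(SIGMA C:Pow D. Pow C). f A (C - A))"
    by (rule sum.reindex_bij_witness[where i = "\<lambda>(C, A). (A, C - A)" and j = "\<lambda>(A, B). (A \<union> B, A)"])
      (auto intro!: arg_cong[where f = "f _"])
  also have "\<dots> = (\<Sum>C\<in>Pow D. \<Sum>A\<in>Pow C. f A (C - A))"
    using assms by (intro sum.Sigma[symmetric]) (auto intro: finite_subset)
  finally show ?thesis .
qed

definition type_size :: "('d \<Rightarrow> nat \<times> sign) \<Rightarrow> 'd set \<Rightarrow> nat" where
  "type_size ty A = (\<Sum>d\<in>A. fst (ty d))"

definition type_sign :: "('d \<Rightarrow> nat \<times> sign) \<Rightarrow> sign \<Rightarrow> 'd set \<Rightarrow> complex" where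
  "type_sign ty s A = (\<Prod>d\<in>A. sign_pairing (snd (ty d)) s)"

lemma type_size_empty [simp]: "type_size ty {} = 0"
  by (simp add: type_size_def)

lemma type_size_insert [simp]:
  "finite A \<Longrightarrow> d \<notin> A \<Longrightarrow> type_size ty (insert d A) = fst (ty d) + type_size ty A"
  by (simp add: type_size_def)

lemma type_sign_insert [simp]:
  "finite A \<Longrightarrow> d \<notin> A \<Longrightarrow> type_sign ty s (insert d A) = sign_pairing (snd (ty d)) s * type_sign ty s A"
  by (simp add: type_sign_def)

lemma type_size_Diff:
  "finite D \<Longrightarrow> A \<subseteq> D \<Longrightarrow> type_size ty (D - A) = type_size ty D - type_size ty A"
  by (simp add: type_size_def sum_diff_nat finite_subset)

lemma type_size_mono: "finite D \<Longrightarrow> A \<subseteq> D \<Longrightarrow> type_size ty A \<le> type_size ty D"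
  by (simp add: type_size_def sum_mono2)

lemma type_size_eq_0_iff:
  "finite D \<Longrightarrow> \<forall>d\<in>D. 0 < fst (ty d) \<Longrightarrow> type_size ty D = 0 \<longleftrightarrow> D = {}"
  by (auto simp: type_size_def)

lemma type_size_less:
  assumes "finite D" and "\<forall>d\<in>D. 0 < fst (ty d)" and "A \<subset> D"
  shows "type_size ty A < type_size ty D"
proof -
  from assms(3) obtain d where "d \<in> D - A" by blast
  with assms show ?thesis
    unfolding type_size_def by (intro sum_strict_mono2[of D A d]) auto
qed

lemma type_sign_split:
  "finite D \<Longrightarrow> A \<subseteq> D \<Longrightarrow> type_sign ty s (D - A) * type_sign ty s A = type_sign ty s D"
  by (simp add: type_sign_def prod.subset_diff)

fun coloring_sum :: "('d \<Rightarrow> nat \<times> sign) \<Rightarrow> signed_composition \<Rightarrow> 'd set \<Rightarrow> complex" where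
  "coloring_sum ty [] D = of_bool (D = {})"
| "coloring_sum ty ((t, s) # \<tau>) D =
     (\<Sum>A\<in>Pow D. of_bool (type_size ty A = t) * type_sign ty s A * coloring_sum ty \<tau> (D - A))"

lemma coloring_sum_append:
  assumes "finite D"
  shows "coloring_sum ty (c @ \<tau>) D =
    (\<Sum>A\<in>Pow D. coloring_sum ty c A * coloring_sum ty \<tau> (D - A))"
  using assms
proof (induction c arbitrary: D)
  case Nil
  have "(\<Sum>A\<in>Pow D. coloring_sum ty [] A * coloring_sum ty \<tau> (D - A)) =
      (\<Sum>A\<in>Pow D. if A = {} then coloring_sum ty \<tau> D else 0)"
    by (rule sum.cong) auto
  with Nil show ?case by simp
next
  case (Cons p c)
  obtain t s where p: "p = (t, s)" by force
  define weight where "weight A = of_bool (type_size ty A = t) * type_sign ty s A" for A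
  have "coloring_sum ty ((p # c) @ \<tau>) D =
      (\<Sum>A\<in>Pow D. \<Sum>B\<in>Pow (D - A).
         weight A * coloring_sum ty c B * coloring_sum ty \<tau> (D - A - B))"
    using Cons by (simp add: p weight_def sum_distrib_left mult.assoc)
  also have "\<dots> = (\<Sum>C\<in>Pow D. \<Sum>A\<in>Pow C.
         weight A * coloring_sum ty c (C - A) * coloring_sum ty \<tau> (D - A - (C - A)))"
    using Cons.prems by (rule sum_Pow_swap_subset)
  also have "\<dots> = (\<Sum>C\<in>Pow D. coloring_sum ty (p # c) C * coloring_sum ty \<tau> (D - C))"
    unfolding p coloring_sum.simps weight_def[symmetric] sum_distrib_right
    by (intro sum.cong refl) (auto intro!: arg_cong[where f = "coloring_sum ty \<tau>"])
  finally show ?case .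
qed

lemma coloring_sum_single:
  assumes "finite D"
  shows "coloring_sum ty [(t, s)] D = of_bool (type_size ty D = t) * type_sign ty s D"
proof -
  have "coloring_sum ty [(t, s)] D =
      (\<Sum>A\<in>Pow D. if A = D then of_bool (type_size ty D = t) * type_sign ty s D else 0)"
    unfolding coloring_sum.simps by (rule sum.cong) auto
  with assms show ?thesis by simp
qed

lemma coloring_sum_eq_0:
  assumes "finite D" and "type_size ty D \<noteq> sum_list (map fst \<tau>)"
  shows "coloring_sum ty \<tau> D = 0"
  using assms
proof (induction \<tau> arbitrary: D)
  case (Cons p \<tau>)
  obtain t s where p: "p = (t, s)" by force
  have "coloring_sum ty \<tau> (D - A) = 0" if "A \<subseteq> D" "type_size ty A = t" for A
    using that Cons.prems type_size_mono[OF Cons.prems(1) that(1), of ty]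
    by (intro Cons.IH) (auto simp: p type_size_Diff)
  then show ?case
    unfolding p coloring_sum.simps by (intro sum.neutral) auto
qed auto

lemma block_functional_coloring_sum_rec:
  assumes D: "finite D" "D \<noteq> {}" and pos: "\<forall>d\<in>D. 0 < fst (ty d)"
  shows "block_functional (type_size ty D) s (\<lambda>c. coloring_sum ty c D) =
    of_nat (type_size ty D) * type_sign ty s D -
    (\<Sum>A\<in>Pow D - {{}, D}. type_sign ty s (D - A) *
       block_functional (type_size ty A) s (\<lambda>c. coloring_sum ty c A))"
proof -
  define k where "k = type_size ty D"
  have k: "0 < k" using type_size_eq_0_iff[OF D(1) pos] D(2) by (simp add: k_def)
  let ?bf = "\<lambda>k D. block_functional k s (\<lambda>c. coloring_sum ty c D)"
  have proper: "type_size ty A \<in> {1..<k} \<longleftrightarrow> A \<noteq> {} \<and> A \<noteq> D" if "A \<subseteq> D" for A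
  proof -
    have "type_size ty A = 0 \<longleftrightarrow> A = {}"
      using that D(1) pos by (intro type_size_eq_0_iff) (auto intro: finite_subset)
    moreover have "A \<noteq> D \<Longrightarrow> type_size ty A < k"
      using that type_size_less[OF D(1) pos, of A] by (auto simp: k_def)
    ultimately show ?thesis by (auto simp: k_def Suc_le_eq)
  qed
  have "(\<Sum>t\<in>{1..<k}. block_functional (k - t) s (\<lambda>c. coloring_sum ty ((t, s) # c) D)) =
      (\<Sum>t\<in>{1..<k}. \<Sum>A\<in>Pow D.
         if type_size ty A = t then type_sign ty s A * ?bf (k - t) (D - A) else 0)"
    by (intro sum.cong refl) (auto simp: block_functional_linear intro!: sum.cong)
  also have "\<dots> = (\<Sum>A\<in>Pow D. if type_size ty A \<in> {1..<k}
       then type_sign ty s A * ?bf (k - type_size ty A) (D - A) else 0)"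
    by (subst sum.swap) (simp add: sum.delta)
  also have "\<dots> = (\<Sum>A\<in>Pow D - {{}, D}. type_sign ty s A * ?bf (type_size ty (D - A)) (D - A))"
    using D(1) proper
    by (intro sum.mono_neutral_cong_right) (auto simp: k_def type_size_Diff)
  also have "\<dots> = (\<Sum>A\<in>Pow D - {{}, D}. type_sign ty s (D - A) * ?bf (type_size ty A) A)"
    by (rule sum.reindex_bij_witness[where i = "\<lambda>A. D - A" and j = "\<lambda>A. D - A"])
      (auto simp: double_diff)
  finally show ?thesis
    using k D(1)
    by (simp add: k_def block_functional_rec[of "type_size ty D"] coloring_sum_single
        del: coloring_sum.simps)
qed

text \<open>
  Unless \<open>D\<close> is a singleton, the contribution \<open>type_size ty D\<close> of the composition with one part
  cancels against those of the subsets with one element.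
\<close>

lemma block_functional_coloring_sum_type_size:
  assumes "finite D" and "D \<noteq> {}" and "\<forall>d\<in>D. 0 < fst (ty d)"
  shows "block_functional (type_size ty D) s (\<lambda>c. coloring_sum ty c D) =
    (if card D = 1 then of_nat (type_size ty D) * type_sign ty s D else 0)"
  using assms
proof (induction D rule: finite_psubset_induct)
  case (psubset D)
  let ?proper = "Pow D - {{}, D}"
  have fin: "finite A" if "A \<subseteq> D" for A
    using that psubset.hyps finite_subset by blast
  have "(\<Sum>A\<in>?proper. type_sign ty s (D - A) *
        block_functional (type_size ty A) s (\<lambda>c. coloring_sum ty c A)) =
      (\<Sum>A\<in>?proper. if card A = 1 then of_nat (type_size ty A) * type_sign ty s D else 0)"
  proof (intro sum.cong refl)
    fix A assume A: "A \<in> ?proper"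
    then have "block_functional (type_size ty A) s (\<lambda>c. coloring_sum ty c A) =
        (if card A = 1 then of_nat (type_size ty A) * type_sign ty s A else 0)"
      using psubset.prems(2) by (intro psubset.IH) blast+
    with A show "type_sign ty s (D - A) *
        block_functional (type_size ty A) s (\<lambda>c. coloring_sum ty c A) =
        (if card A = 1 then of_nat (type_size ty A) * type_sign ty s D else 0)"
      using type_sign_split[OF psubset.hyps, of A ty s] by auto
  qed
  also have "\<dots> = (\<Sum>A\<in>{A \<in> ?proper. card A = 1}. of_nat (type_size ty A) * type_sign ty s D)"
    using psubset.hyps by (simp add: sum.If_cases Int_def)
  also have "\<dots> = (if card D = 1 then 0 else of_nat (type_size ty D) * type_sign ty s D)"
  proof (cases "card D = 1")
    case True
    then have none: "{A \<in> ?proper. card A = 1} = {}" by (auto simp: card_1_singleton_iff)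
    show ?thesis unfolding none using True by simp
  next
    case False
    then have "{A \<in> ?proper. card A = 1} = (\<lambda>d. {d}) ` D"
      by (auto simp: card_1_singleton_iff)
    then have "(\<Sum>A\<in>{A \<in> ?proper. card A = 1}. of_nat (type_size ty A) * type_sign ty s D) =
        (\<Sum>d\<in>D. of_nat (fst (ty d)) * type_sign ty s D)"
      by (simp add: sum.reindex)
    with False show ?thesis
      by (simp add: type_size_def sum_distrib_right)
  qed
  finally show ?case
    by (simp add: block_functional_coloring_sum_rec[OF psubset.hyps psubset.prems])
qed

lemma block_functional_coloring_sum:
  assumes "0 < k" and "finite D" and "\<forall>d\<in>D. 0 < fst (ty d)"
  shows "block_functional k s (\<lambda>c. coloring_sum ty c D) =
    (if card D = 1 \<and> type_size ty D = k then of_nat k * type_sign ty s D else 0)"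
proof (cases "type_size ty D = k")
  case True
  with assms(1) have "D \<noteq> {}" by auto
  from block_functional_coloring_sum_type_size[OF assms(2) this assms(3)] True show ?thesis by simp
next
  case False
  then have "block_functional k s (\<lambda>c. coloring_sum ty c D) = 0"
    by (intro block_functional_eq_0 coloring_sum_eq_0 assms(2)) (simp add: signed_compositions_def)
  with False show ?thesis by simp
qed

lemma sum_sign_pairing_block_functional_coloring_sum:
  assumes "0 < k" and "finite D" and "\<forall>d\<in>D. 0 < fst (ty d)"
  shows "(\<Sum>s\<in>UNIV. sign_pairing e s * block_functional k s (\<lambda>c. coloring_sum ty c D)) =
    (if \<exists>d. D = {d} \<and> ty d = (k, e) then 2 * of_nat k else 0)"
proof (cases "card D = 1 \<and> type_size ty D = k")
  case True
  then obtain d where d: "D = {d}" "fst (ty d) = k"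
    by (auto simp: card_1_singleton_iff type_size_def)
  have "(\<Sum>s\<in>UNIV. sign_pairing e s * block_functional k s (\<lambda>c. coloring_sum ty c D)) =
      of_nat k * (\<Sum>s\<in>UNIV. sign_pairing e s * sign_pairing (snd (ty d)) s)"
    using True assms d
    by (simp add: block_functional_coloring_sum type_sign_def sum_distrib_left mult.left_commute)
  also have "\<dots> = (if ty d = (k, e) then 2 * of_nat k else 0)"
    unfolding sign_pairing_orthogonal using d by (cases "ty d") auto
  finally show ?thesis using d by simp
next
  case False
  then have "\<not> (\<exists>d. D = {d} \<and> ty d = (k, e))" by (auto simp: type_size_def)
  with False show ?thesis
    using assms
    by (simp only: block_functional_coloring_sum if_False mult_zero_right sum.neutral_const)
qed

lemma weight_functional_coloring_sum_Cons:
  assumes "0 < k" and "finite D" and "\<forall>d\<in>D. 0 < fst (ty d)"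
  shows "weight_functional ((k, e) # \<gamma>) (\<lambda>\<tau>. coloring_sum ty \<tau> D) =
    (\<Sum>d | d \<in> D \<and> ty d = (k, e).
       2 * of_nat k * weight_functional \<gamma> (\<lambda>\<tau>. coloring_sum ty \<tau> (D - {d})))"
proof -
  define W where "W A = weight_functional \<gamma> (\<lambda>\<tau>. coloring_sum ty \<tau> A)" for A
  have "(\<lambda>c. weight_functional \<gamma> (\<lambda>\<tau>. coloring_sum ty (c @ \<tau>) D)) =
      (\<lambda>c. \<Sum>A\<in>Pow D. W (D - A) * coloring_sum ty c A)"
    by (simp add: coloring_sum_append[OF assms(2)] weight_functional_linear W_def mult.commute)
  then have "weight_functional ((k, e) # \<gamma>) (\<lambda>\<tau>. coloring_sum ty \<tau> D) =
      (\<Sum>A\<in>Pow D. W (D - A) *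
        (\<Sum>s\<in>UNIV. sign_pairing e s * block_functional k s (\<lambda>c. coloring_sum ty c A)))"
    by (simp add: block_functional_linear sum_distrib_left mult.left_commute)
      (rule sum.swap)
  also have "\<dots> = (\<Sum>A\<in>Pow D. if \<exists>d. A = {d} \<and> ty d = (k, e) then 2 * of_nat k * W (D - A) else 0)"
    using assms finite_subset[of _ D]
    by (intro sum.cong refl) (subst sum_sign_pairing_block_functional_coloring_sum; auto)
  also have "\<dots> = (\<Sum>A\<in>(\<lambda>d. {d}) ` {d \<in> D. ty d = (k, e)}. 2 * of_nat k * W (D - A))"
    using assms(2) by (intro sum.mono_neutral_cong_right) auto
  finally show ?thesis by (simp add: sum.reindex W_def)
qed

section \<open>Series given by monomial coefficients\<close>

lemma mps_coeff_sum: "mps_coeff (\<Sum>i\<in>I. f i) M = (\<Sum>i\<in>I. mps_coeff (f i) M)"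
  by (induction I rule: infinite_finite_induct) (simp_all add: zero_mps.rep_eq plus_mps.rep_eq)

lemma mps_coeff_const_times: "mps_coeff (mps_const c * f) M = c * mps_coeff f M"
proof -
  have "mps_coeff (mps_const c * f) M = (\<Sum>A | A \<subseteq># M. if A = {#} then c * mps_coeff f M else 0)"
    unfolding times_mps.rep_eq mps_const.rep_eq by (rule sum.cong) auto
  then show ?thesis by (simp add: finite_submultisets)
qed

lemma mps_const_mult: "mps_const a * mps_const b = mps_const (a * b)"
  by (rule mps_eqI) (simp add: mps_coeff_const_times, simp add: mps_const.rep_eq)

lemma mps_coeff_monomial_sum_inj:
  assumes "inj_on m I"
  shows "mps_coeff (monomial_sum I m) M = of_bool (M \<in> m ` I)"
proof (cases "M \<in> m ` I")
  case True
  then obtain i where "i \<in> I" "M = m i" by blast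
  then have "{i \<in> I. m i = M} = {i}" using assms by (auto dest: inj_onD)
  with True show ?thesis by (simp add: monomial_sum.rep_eq)
next
  case False
  then have "{i \<in> I. m i = M} = {}" by auto
  then show ?thesis using False by (simp only: monomial_sum.rep_eq) simp
qed

fun var_sign :: "var \<Rightarrow> sign" where
  "var_sign (X i) = Plus"
| "var_sign (Y i) = Minus"

fun var_index :: "var \<Rightarrow> nat" where
  "var_index (X i) = i"
| "var_index (Y i) = i"

lemma signed_var_var_sign [simp]: "signed_var (var_sign v) (var_index v) = v"
  by (cases v) (simp_all add: signed_var_def)

lemma var_sign_signed_var [simp]: "var_sign (signed_var s i) = s"
  and var_index_signed_var [simp]: "var_index (signed_var s i) = i"
  by (cases s; simp add: signed_var_def)+

lemma signed_var_eq_iff [simp]: "signed_var s i = signed_var s' i' \<longleftrightarrow> s = s' \<and> i = i'"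
  by (metis var_index_signed_var var_sign_signed_var)

fun var_rank :: "var \<Rightarrow> nat" where
  "var_rank (Y i) = 2 * i"
| "var_rank (X i) = 2 * i + 1"

lemma var_rank_eq_iff: "var_rank v = var_rank w \<longleftrightarrow> v = w"
  by (cases v; cases w) (auto, presburger+)

instantiation var :: linorder
begin

definition less_eq_var :: "var \<Rightarrow> var \<Rightarrow> bool" where
  "v \<le> w \<longleftrightarrow> var_rank v \<le> var_rank w"

definition less_var :: "var \<Rightarrow> var \<Rightarrow> bool" where
  "v < w \<longleftrightarrow> var_rank v < var_rank w"

instance
  by standard (auto simp: less_eq_var_def less_var_def var_rank_eq_iff)

end

lemma signed_var_less_iff:
  "signed_var s i < signed_var s' i' \<longleftrightarrow> i < i' \<or> i = i' \<and> s = Minus \<and> s' = Plus"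
  by (cases s; cases s') (auto simp: less_var_def signed_var_def)

lemma var_index_less: "var_index v < var_index w \<Longrightarrow> v < w"
  by (metis signed_var_less_iff signed_var_var_sign)

lemma multiset_induct_remove_Min [case_names empty add]:
  fixes M :: "'a::linorder multiset"
  assumes empty: "P {#}"
    and add: "\<And>v t N. 0 < t \<Longrightarrow> \<forall>u\<in>#N. v < u \<Longrightarrow> P N \<Longrightarrow> P (replicate_mset t v + N)"
  shows "P M"
proof (induction "card (set_mset M)" arbitrary: M rule: less_induct)
  case less
  show ?case
  proof (cases "M = {#}")
    case True
    with empty show ?thesis by simp
  next
    case False
    define v where "v = Min (set_mset M)"
    define N where "N = {#u \<in># M. u \<noteq> v#}"
    have v: "v \<in># M" using False by (simp add: v_def)
    have "M = replicate_mset (count M v) v + N"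
      by (rule multiset_eqI) (simp add: N_def)
    moreover have "\<forall>u\<in>#N. v < u"
      by (auto simp: N_def v_def less_le)
    moreover have "card (set_mset N) < card (set_mset M)"
      using v by (intro psubset_card_mono) (auto simp: N_def)
    ultimately show ?thesis
      using add[of "count M v" N v] less v by simp
  qed
qed

definition sign_pattern :: "var multiset \<Rightarrow> signed_composition" where
  "sign_pattern M = map (\<lambda>v. (count M v, var_sign v)) (sorted_list_of_set (set_mset M))"

lemma sign_pattern_empty [simp]: "sign_pattern {#} = []"
  by (simp add: sign_pattern_def)

lemma sign_pattern_replicate_add:
  assumes "0 < t" and "\<forall>u\<in>#N. v < u"
  shows "sign_pattern (replicate_mset t v + N) = (t, var_sign v) # sign_pattern N"
proof -
  have "v \<notin># N" using assms(2) by auto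
  then have "count N v = 0" by (simp add: not_in_iff)
  moreover have "sorted_list_of_set (insert v (set_mset N)) = v # sorted_list_of_set (set_mset N)"
    using assms(2) \<open>v \<notin># N\<close> by (simp add: insort_is_Cons less_imp_le)
  ultimately show ?thesis
    using assms(1) \<open>v \<notin># N\<close> by (auto simp: sign_pattern_def)
qed

lemma sign_pattern_in_signed_compositions: "sign_pattern M \<in> signed_compositions (size M)"
  by (induction M rule: multiset_induct_remove_Min)
    (simp_all add: Nil_in_signed_compositions sign_pattern_replicate_add
        Cons_in_signed_compositions)

definition monomials :: "nat \<Rightarrow> var multiset set" where
  "monomials n = {M. size M = n \<and> (\<forall>v\<in>#M. 1 \<le> var_index v)}"

lemma sign_pattern_surj:
  assumes "\<tau> \<in> signed_compositions n"
  shows "\<exists>M\<in>monomials n. sign_pattern M = \<tau>"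
proof -
  have "\<exists>M. size M = n \<and> (\<forall>v\<in>#M. a < var_index v) \<and> sign_pattern M = \<tau>" for a
    using assms
  proof (induction \<tau> arbitrary: n a)
    case Nil
    then show ?case by (simp add: Nil_in_signed_compositions)
  next
    case (Cons p \<tau>)
    obtain t s where p: "p = (t, s)" by force
    with Cons.prems have t: "0 < t" "t \<le> n" "\<tau> \<in> signed_compositions (n - t)"
      by (auto simp: Cons_in_signed_compositions)
    obtain N where N: "size N = n - t" "\<forall>v\<in>#N. a + 1 < var_index v" "sign_pattern N = \<tau>"
      using Cons.IH[OF t(3)] by blast
    define M where "M = replicate_mset t (signed_var s (a + 1)) + N"
    have "sign_pattern M = p # \<tau>"
      unfolding M_def using t(1) N(2,3)
      by (subst sign_pattern_replicate_add) (auto simp: p intro: var_index_less)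
    moreover have "size M = n" "\<forall>v\<in>#M. a < var_index v"
      using t N by (auto simp: M_def)
    ultimately show ?case by blast
  qed
  from this[of 0] show ?thesis by (auto simp: monomials_def Suc_le_eq)
qed

text \<open>
  \<open>quasisym n \<phi>\<close> is the sum of \<open>\<phi> \<tau>\<close> times the monomial quasisymmetric function of type B indexed
  by \<open>\<tau>\<close>, over the signed compositions \<open>\<tau>\<close> of \<open>n\<close>.
\<close>

lift_definition quasisym :: "nat \<Rightarrow> (signed_composition \<Rightarrow> complex) \<Rightarrow> (var, complex) mps"
  is "\<lambda>n \<phi> M. if M \<in> monomials n then \<phi> (sign_pattern M) else 0" .

lemma quasisym_sum: "(\<Sum>i\<in>I. quasisym n (\<phi> i)) = quasisym n (\<lambda>\<tau>. \<Sum>i\<in>I. \<phi> i \<tau>)"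
  by (rule mps_eqI) (simp add: mps_coeff_sum quasisym.rep_eq)

lemma mps_const_times_quasisym: "mps_const c * quasisym n \<phi> = quasisym n (\<lambda>\<tau>. c * \<phi> \<tau>)"
  by (rule mps_eqI) (simp add: mps_coeff_const_times quasisym.rep_eq)

lemma quasisym_eq_iff: "quasisym n \<phi> = quasisym n \<psi> \<longleftrightarrow> (\<forall>\<tau>\<in>signed_compositions n. \<phi> \<tau> = \<psi> \<tau>)"
proof
  assume eq: "quasisym n \<phi> = quasisym n \<psi>"
  show "\<forall>\<tau>\<in>signed_compositions n. \<phi> \<tau> = \<psi> \<tau>"
  proof
    fix \<tau> assume "\<tau> \<in> signed_compositions n"
    then obtain M where "M \<in> monomials n" "sign_pattern M = \<tau>" using sign_pattern_surj by blast
    with arg_cong[OF eq, of "\<lambda>f. mps_coeff f M"] show "\<phi> \<tau> = \<psi> \<tau>" by (simp add: quasisym.rep_eq)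
  qed
next
  assume "\<forall>\<tau>\<in>signed_compositions n. \<phi> \<tau> = \<psi> \<tau>"
  then show "quasisym n \<phi> = quasisym n \<psi>"
    using sign_pattern_in_signed_compositions
    by (intro mps_eqI) (auto simp: quasisym.rep_eq monomials_def)
qed

section \<open>Products of power sums\<close>

lemma replicate_mset_eq_iff_pos:
  "0 < k \<Longrightarrow> replicate_mset k v = replicate_mset k w \<longleftrightarrow> v = w"
  by (auto simp: replicate_mset_eq_iff)

lemma coeff_power_sum:
  assumes "0 < k"
  shows "mps_coeff (power_sum e k) M =
    of_bool (\<exists>i\<ge>1. M = replicate_mset k (X i)) +
    sign_pairing e Minus * of_bool (\<exists>i\<ge>1. M = replicate_mset k (Y i))"
proof -
  have "mps_coeff (monomial_sum {1..} (\<lambda>i. replicate_mset k (f i)) :: (var, complex) mps) M =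
      of_bool (\<exists>i\<ge>1. M = replicate_mset k (f i))" if "inj f" for f :: "nat \<Rightarrow> var"
  proof (subst mps_coeff_monomial_sum_inj)
    show "inj_on (\<lambda>i. replicate_mset k (f i)) {1..}"
      using assms that by (auto intro!: inj_onI simp: replicate_mset_eq_iff_pos dest: injD)
  qed (auto simp: image_iff)
  moreover have "inj X" "inj Y" by (auto intro: injI)
  ultimately show ?thesis
    by (cases e)
      (simp_all add: power_sum_def Let_def plus_mps.rep_eq minus_mps.rep_eq sign_pairing_def)
qed

lemma coeff_power_sum_replicate:
  assumes "0 < k"
  shows "mps_coeff (power_sum e k) (replicate_mset k v) =
    (if 1 \<le> var_index v then sign_pairing e (var_sign v) else 0)"
  using assms
  by (cases v) (auto simp: coeff_power_sum replicate_mset_eq_iff_pos sign_pairing_def)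

lemma coeff_power_sum_times:
  assumes "0 < k"
  shows "mps_coeff (power_sum e k * f) M =
    (\<Sum>v | v \<in># M \<and> 1 \<le> var_index v \<and> k \<le> count M v.
       sign_pairing e (var_sign v) * mps_coeff f (M - replicate_mset k v))"
proof -
  let ?V = "{v. v \<in># M \<and> 1 \<le> var_index v \<and> k \<le> count M v}"
  have inj: "inj_on (replicate_mset k) ?V"
    using assms by (auto intro: inj_onI simp: replicate_mset_eq_iff_pos)
  have sub: "replicate_mset k ` ?V \<subseteq> {A. A \<subseteq># M}"
    by (auto simp: count_le_replicate_mset_subset_eq)
  have zero: "mps_coeff (power_sum e k) A = 0" if A: "A \<subseteq># M" "A \<notin> replicate_mset k ` ?V" for A
  proof -
    have "A \<noteq> replicate_mset k v" if "1 \<le> var_index v" for v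
    proof
      assume v: "A = replicate_mset k v"
      with A(1) have "k \<le> count M v" by (simp add: count_le_replicate_mset_subset_eq)
      moreover from this assms have "v \<in># M" by (auto simp flip: count_greater_zero_iff)
      ultimately show False using A(2) v that by blast
    qed
    then have "\<not> (\<exists>i\<ge>1. A = replicate_mset k (X i))" "\<not> (\<exists>i\<ge>1. A = replicate_mset k (Y i))"
      by force+
    then show ?thesis
      unfolding coeff_power_sum[OF assms] by (simp only: of_bool_eq) simp
  qed
  have "mps_coeff (power_sum e k * f) M =
      (\<Sum>A | A \<subseteq># M. mps_coeff (power_sum e k) A * mps_coeff f (M - A))"
    by (simp add: times_mps.rep_eq)
  also have "\<dots> = (\<Sum>A\<in>replicate_mset k ` ?V. mps_coeff (power_sum e k) A * mps_coeff f (M - A))"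
    using sub zero by (intro sum.mono_neutral_right) (auto simp: finite_submultisets)
  also have "\<dots> = (\<Sum>v\<in>?V. sign_pairing e (var_sign v) * mps_coeff f (M - replicate_mset k v))"
    using assms by (subst sum.reindex[OF inj]) (simp add: coeff_power_sum_replicate)
  finally show ?thesis .
qed

lemma coeff_power_sum_times_replicate_add:
  assumes "0 < k" and "v \<notin># N" and "1 \<le> var_index v"
  shows "mps_coeff (power_sum e k * f) (replicate_mset t v + N) =
    (if k \<le> t
     then sign_pairing e (var_sign v) * mps_coeff f (replicate_mset (t - k) v + N) else 0) +
    (\<Sum>u | u \<in># N \<and> 1 \<le> var_index u \<and> k \<le> count N u.
       sign_pairing e (var_sign u) * mps_coeff f (replicate_mset t v + (N - replicate_mset k u)))"
proof -
  let ?M = "replicate_mset t v + N"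
  let ?V = "{u. u \<in># N \<and> 1 \<le> var_index u \<and> k \<le> count N u}"
  let ?g = "\<lambda>u. sign_pairing e (var_sign u) * mps_coeff f (?M - replicate_mset k u)"
  have count_v: "count N v = 0" using assms(2) by (simp add: not_in_iff)
  have V: "{u. u \<in># ?M \<and> 1 \<le> var_index u \<and> k \<le> count ?M u} = (if k \<le> t then {v} else {}) \<union> ?V"
    using assms count_v by (auto split: if_splits)
  have "finite ?V" by (rule finite_subset[of _ "set_mset N"]) auto
  then have "mps_coeff (power_sum e k * f) ?M = (if k \<le> t then ?g v else 0) + (\<Sum>u\<in>?V. ?g u)"
    unfolding coeff_power_sum_times[OF assms(1)] V using assms(2) by (subst sum.union_disjoint) auto
  also have "?M - replicate_mset k v = replicate_mset (t - k) v + N" if "k \<le> t"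
    using that count_v by (intro multiset_eqI) auto
  then have "(if k \<le> t then ?g v else 0) =
      (if k \<le> t
       then sign_pairing e (var_sign v) * mps_coeff f (replicate_mset (t - k) v + N) else 0)"
    by simp
  also have "(\<Sum>u\<in>?V. ?g u) = (\<Sum>u\<in>?V. sign_pairing e (var_sign u) *
      mps_coeff f (replicate_mset t v + (N - replicate_mset k u)))"
  proof (intro sum.cong refl)
    fix u assume "u \<in> ?V"
    with assms(2) have "?M - replicate_mset k u = replicate_mset t v + (N - replicate_mset k u)"
      by (intro multiset_eqI) auto
    then show "?g u = sign_pairing e (var_sign u) *
        mps_coeff f (replicate_mset t v + (N - replicate_mset k u))" by simp
  qed
  finally show ?thesis .
qed

definition power_sum_prod :: "('d \<Rightarrow> nat \<times> sign) \<Rightarrow> 'd set \<Rightarrow> (var, complex) mps" where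
  "power_sum_prod ty D = (\<Prod>d\<in>D. power_sum (snd (ty d)) (fst (ty d)))"

lemma power_sum_prod_empty [simp]: "power_sum_prod ty {} = 1"
  by (simp add: power_sum_prod_def)

lemma power_sum_prod_insert [simp]:
  "finite D \<Longrightarrow> d \<notin> D \<Longrightarrow>
     power_sum_prod ty (insert d D) = power_sum (snd (ty d)) (fst (ty d)) * power_sum_prod ty D"
  by (simp add: power_sum_prod_def)

lemma power_sum_prod_insert_Diff:
  assumes "finite D" and "d \<notin> D" and "A \<subseteq> D"
  shows "power_sum_prod ty (insert d D - A) =
    power_sum (snd (ty d)) (fst (ty d)) * power_sum_prod ty (D - A)"
proof -
  have "insert d D - A = insert d (D - A)" using assms by auto
  then show ?thesis using assms by simp
qed

lemma coeff_power_sum_prod_eq_0: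
  assumes "finite D" and "\<forall>d\<in>D. 0 < fst (ty d)" and "M \<notin> monomials (type_size ty D)"
  shows "mps_coeff (power_sum_prod ty D) M = 0"
  using assms
proof (induction D arbitrary: M rule: finite_induct)
  case empty
  then show ?case by (auto simp: monomials_def one_mps.rep_eq)
next
  case (insert d D)
  let ?k = "fst (ty d)"
  have "mps_coeff (power_sum_prod ty D) (M - replicate_mset ?k v) = 0"
    if v: "1 \<le> var_index v" "?k \<le> count M v" for v
  proof (rule insert.IH)
    from v(2) have M: "M = replicate_mset ?k v + (M - replicate_mset ?k v)"
      by (simp add: count_le_replicate_mset_subset_eq)
    show "M - replicate_mset ?k v \<notin> monomials (type_size ty D)"
    proof
      assume "M - replicate_mset ?k v \<in> monomials (type_size ty D)"
      with v(1) have "replicate_mset ?k v + (M - replicate_mset ?k v) \<in>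
          monomials (?k + type_size ty D)"
        by (auto simp: monomials_def simp del: add_mset_replicate_mset_safe)
      with insert show False by (simp flip: M)
    qed
  qed (use insert.prems in auto)
  then show ?case
    using insert by (simp add: coeff_power_sum_times)
qed

lemma sum_coeff_power_sum_times:
  assumes "0 < k"
  shows "(\<Sum>u | u \<in># N \<and> 1 \<le> var_index u \<and> k \<le> count N u. sign_pairing e (var_sign u) *
      (\<Sum>A\<in>I. c A * mps_coeff (g A) (N - replicate_mset k u))) =
    (\<Sum>A\<in>I. c A * mps_coeff (power_sum e k * g A) N)"
  unfolding coeff_power_sum_times[OF assms] sum_distrib_left
  by (subst sum.swap) (simp only: mult.left_commute)

lemma coeff_power_sum_prod_replicate_add:
  assumes "finite D" and "\<forall>d\<in>D. 0 < fst (ty d)" and "v \<notin># N" and "1 \<le> var_index v"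
  shows "mps_coeff (power_sum_prod ty D) (replicate_mset t v + N) =
    (\<Sum>A\<in>Pow D. of_bool (type_size ty A = t) * type_sign ty (var_sign v) A *
       mps_coeff (power_sum_prod ty (D - A)) N)"
  using assms(1-3)
proof (induction D arbitrary: N t rule: finite_induct)
  case empty
  then show ?case
    by (auto simp: type_sign_def one_mps.rep_eq)
next
  case (insert d D)
  obtain k e where d: "ty d = (k, e)" by force
  have k: "0 < k" using insert.prems(1) d by simp
  define weight where "weight t A = of_bool (type_size ty A = t) * type_sign ty (var_sign v) A"
    for t A
  have IH: "mps_coeff (power_sum_prod ty D) (replicate_mset t v + N) =
      (\<Sum>A\<in>Pow D. weight t A * mps_coeff (power_sum_prod ty (D - A)) N)" if "v \<notin># N" for t N
    unfolding weight_def using insert.prems(1) that by (intro insert.IH) auto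
  have weight_insert: "weight t (insert d A) =
      (if k \<le> t then sign_pairing e (var_sign v) * weight (t - k) A else 0)" if "A \<subseteq> D" for A
  proof -
    have "finite A" "d \<notin> A" using that insert.hyps finite_subset by auto
    then show ?thesis by (auto simp: weight_def d)
  qed
  have "v \<notin># N - replicate_mset k u" for u
    using insert.prems(2) by (meson in_diffD)
  then have "mps_coeff (power_sum_prod ty (insert d D)) (replicate_mset t v + N) =
      (if k \<le> t then sign_pairing e (var_sign v) *
        (\<Sum>A\<in>Pow D. weight (t - k) A * mps_coeff (power_sum_prod ty (D - A)) N) else 0) +
      (\<Sum>A\<in>Pow D. weight t A * mps_coeff (power_sum e k * power_sum_prod ty (D - A)) N)"
    using insert.hyps
    by (simp only: power_sum_prod_insert d fst_conv snd_conv IH insert.prems(2) not_False_eq_True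
        coeff_power_sum_times_replicate_add[OF k insert.prems(2) assms(4)]
        sum_coeff_power_sum_times[OF k])
  also have "(if k \<le> t then sign_pairing e (var_sign v) *
        (\<Sum>A\<in>Pow D. weight (t - k) A * mps_coeff (power_sum_prod ty (D - A)) N) else 0) =
      (\<Sum>A\<in>Pow D. weight t (insert d A) * mps_coeff (power_sum_prod ty (D - A)) N)"
    by (simp add: weight_insert sum_distrib_left mult.assoc)
  also have "\<dots> = (\<Sum>A\<in>Pow D. weight t (insert d A) *
      mps_coeff (power_sum_prod ty (insert d D - insert d A)) N)"
    using insert.hyps(2) by (intro sum.cong refl) (simp add: insert_Diff_if Diff_insert_absorb)
  also have "(\<Sum>A\<in>Pow D. weight t A * mps_coeff (power_sum e k * power_sum_prod ty (D - A)) N) =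
      (\<Sum>A\<in>Pow D. weight t A * mps_coeff (power_sum_prod ty (insert d D - A)) N)"
    by (simp add: power_sum_prod_insert_Diff[OF insert.hyps] d)
  finally show ?case
    by (simp only: weight_def sum_Pow_insert[OF insert.hyps] add.commute)
qed

lemma coeff_power_sum_prod:
  assumes "finite D" and "\<forall>d\<in>D. 0 < fst (ty d)" and "\<forall>v\<in>#M. 1 \<le> var_index v"
  shows "mps_coeff (power_sum_prod ty D) M = coloring_sum ty (sign_pattern M) D"
  using assms
proof (induction M arbitrary: D rule: multiset_induct_remove_Min)
  case empty
  show ?case
  proof (cases "D = {}")
    case False
    with empty have "{#} \<notin> monomials (type_size ty D)"
      by (simp add: monomials_def type_size_eq_0_iff)
    with False empty show ?thesis by (simp add: coeff_power_sum_prod_eq_0)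
  qed (simp add: one_mps.rep_eq)
next
  case (add v t N)
  then have v: "v \<notin># N" "1 \<le> var_index v" by auto
  have "mps_coeff (power_sum_prod ty (D - A)) N = coloring_sum ty (sign_pattern N) (D - A)" for A
    using add.prems by (intro add.IH) auto
  then show ?case
    using coeff_power_sum_prod_replicate_add[OF add.prems(1,2) v, of t]
    by (simp add: sign_pattern_replicate_add add.hyps)
qed

lemma power_sum_prod_eq_quasisym:
  assumes "finite D" and "\<forall>d\<in>D. 0 < fst (ty d)"
  shows "power_sum_prod ty D = quasisym (type_size ty D) (\<lambda>\<tau>. coloring_sum ty \<tau> D)"
  using assms
  by (intro mps_eqI)
    (auto simp: quasisym.rep_eq coeff_power_sum_prod coeff_power_sum_prod_eq_0 monomials_def)

section \<open>The series of a signed set\<close>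

lemma signed_setsD:
  assumes "\<sigma> \<in> signed_sets n"
  shows "n \<in> fst \<sigma>" and "fst \<sigma> \<subseteq> {1..n}" and "snd \<sigma> \<in> fst \<sigma> \<rightarrow>\<^sub>E UNIV" and "finite (fst \<sigma>)"
  using assms finite_subset[of "fst \<sigma>" "{1..n}"] by (auto simp: signed_sets_def)

lemma sign_vector_member:
  assumes "\<sigma> \<in> signed_sets n" and "s \<in> fst \<sigma>"
  shows "sign_vector \<sigma> s = snd \<sigma> s"
proof -
  have "Min {t \<in> fst \<sigma>. s \<le> t} = s"
    using assms(2) signed_setsD(4)[OF assms(1)] by (intro Min_eqI) auto
  then show ?thesis by (simp add: sign_vector_def case_prod_unfold)
qed

lemma sign_vector_Suc:
  assumes "j \<notin> fst \<sigma>"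
  shows "sign_vector \<sigma> (Suc j) = sign_vector \<sigma> j"
proof -
  have "{t \<in> fst \<sigma>. Suc j \<le> t} = {t \<in> fst \<sigma>. j \<le> t}"
    using assms by (auto simp: Suc_le_eq order_le_less)
  then show ?thesis by (simp only: sign_vector_def case_prod_unfold)
qed

lemma wDes_eq:
  assumes "\<sigma> \<in> signed_sets n"
  shows "wDes \<sigma> = {j \<in> fst \<sigma>. j < n \<and> (sign_vector \<sigma> j = sign_vector \<sigma> (Suc j) \<or>
    (sign_vector \<sigma> j = Plus \<and> sign_vector \<sigma> (Suc j) = Minus))}"
proof -
  note S = signed_setsD[OF assms]
  have "Max (fst \<sigma>) = n" using S by (intro Max_eqI) auto
  moreover have "sign_vector \<sigma> (Suc s) = snd \<sigma> (Min {t \<in> fst \<sigma>. s < t})" for s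
    by (simp add: sign_vector_def case_prod_unfold Suc_le_eq)
  ultimately show ?thesis
    using S(2) by (auto simp: wDes_def case_prod_unfold Let_def sign_vector_member[OF assms])
qed

lemma finite_signed_sets: "finite (signed_sets n)"
proof (rule finite_subset)
  show "signed_sets n \<subseteq> (SIGMA S:Pow {1..n}. S \<rightarrow>\<^sub>E UNIV)"
    by (auto simp: signed_sets_def)
  show "finite (SIGMA S:Pow {1..n}. S \<rightarrow>\<^sub>E (UNIV :: sign set))"
    by (intro finite_SigmaI finite_PiE) (auto intro: finite_subset simp: UNIV_sign)
qed

lemma signed_set_eqI:
  assumes \<sigma>: "\<sigma> \<in> signed_sets n" and \<tau>: "\<tau> \<in> signed_sets n" and "fst \<sigma> = fst \<tau>"
    and "\<forall>j\<in>{1..n}. sign_vector \<sigma> j = sign_vector \<tau> j"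
  shows "\<sigma> = \<tau>"
proof -
  have "snd \<sigma> s = snd \<tau> s" if "s \<in> fst \<sigma>" for s
    using that assms(3,4) signed_setsD(2)[OF \<sigma>] sign_vector_member[OF \<sigma>] sign_vector_member[OF \<tau>]
    by force
  then have "snd \<sigma> = snd \<tau>"
    using signed_setsD(3)[OF \<sigma>] signed_setsD(3)[OF \<tau>] assms(3) by (intro PiE_ext) auto
  with assms(3) show ?thesis by (simp add: prod_eq_iff)
qed

fun word_matches :: "nat set \<Rightarrow> (nat \<Rightarrow> sign) \<Rightarrow> nat \<Rightarrow> var list \<Rightarrow> bool" where
  "word_matches S \<epsilon> a [] \<longleftrightarrow> True"
| "word_matches S \<epsilon> a (x # xs) \<longleftrightarrow>
     var_sign x = \<epsilon> (a + 1) \<and> (xs \<noteq> [] \<and> a + 1 \<in> S \<longrightarrow> x \<noteq> hd xs) \<and> word_matches S \<epsilon> (a + 1) xs"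

lemma word_matches_iff_nth:
  "word_matches S \<epsilon> a xs \<longleftrightarrow>
     (\<forall>i<length xs. var_sign (xs ! i) = \<epsilon> (a + i + 1)) \<and>
     (\<forall>i. Suc i < length xs \<and> a + i + 1 \<in> S \<longrightarrow> xs ! i \<noteq> xs ! Suc i)"
proof (induction xs arbitrary: a)
  case (Cons x xs)
  have all: "(\<forall>i. P i) \<longleftrightarrow> P 0 \<and> (\<forall>i. P (Suc i))" for P
    by (metis not0_implies_Suc)
  show ?case
    by (subst (1 2) all) (auto simp: Cons.IH hd_conv_nth)
qed simp

lemma word_matches_replicate_append:
  assumes "xs = [] \<or> hd xs \<noteq> v"
  shows "word_matches S \<epsilon> a (replicate (Suc t) v @ xs) \<longleftrightarrow>
    free_block S \<epsilon> a (Suc t) (var_sign v) \<and> word_matches S \<epsilon> (a + Suc t) xs"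
proof (induction t arbitrary: a)
  case 0
  then show ?case using assms by (auto simp: free_block_Suc_0)
next
  case (Suc t)
  have "word_matches S \<epsilon> a (replicate (Suc (Suc t)) v @ xs) \<longleftrightarrow>
      var_sign v = \<epsilon> (a + 1) \<and> a + 1 \<notin> S \<and> word_matches S \<epsilon> (a + 1) (replicate (Suc t) v @ xs)"
    by auto
  also have "\<dots> \<longleftrightarrow>
      free_block S \<epsilon> a (Suc (Suc t)) (var_sign v) \<and> word_matches S \<epsilon> (a + Suc (Suc t)) xs"
    unfolding Suc.IH free_block_Suc[OF zero_less_Suc] by auto
  finally show ?case .
qed

lemma sorted_list_of_multiset_replicate_add:
  assumes "\<forall>u\<in>#N. v \<le> u"
  shows "sorted_list_of_multiset (replicate_mset t v + N) =
      replicate t v @ sorted_list_of_multiset N"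
proof -
  let ?xs = "replicate t v @ sorted_list_of_multiset N"
  have "sorted ?xs" using assms by (auto simp: sorted_append)
  then have "sorted_list_of_multiset (mset ?xs) = ?xs"
    unfolding sorted_list_of_multiset_mset by (rule sorted_sort_id)
  then show ?thesis by simp
qed

lemma F_coeff_sign_pattern:
  "F_coeff S \<epsilon> a (sign_pattern M) = of_bool (word_matches S \<epsilon> a (sorted_list_of_multiset M))"
proof (induction M arbitrary: a rule: multiset_induct_remove_Min)
  case (add v t N)
  obtain t' where t: "t = Suc t'" using add.hyps(1) gr0_implies_Suc by blast
  have "sorted_list_of_multiset N = [] \<or> hd (sorted_list_of_multiset N) \<noteq> v"
    using add.hyps(2) hd_in_set[of "sorted_list_of_multiset N"] by auto
  then have "word_matches S \<epsilon> a (sorted_list_of_multiset (replicate_mset t v + N)) \<longleftrightarrow>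
      free_block S \<epsilon> a t (var_sign v) \<and> word_matches S \<epsilon> (a + t) (sorted_list_of_multiset N)"
    using add.hyps(2) unfolding t
    by (subst sorted_list_of_multiset_replicate_add)
      (auto simp: word_matches_replicate_append simp del: replicate_Suc)
  then show ?case
    by (simp only: sign_pattern_replicate_add[OF add.hyps(1,2)] F_coeff.simps add.IH of_bool_conj)
qed simp

definition index_word :: "nat \<Rightarrow> signed_set \<Rightarrow> (nat \<Rightarrow> nat) \<Rightarrow> var list" where
  "index_word n \<sigma> i = map (\<lambda>j. signed_var (sign_vector \<sigma> j) (i j)) [1..<n + 1]"

lemma length_index_word [simp]: "length (index_word n \<sigma> i) = n"
  by (simp add: index_word_def)

lemma nth_index_word [simp]:
  "k < n \<Longrightarrow> index_word n \<sigma> i ! k = signed_var (sign_vector \<sigma> (Suc k)) (i (Suc k))"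
  by (simp add: index_word_def del: upt_Suc)

lemma set_index_word: "set (index_word n \<sigma> i) = (\<lambda>j. signed_var (sign_vector \<sigma> j) (i j)) ` {1..n}"
  by (simp add: index_word_def atLeastLessThanSuc_atLeastAtMost del: upt_Suc)

lemma mset_index_word:
  "mset (index_word n \<sigma> i) = image_mset (\<lambda>j. signed_var (sign_vector \<sigma> j) (i j)) (mset_set {1..n})"
proof -
  have "mset [1..<n + 1] = mset_set {1..n}"
    by (simp add: mset_upt atLeastLessThanSuc_atLeastAtMost del: upt_Suc)
  then show ?thesis by (simp only: index_word_def mset_map)
qed

text \<open>
  Thanks to the order \<open>Y i < X i\<close> every element of the signed set forces a strict increase of the
  variable, but a strict increase of the index at the weak descents only.
\<close>

lemma sorted_matching_index_word_iff:
  assumes "\<sigma> \<in> signed_sets n"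
  shows "sorted (index_word n \<sigma> i) \<and> word_matches (fst \<sigma>) (sign_vector \<sigma>) 0 (index_word n \<sigma> i) \<longleftrightarrow>
    (\<forall>j\<in>{1..<n}. i j \<le> i (j + 1)) \<and> (\<forall>j\<in>wDes \<sigma>. i j < i (j + 1))"
proof -
  let ?v = "\<lambda>j. signed_var (sign_vector \<sigma> j) (i j)"
  have step: "?v j \<le> ?v (Suc j) \<and> (j \<in> fst \<sigma> \<longrightarrow> ?v j \<noteq> ?v (Suc j)) \<longleftrightarrow>
      i j \<le> i (Suc j) \<and> (j \<in> wDes \<sigma> \<longrightarrow> i j < i (Suc j))" if "j < n" for j
  proof (cases "j \<in> fst \<sigma>")
    case True
    with that show ?thesis
      unfolding wDes_eq[OF assms] le_less signed_var_less_iff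
      by (cases "sign_vector \<sigma> j"; cases "sign_vector \<sigma> (Suc j)") auto
  next
    case False
    then show ?thesis
      unfolding wDes_eq[OF assms] le_less signed_var_less_iff by (auto simp: sign_vector_Suc)
  qed
  have "sorted (index_word n \<sigma> i) \<and> word_matches (fst \<sigma>) (sign_vector \<sigma>) 0 (index_word n \<sigma> i) \<longleftrightarrow>
      (\<forall>k. Suc k < n \<longrightarrow> ?v (Suc k) \<le> ?v (Suc (Suc k)) \<and>
        (Suc k \<in> fst \<sigma> \<longrightarrow> ?v (Suc k) \<noteq> ?v (Suc (Suc k))))"
    by (auto simp: sorted_iff_nth_Suc word_matches_iff_nth)
  also have "\<dots> \<longleftrightarrow> (\<forall>j\<in>{1..<n}. i j \<le> i (Suc j) \<and> (j \<in> wDes \<sigma> \<longrightarrow> i j < i (Suc j)))"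
  proof -
    have "(\<forall>j\<in>{1..<n}. Q j) \<longleftrightarrow> (\<forall>k. Suc k < n \<longrightarrow> Q (Suc k))" for Q
      by (auto simp: Suc_le_eq gr0_conv_Suc)
    then show ?thesis
      by (simp only:) (intro arg_cong[where f = All] ext imp_cong refl step; simp)
  qed
  also have "\<dots> \<longleftrightarrow> (\<forall>j\<in>{1..<n}. i j \<le> i (j + 1)) \<and> (\<forall>j\<in>wDes \<sigma>. i j < i (j + 1))"
    using signed_setsD(2)[OF assms] by (auto simp: wDes_eq[OF assms])
  finally show ?thesis .
qed

lemma index_word_surj:
  assumes "length w = n" and "\<forall>v\<in>set w. 1 \<le> var_index v" and "word_matches S (sign_vector \<sigma>) 0 w"
  shows "\<exists>i\<in>{1..n} \<rightarrow>\<^sub>E {1..}. index_word n \<sigma> i = w"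
proof
  let ?i = "restrict (\<lambda>j. var_index (w ! (j - 1))) {1..n}"
  show "index_word n \<sigma> ?i = w"
  proof (rule nth_equalityI)
    fix k assume "k < length (index_word n \<sigma> ?i)"
    then have "k < n" by simp
    moreover from this have "var_sign (w ! k) = sign_vector \<sigma> (Suc k)"
      using assms(1,3) by (simp add: word_matches_iff_nth)
    ultimately show "index_word n \<sigma> ?i ! k = w ! k" using signed_var_var_sign[of "w ! k"] by simp
  qed (simp add: assms(1))
  show "?i \<in> {1..n} \<rightarrow>\<^sub>E {1..}"
    using assms(1,2) by (auto simp: Suc_le_eq)
qed

lemma inj_on_index_word: "inj_on (index_word n \<sigma>) ({1..n} \<rightarrow>\<^sub>E A)"
proof (rule inj_onI)
  fix i i' assume ext: "i \<in> {1..n} \<rightarrow>\<^sub>E A" "i' \<in> {1..n} \<rightarrow>\<^sub>E A"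
    and eq: "index_word n \<sigma> i = index_word n \<sigma> i'"
  have "i j = i' j" if "j \<in> {1..n}" for j
    using that eq by (simp add: index_word_def del: upt_Suc)
  with ext show "i = i'" by (rule PiE_ext)
qed

lemma coeff_F:
  assumes "\<sigma> \<in> signed_sets n"
  shows "mps_coeff (F n \<sigma>) M =
    of_bool (M \<in> monomials n \<and> word_matches (fst \<sigma>) (sign_vector \<sigma>) 0 (sorted_list_of_multiset M))"
proof -
  let ?matches = "word_matches (fst \<sigma>) (sign_vector \<sigma>) 0"
  define I where "I =
      {i \<in> {1..n} \<rightarrow>\<^sub>E {1..}. sorted (index_word n \<sigma> i) \<and> ?matches (index_word n \<sigma> i)}"
  have sort: "sort (index_word n \<sigma> i) = index_word n \<sigma> i" if "i \<in> I" for i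
    using that by (simp add: I_def sorted_sort_id)
  have "inj_on (\<lambda>i. mset (index_word n \<sigma> i)) I"
  proof (rule inj_onI)
    fix i i' assume I: "i \<in> I" "i' \<in> I" and "mset (index_word n \<sigma> i) = mset (index_word n \<sigma> i')"
    then have "index_word n \<sigma> i = index_word n \<sigma> i'"
      by (metis sort sorted_list_of_multiset_mset)
    with I show "i = i'"
      by (intro inj_onD[OF inj_on_index_word]) (auto simp: I_def)
  qed
  moreover have "F n \<sigma> = monomial_sum I (\<lambda>i. mset (index_word n \<sigma> i))"
    unfolding F_def I_def sorted_matching_index_word_iff[OF assms] mset_index_word ..
  ultimately have "mps_coeff (F n \<sigma>) M = of_bool (M \<in> (\<lambda>i. mset (index_word n \<sigma> i)) ` I)"
    by (simp add: mps_coeff_monomial_sum_inj)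
  also have "M \<in> (\<lambda>i. mset (index_word n \<sigma> i)) ` I \<longleftrightarrow>
      M \<in> monomials n \<and> ?matches (sorted_list_of_multiset M)"
  proof
    assume "M \<in> (\<lambda>i. mset (index_word n \<sigma> i)) ` I"
    then obtain i where "i \<in> I" "M = mset (index_word n \<sigma> i)" by blast
    then show "M \<in> monomials n \<and> ?matches (sorted_list_of_multiset M)"
      using sort by (auto simp: I_def monomials_def set_index_word)
  next
    assume M: "M \<in> monomials n \<and> ?matches (sorted_list_of_multiset M)"
    then have "length (sorted_list_of_multiset M) = n"
      "\<forall>v\<in>set (sorted_list_of_multiset M). 1 \<le> var_index v"
      by (auto simp: monomials_def simp flip: size_mset)
    with M obtain i where "i \<in> {1..n} \<rightarrow>\<^sub>E {1..}" "index_word n \<sigma> i = sorted_list_of_multiset M"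
      using index_word_surj by blast
    with M have "i \<in> I" "M = mset (index_word n \<sigma> i)" by (simp_all add: I_def)
    then show "M \<in> (\<lambda>i. mset (index_word n \<sigma> i)) ` I" by blast
  qed
  finally show ?thesis .
qed

lemma F_eq_quasisym:
  assumes "\<sigma> \<in> signed_sets n"
  shows "F n \<sigma> = quasisym n (F_coeff (fst \<sigma>) (sign_vector \<sigma>) 0)"
  by (rule mps_eqI) (simp add: coeff_F[OF assms] quasisym.rep_eq F_coeff_sign_pattern)

definition coarsenings :: "nat \<Rightarrow> signed_set \<Rightarrow> signed_set set" where
  "coarsenings n \<tau> =
     {\<sigma> \<in> signed_sets n. fst \<sigma> \<subseteq> fst \<tau> \<and> (\<forall>j\<in>{1..n}. sign_vector \<sigma> j = sign_vector \<tau> j)}"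

text \<open>\<open>M\<close> comes from the word whose index increases exactly at the elements of \<open>\<tau>\<close>.\<close>

lemma coeff_F_indicates_coarsenings:
  assumes \<tau>: "\<tau> \<in> signed_sets n"
  obtains M where "\<And>\<sigma>. \<sigma> \<in> signed_sets n \<Longrightarrow> mps_coeff (F n \<sigma>) M = of_bool (\<sigma> \<in> coarsenings n \<tau>)"
proof
  define c where "c j = 1 + card {s \<in> fst \<tau>. s < j}" for j
  let ?w = "index_word n \<tau> c"
  have c_Suc: "c (Suc j) = c j + of_bool (j \<in> fst \<tau>)" for j
  proof -
    have "{s \<in> fst \<tau>. s < Suc j} = {s \<in> fst \<tau>. s < j} \<union> (if j \<in> fst \<tau> then {j} else {})"
      by (auto simp: less_Suc_eq)
    then show ?thesis using signed_setsD(4)[OF \<tau>] by (simp add: c_def)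
  qed
  have "sorted ?w \<and> word_matches (fst \<tau>) (sign_vector \<tau>) 0 ?w"
    unfolding sorted_matching_index_word_iff[OF \<tau>] by (auto simp: c_Suc wDes_eq[OF \<tau>])
  then have sort: "sort ?w = ?w"
    by (simp add: sorted_sort_id)
  have M: "mset ?w \<in> monomials n" by (auto simp: monomials_def set_index_word c_def)
  have rise: "?w ! k \<noteq> ?w ! Suc k \<longleftrightarrow> Suc k \<in> fst \<tau>" if "Suc k < n" for k
    using that by (cases "Suc k \<in> fst \<tau>") (simp_all add: c_Suc sign_vector_Suc)
  fix \<sigma> assume \<sigma>: "\<sigma> \<in> signed_sets n"
  have "(\<forall>k. Suc k < n \<and> Suc k \<in> fst \<sigma> \<longrightarrow> Suc k \<in> fst \<tau>) \<longleftrightarrow> fst \<sigma> \<subseteq> fst \<tau>"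
  proof
    assume inner: "\<forall>k. Suc k < n \<and> Suc k \<in> fst \<sigma> \<longrightarrow> Suc k \<in> fst \<tau>"
    show "fst \<sigma> \<subseteq> fst \<tau>"
    proof
      fix s assume s: "s \<in> fst \<sigma>"
      then obtain k where "s = Suc k" "Suc k \<le> n"
        using signed_setsD(2)[OF \<sigma>] by (cases s) auto
      with s inner signed_setsD(1)[OF \<tau>] show "s \<in> fst \<tau>"
        by (cases "Suc k = n") auto
    qed
  qed auto
  moreover have "(\<forall>k<n. sign_vector \<tau> (Suc k) = sign_vector \<sigma> (Suc k)) \<longleftrightarrow>
      (\<forall>j\<in>{1..n}. sign_vector \<sigma> j = sign_vector \<tau> j)"
    unfolding image_Suc_lessThan[symmetric] by auto
  ultimately have "word_matches (fst \<sigma>) (sign_vector \<sigma>) 0 ?w \<longleftrightarrow> \<sigma> \<in> coarsenings n \<tau>"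
    using rise \<sigma> by (auto simp: word_matches_iff_nth coarsenings_def)
  with M show "mps_coeff (F n \<sigma>) (mset ?w) = of_bool (\<sigma> \<in> coarsenings n \<tau>)"
    by (simp add: coeff_F[OF \<sigma>] sort)
qed

lemma triangular_sums_eqD:
  fixes f g :: "'i \<Rightarrow> 'a::cancel_comm_monoid_add" and m :: "'i \<Rightarrow> nat"
  assumes R: "\<And>j. j \<in> J \<Longrightarrow> finite (R j) \<and> j \<in> R j \<and> R j \<subseteq> J"
    and smaller: "\<And>i j. j \<in> J \<Longrightarrow> i \<in> R j \<Longrightarrow> i \<noteq> j \<Longrightarrow> m i < m j"
    and eq: "\<And>j. j \<in> J \<Longrightarrow> (\<Sum>i\<in>R j. f i) = (\<Sum>i\<in>R j. g i)"
    and "j \<in> J"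
  shows "f j = g j"
  using \<open>j \<in> J\<close>
proof (induction "m j" arbitrary: j rule: less_induct)
  case less
  have "(\<Sum>i\<in>R j - {j}. f i) = (\<Sum>i\<in>R j - {j}. g i)"
    using R[OF less.prems] smaller[OF less.prems] by (intro sum.cong refl less.hyps) auto
  then show ?case
    using R[OF less.prems] eq[OF less.prems] sum.remove[of "R j" j f] sum.remove[of "R j" j g]
    by simp
qed

lemma card_vimage_eq_sum:
  assumes "finite B" and "finite R"
  shows "card {b \<in> B. f b \<in> R} = (\<Sum>r\<in>R. card {b \<in> B. f b = r})"
proof -
  have "{b \<in> B. f b \<in> R} = (\<Union>r\<in>R. {b \<in> B. f b = r})" by auto
  also have "card \<dots> = (\<Sum>r\<in>R. card {b \<in> B. f b = r})"
    using assms by (intro card_UN_disjoint) auto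
  finally show ?thesis .
qed

lemma sum_F_determines_distribution:
  assumes B: "finite B" "sDes \<in> B \<rightarrow> signed_sets n"
    and B': "finite B'" "sDes' \<in> B' \<rightarrow> signed_sets n"
    and eq: "(\<Sum>b\<in>B. F n (sDes b)) = (\<Sum>b\<in>B'. F n (sDes' b))"
    and "\<sigma> \<in> signed_sets n"
  shows "card {b \<in> B. sDes b = \<sigma>} = card {b \<in> B'. sDes' b = \<sigma>}"
proof (rule triangular_sums_eqD[where R = "coarsenings n" and J = "signed_sets n"
    and m = "\<lambda>\<sigma>. card (fst \<sigma>)"])
  fix \<tau> assume \<tau>: "\<tau> \<in> signed_sets n"
  have fin: "finite (coarsenings n \<tau>)"
    using finite_signed_sets by (simp add: coarsenings_def)
  with \<tau> show "finite (coarsenings n \<tau>) \<and> \<tau> \<in> coarsenings n \<tau> \<and> coarsenings n \<tau> \<subseteq> signed_sets n"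
    by (auto simp: coarsenings_def)
  show "card (fst \<sigma>) < card (fst \<tau>)" if "\<sigma> \<in> coarsenings n \<tau>" "\<sigma> \<noteq> \<tau>" for \<sigma>
    using that signed_set_eqI[of \<sigma> n \<tau>] \<tau> signed_setsD(4)[OF \<tau>]
    by (intro psubset_card_mono) (auto simp: coarsenings_def)
  obtain M where M: "\<And>\<sigma>. \<sigma> \<in> signed_sets n \<Longrightarrow> mps_coeff (F n \<sigma>) M = of_bool (\<sigma> \<in> coarsenings n \<tau>)"
    using coeff_F_indicates_coarsenings[OF \<tau>] by blast
  have count: "mps_coeff (\<Sum>b\<in>C. F n (s b)) M = of_nat (\<Sum>\<rho>\<in>coarsenings n \<tau>. card {b \<in> C. s b = \<rho>})"
    if "finite C" "s \<in> C \<rightarrow> signed_sets n" for C :: "'x set" and s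
  proof -
    have "mps_coeff (\<Sum>b\<in>C. F n (s b)) M = (\<Sum>b\<in>C. of_bool (s b \<in> coarsenings n \<tau>))"
      unfolding mps_coeff_sum using that(2) by (intro sum.cong refl M) auto
    also have "\<dots> = of_nat (card {b \<in> C. s b \<in> coarsenings n \<tau>})"
      using that(1) by (simp add: sum_of_bool_eq Int_def)
    finally show ?thesis using that(1) fin by (simp add: card_vimage_eq_sum)
  qed
  show "(\<Sum>\<rho>\<in>coarsenings n \<tau>. card {b \<in> B. sDes b = \<rho>}) =
      (\<Sum>\<rho>\<in>coarsenings n \<tau>. card {b \<in> B'. sDes' b = \<rho>})"
    using arg_cong[OF eq, of "\<lambda>f. mps_coeff f M"] unfolding count[OF B] count[OF B'] of_nat_eq_iff .
qed fact

section \<open>Signed orbits\<close>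

lemma finite_Omega [simp]: "finite (Omega n)"
  by (simp add: Omega_def)

lemma mem_Omega_iff: "x \<in> Omega n \<longleftrightarrow> x \<noteq> 0 \<and> \<bar>x\<bar> \<le> int n"
  by (auto simp: Omega_def)

lemma uminus_mem_Omega_iff [simp]: "- x \<in> Omega n \<longleftrightarrow> x \<in> Omega n"
  by (simp add: mem_Omega_iff)

lemma card_Omega: "card (Omega n) = 2 * n"
  by (simp add: Omega_def card_Diff_singleton_if)

lemma signed_permsI: "w permutes Omega n \<Longrightarrow> (\<And>x. w (- x) = - w x) \<Longrightarrow> w \<in> signed_perms n"
  by (simp add: signed_perms_def)

lemma signed_perms_permutes: "w \<in> signed_perms n \<Longrightarrow> w permutes Omega n"
  by (simp add: signed_perms_def)

lemma signed_perms_not_in: "w \<in> signed_perms n \<Longrightarrow> x \<notin> Omega n \<Longrightarrow> w x = x"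
  by (rule permutes_not_in[OF signed_perms_permutes])

lemma signed_perms_permutation: "w \<in> signed_perms n \<Longrightarrow> permutation w"
  using signed_perms_permutes finite_Omega permutation_permutes by blast

lemma signed_perms_uminus: "w \<in> signed_perms n \<Longrightarrow> w (- x) = - w x"
  by (cases "x \<in> Omega n") (simp_all add: signed_perms_not_in, simp add: signed_perms_def)

lemma signed_perms_eq_iff: "w \<in> signed_perms n \<Longrightarrow> w x = w y \<longleftrightarrow> x = y"
  using permutes_inj[OF signed_perms_permutes] by (auto dest: injD)

lemma abs_signed_perms_eq_iff:
  assumes "w \<in> signed_perms n"
  shows "\<bar>w x\<bar> = \<bar>w y\<bar> \<longleftrightarrow> \<bar>x\<bar> = \<bar>y\<bar>"
  using signed_perms_eq_iff[OF assms, of x y] signed_perms_eq_iff[OF assms, of x "- y"]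
  by (simp add: abs_eq_iff signed_perms_uminus[OF assms])

lemma finite_signed_perms: "finite (signed_perms n)"
  unfolding signed_perms_def
  by (rule finite_subset[OF _ finite_permutations[OF finite_Omega[of n]]]) auto

lemma id_in_signed_perms: "id \<in> signed_perms n"
  by (rule signed_permsI) (auto simp: permutes_id)

lemma comp_in_signed_perms: "v \<in> signed_perms n \<Longrightarrow> w \<in> signed_perms n \<Longrightarrow> v \<circ> w \<in> signed_perms n"
  by (rule signed_permsI)
    (auto intro: permutes_compose signed_perms_permutes simp: signed_perms_uminus)

lemma funpow_in_signed_perms: "w \<in> signed_perms n \<Longrightarrow> w ^^ j \<in> signed_perms n"
  by (induction j) (simp_all add: id_in_signed_perms comp_in_signed_perms flip: id_def)

lemma inv_in_signed_perms:
  assumes "w \<in> signed_perms n"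
  shows "inv_into UNIV w \<in> signed_perms n"
proof (rule signed_permsI)
  note w = signed_perms_permutes[OF assms]
  show "inv_into UNIV w permutes Omega n" using w by (rule permutes_inv)
  show "inv_into UNIV w (- x) = - inv_into UNIV w x" for x
    by (metis assms permutes_inverses[OF w] signed_perms_uminus)
qed

lemma signed_perms_mult_sign:
  "w \<in> signed_perms n \<Longrightarrow> s \<in> {1, - 1} \<Longrightarrow> w (s * x) = s * w x"
  by (auto simp: signed_perms_uminus)

definition abs_map :: "(int \<Rightarrow> int) \<Rightarrow> int \<Rightarrow> int" where
  "abs_map w x = \<bar>w x\<bar>"

definition signed_orbit :: "(int \<Rightarrow> int) \<Rightarrow> int \<Rightarrow> int set" where
  "signed_orbit w x = {y. \<bar>y\<bar> \<in> orbit (abs_map w) \<bar>x\<bar>}"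

definition point_type :: "(int \<Rightarrow> int) \<Rightarrow> int \<Rightarrow> nat \<times> sign" where
  "point_type w x =
     (let k = funpow_dist1 (abs_map w) \<bar>x\<bar> \<bar>x\<bar> in (k, if (w ^^ k) x = x then Plus else Minus))"

definition sign_int :: "sign \<Rightarrow> int" where
  "sign_int e = (case e of Plus \<Rightarrow> 1 | Minus \<Rightarrow> - 1)"

lemma sign_int_cases: "sign_int e \<in> {1, - 1}"
  by (cases e) (simp_all add: sign_int_def)

lemma funpow_abs_map:
  assumes "w \<in> signed_perms n"
  shows "(abs_map w ^^ j) \<bar>x\<bar> = \<bar>(w ^^ j) x\<bar>"
proof (induction j)
  case (Suc j)
  then show ?case
    using abs_signed_perms_eq_iff[OF assms, of "\<bar>(w ^^ j) x\<bar>" "(w ^^ j) x"]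
    by (simp add: abs_map_def)
qed simp

lemma orbit_eq_if_mem:
  assumes "x \<in> orbit f x" and "y \<in> orbit f x"
  shows "orbit f y = orbit f x"
  using orbit_swap[OF assms] assms(2) by (intro equalityI subsetI) (rule orbit_trans, assumption+)+

lemma self_in_orbit: "w \<in> signed_perms n \<Longrightarrow> x \<in> orbit w x"
  by (rule permutation_self_in_orbit[OF signed_perms_permutation])

lemma abs_self_in_orbit:
  assumes "w \<in> signed_perms n"
  shows "\<bar>x\<bar> \<in> orbit (abs_map w) \<bar>x\<bar>"
proof -
  have "\<exists>k>0. (w ^^ k) x = x"
    using self_in_orbit[OF assms, of x] unfolding orbit_altdef by force
  then obtain k where k: "0 < k" "(w ^^ k) x = x" by blast
  from k(1) have "(abs_map w ^^ k) \<bar>x\<bar> \<in> orbit (abs_map w) \<bar>x\<bar>"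
    unfolding orbit_altdef by blast
  then show ?thesis by (simp add: funpow_abs_map[OF assms] k(2))
qed

lemma mem_signed_orbit_iff:
  assumes "w \<in> signed_perms n"
  shows "y \<in> signed_orbit w x \<longleftrightarrow> (\<exists>j. \<bar>y\<bar> = \<bar>(w ^^ j) x\<bar>)"
  by (auto simp: signed_orbit_def orbit_altdef_self_in[OF abs_self_in_orbit[OF assms]]
      funpow_abs_map[OF assms])

lemma self_in_signed_orbit: "w \<in> signed_perms n \<Longrightarrow> x \<in> signed_orbit w x"
  by (simp add: signed_orbit_def abs_self_in_orbit)

lemma signed_orbit_eq_if_mem:
  assumes "w \<in> signed_perms n" and "y \<in> signed_orbit w x"
  shows "signed_orbit w y = signed_orbit w x"
  using orbit_eq_if_mem[OF abs_self_in_orbit[OF assms(1)]] assms(2) by (simp add: signed_orbit_def)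

lemma signed_orbit_subset_Omega:
  assumes "w \<in> signed_perms n" and "x \<in> Omega n"
  shows "signed_orbit w x \<subseteq> Omega n"
proof
  fix y assume "y \<in> signed_orbit w x"
  then obtain j where "\<bar>y\<bar> = \<bar>(w ^^ j) x\<bar>" by (auto simp: mem_signed_orbit_iff[OF assms(1)])
  moreover have "(w ^^ j) x \<in> Omega n"
    using assms permutes_in_image[OF signed_perms_permutes[OF funpow_in_signed_perms]] by blast
  ultimately show "y \<in> Omega n" by (auto simp: mem_Omega_iff)
qed

lemma point_type_funpow:
  assumes "w \<in> signed_perms n" and "point_type w x = (k, e)"
  shows "0 < k" and "(w ^^ k) x = sign_int e * x"
    and "inj_on (\<lambda>j. \<bar>(w ^^ j) x\<bar>) {..<k}"
    and "orbit (abs_map w) \<bar>x\<bar> = (\<lambda>j. \<bar>(w ^^ j) x\<bar>) ` {..<k}"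
proof -
  note self = abs_self_in_orbit[OF assms(1), of x]
  have k: "k = funpow_dist1 (abs_map w) \<bar>x\<bar> \<bar>x\<bar>"
    and e: "e = (if (w ^^ k) x = x then Plus else Minus)"
    using assms(2) by (auto simp: point_type_def Let_def)
  then show "0 < k" by simp
  have "\<bar>(w ^^ k) x\<bar> = \<bar>x\<bar>"
    using funpow_dist1_prop[OF self] by (simp only: k funpow_abs_map[OF assms(1)])
  then show "(w ^^ k) x = sign_int e * x"
    by (auto simp: e sign_int_def abs_eq_iff)
  show "inj_on (\<lambda>j. \<bar>(w ^^ j) x\<bar>) {..<k}"
    using inj_on_funpow_dist1[OF self]
    by (simp only: k funpow_abs_map[OF assms(1)] lessThan_atLeast0)
  show "orbit (abs_map w) \<bar>x\<bar> = (\<lambda>j. \<bar>(w ^^ j) x\<bar>) ` {..<k}"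
    using orbit_conv_funpow_dist1[OF self]
    by (simp only: k funpow_abs_map[OF assms(1)] lessThan_atLeast0)
qed

lemma point_type_eqI:
  assumes w: "w \<in> signed_perms n" and "x \<noteq> 0"
    and k: "0 < k" "(w ^^ k) x = sign_int e * x" "\<And>j. 0 < j \<Longrightarrow> j < k \<Longrightarrow> \<bar>(w ^^ j) x\<bar> \<noteq> \<bar>x\<bar>"
  shows "point_type w x = (k, e)"
proof -
  obtain m e' where m: "point_type w x = (m, e')" by force
  note cycle = point_type_funpow[OF w m]
  have "\<bar>(w ^^ m) x\<bar> = \<bar>x\<bar>" "\<bar>(w ^^ k) x\<bar> = \<bar>x\<bar>"
    using cycle(2) k(2) sign_int_cases[of e] sign_int_cases[of e'] by auto
  then have "k = m"
    using k(1,3) cycle(1) inj_onD[OF cycle(3), of k 0]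
    by (metis funpow_0 lessThan_iff linorder_neqE_nat)
  then show ?thesis
    using m k(2) cycle(2) \<open>x \<noteq> 0\<close> by (cases e; cases e') (simp_all add: sign_int_def)
qed

lemma point_type_signed_orbit:
  assumes w: "w \<in> signed_perms n" and "x \<in> Omega n" and y: "y \<in> signed_orbit w x"
  shows "point_type w y = point_type w x"
proof -
  obtain k e where type: "point_type w x = (k, e)" by force
  note cycle = point_type_funpow[OF w type]
  obtain i where i: "\<bar>y\<bar> = \<bar>(w ^^ i) x\<bar>" using y by (auto simp: mem_signed_orbit_iff[OF w])
  note funpow = funpow_in_signed_perms[OF w]
  have comm: "(w ^^ j) ((w ^^ i) x) = (w ^^ i) ((w ^^ j) x)" for j
    by (metis add.commute comp_apply funpow_add)
  show ?thesis
    unfolding type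
  proof (rule point_type_eqI[OF w])
    show "0 < k" by (rule cycle(1))
    show "y \<noteq> 0"
      using signed_orbit_subset_Omega[OF w assms(2)] y by (auto simp: mem_Omega_iff)
    have "(w ^^ k) ((w ^^ i) x) = sign_int e * (w ^^ i) x"
      unfolding comm cycle(2) by (rule signed_perms_mult_sign[OF funpow sign_int_cases])
    then show "(w ^^ k) y = sign_int e * y"
      using i by (auto simp: abs_eq_iff signed_perms_uminus[OF funpow])
    fix j assume j: "0 < j" "j < k"
    have "\<bar>(w ^^ j) y\<bar> = \<bar>(w ^^ i) ((w ^^ j) x)\<bar>"
      using i abs_signed_perms_eq_iff[OF funpow, of j y "(w ^^ i) x"] by (simp only: comm)
    moreover have "\<bar>(w ^^ j) x\<bar> \<noteq> \<bar>(w ^^ 0) x\<bar>"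
      using j inj_onD[OF cycle(3), of j 0] by auto
    ultimately show "\<bar>(w ^^ j) y\<bar> \<noteq> \<bar>y\<bar>"
      using i by (simp add: abs_signed_perms_eq_iff[OF funpow])
  qed
qed

lemma signed_orbit_bij_betw:
  assumes w: "w \<in> signed_perms n" and type: "point_type w x = (k, e)" and "x \<noteq> 0"
  shows "bij_betw (\<lambda>(j, s). s * (w ^^ j) x) ({..<k} \<times> {1, - 1}) (signed_orbit w x)"
proof (rule bij_betw_imageI)
  note cycle = point_type_funpow[OF w type]
  have nonzero: "(w ^^ j) x \<noteq> 0" for j
    using \<open>x \<noteq> 0\<close> signed_perms_eq_iff[OF funpow_in_signed_perms[OF w], of j x 0]
      signed_perms_uminus[OF funpow_in_signed_perms[OF w], of j 0] by simp
  show "inj_on (\<lambda>(j, s). s * (w ^^ j) x) ({..<k} \<times> {1, - 1})"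
  proof (rule inj_onI)
    fix p q assume "p \<in> {..<k} \<times> {1, - 1}" "q \<in> {..<k} \<times> {1, - 1}"
      and "(case p of (j, s) \<Rightarrow> s * (w ^^ j) x) = (case q of (j, s) \<Rightarrow> s * (w ^^ j) x)"
    then obtain i s j t where p: "p = (i, s)" and q: "q = (j, t)" and ij: "i \<in> {..<k}" "j \<in> {..<k}"
      and st: "s \<in> {1, - 1}" "t \<in> {1, - 1}" and eq: "s * (w ^^ i) x = t * (w ^^ j) x"
      by auto
    have "\<bar>(w ^^ i) x\<bar> = \<bar>(w ^^ j) x\<bar>"
      using arg_cong[OF eq, of abs] st by (auto simp: abs_mult)
    then have "i = j" using ij by (rule inj_onD[OF cycle(3)])
    with p q eq nonzero show "p = q" by simp
  qed
  show "(\<lambda>(j, s). s * (w ^^ j) x) ` ({..<k} \<times> {1, - 1}) = signed_orbit w x"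
    unfolding signed_orbit_def cycle(4) by (force simp: abs_eq_iff)
qed

lemma card_signed_orbit:
  assumes "w \<in> signed_perms n" and "point_type w x = (k, e)" and "x \<noteq> 0"
  shows "card (signed_orbit w x) = 2 * k"
  using bij_betw_same_card[OF signed_orbit_bij_betw[OF assms]] by (simp add: card_cartesian_product)

definition signed_orbits :: "nat \<Rightarrow> (int \<Rightarrow> int) \<Rightarrow> int set set" where
  "signed_orbits n w = signed_orbit w ` Omega n"

definition orbit_type :: "(int \<Rightarrow> int) \<Rightarrow> int set \<Rightarrow> nat \<times> sign" where
  "orbit_type w d = point_type w (SOME x. x \<in> d)"

lemma signed_orbit_in_signed_orbits_iff:
  assumes "w \<in> signed_perms n"
  shows "signed_orbit w x \<in> signed_orbits n w \<longleftrightarrow> x \<in> Omega n"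
  using signed_orbit_subset_Omega[OF assms] self_in_signed_orbit[OF assms]
  unfolding signed_orbits_def by blast

lemma signed_orbits_memD:
  assumes w: "w \<in> signed_perms n" and d: "d \<in> signed_orbits n w" and x: "x \<in> d"
  shows "x \<in> Omega n" and "signed_orbit w x = d"
  using d x signed_orbit_subset_Omega[OF w] signed_orbit_eq_if_mem[OF w]
  unfolding signed_orbits_def by blast+

lemma orbit_type_signed_orbit:
  assumes "w \<in> signed_perms n" and "x \<in> Omega n"
  shows "orbit_type w (signed_orbit w x) = point_type w x"
  unfolding orbit_type_def
  by (rule point_type_signed_orbit[OF assms], rule someI[where P = "\<lambda>y. y \<in> signed_orbit w x"],
      rule self_in_signed_orbit[OF assms(1)])

lemma orbit_type_eq_point_type:
  "w \<in> signed_perms n \<Longrightarrow> d \<in> signed_orbits n w \<Longrightarrow> x \<in> d \<Longrightarrow> orbit_type w d = point_type w x"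
  using signed_orbits_memD orbit_type_signed_orbit by metis

lemma signed_orbitsE:
  assumes "w \<in> signed_perms n" and "d \<in> signed_orbits n w"
  obtains x where "x \<in> d" "x \<in> Omega n" "d = signed_orbit w x"
  using assms self_in_signed_orbit unfolding signed_orbits_def by blast

lemma finite_signed_orbits [simp]: "finite (signed_orbits n w)"
  by (simp add: signed_orbits_def)

lemma card_signed_orbits_elem:
  assumes "w \<in> signed_perms n" and "d \<in> signed_orbits n w"
  shows "card d = 2 * fst (orbit_type w d)"
proof -
  obtain x where "x \<in> Omega n" "d = signed_orbit w x"
    using assms by (rule signed_orbitsE)
  then show ?thesis
    using card_signed_orbit[OF assms(1), of x] orbit_type_signed_orbit[OF assms(1), of x]
    by (cases "point_type w x") (auto simp: mem_Omega_iff)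
qed

lemma finite_signed_orbits_elem: "w \<in> signed_perms n \<Longrightarrow> d \<in> signed_orbits n w \<Longrightarrow> finite d"
  using signed_orbits_memD(1) finite_Omega[of n] by (meson finite_subset subsetI)

lemma orbit_type_pos:
  assumes "w \<in> signed_perms n" and "d \<in> signed_orbits n w"
  shows "0 < fst (orbit_type w d)"
  using assms card_signed_orbits_elem[OF assms] finite_signed_orbits_elem[OF assms]
  by (metis card_gt_0_iff empty_iff mult_0_right neq0_conv signed_orbitsE)

lemma Union_signed_orbits:
  assumes "w \<in> signed_perms n"
  shows "\<Union> (signed_orbits n w) = Omega n"
  using signed_orbit_subset_Omega[OF assms] self_in_signed_orbit[OF assms]
  unfolding signed_orbits_def by blast

lemma type_size_signed_orbits:
  assumes w: "w \<in> signed_perms n"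
  shows "type_size (orbit_type w) (signed_orbits n w) = n"
proof -
  have "pairwise disjnt (signed_orbits n w)"
    unfolding pairwise_def disjnt_iff using signed_orbits_memD(2)[OF w] by metis
  then have "card (\<Union> (signed_orbits n w)) = (\<Sum>d\<in>signed_orbits n w. card d)"
    by (rule card_Union_disjoint) (rule finite_signed_orbits_elem[OF w])
  also have "\<dots> = 2 * type_size (orbit_type w) (signed_orbits n w)"
    by (simp add: type_size_def sum_distrib_left card_signed_orbits_elem[OF w])
  finally show ?thesis by (simp add: Union_signed_orbits[OF w] card_Omega)
qed

section \<open>Signed cycle types\<close>

definition split_by_sign :: "(nat \<times> sign) multiset \<Rightarrow> nat multiset \<times> nat multiset" where
  "split_by_sign \<mu> = (image_mset fst (filter_mset (\<lambda>p. snd p = Plus) \<mu>),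
     image_mset fst (filter_mset (\<lambda>p. snd p = Minus) \<mu>))"

lemma bipartition_of_eq: "bipartition_of \<gamma> = split_by_sign (mset \<gamma>)"
  by (simp add: bipartition_of_def split_by_sign_def mset_filter)

lemma split_by_sign_eq_iff: "split_by_sign \<mu> = split_by_sign \<nu> \<longleftrightarrow> \<mu> = \<nu>"
proof -
  define g where "g =
      (\<lambda>(\<alpha>, \<beta>). image_mset (\<lambda>k :: nat. (k, Plus)) \<alpha> + image_mset (\<lambda>k. (k, Minus)) \<beta>)"
  have "g (split_by_sign \<mu>) = \<mu>" for \<mu>
  proof (induction \<mu>)
    case (add p \<mu>)
    then show ?case by (cases p, cases "snd p") (auto simp: g_def split_by_sign_def)
  qed (simp add: g_def split_by_sign_def)
  then show ?thesis by metis
qed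

lemma power_sum_part_split_by_sign:
  "(case split_by_sign \<mu> of (\<alpha>, \<beta>) \<Rightarrow> power_sum_part Plus \<alpha> * power_sum_part Minus \<beta>) =
   (\<Prod>p\<in>#\<mu>. power_sum (snd p) (fst p))"
proof (induction \<mu>)
  case (add p \<mu>)
  then show ?case
    by (cases p, cases "snd p") (auto simp: split_by_sign_def power_sum_part_def mult_ac)
qed (simp add: split_by_sign_def power_sum_part_def)

lemma mem_orbit_iff:
  assumes "w \<in> signed_perms n"
  shows "y \<in> orbit w x \<longleftrightarrow> (\<exists>j. (w ^^ j) x = y)"
  unfolding orbit_altdef_permutation[OF signed_perms_permutation[OF assms]] by blast

lemma orbit_uminus:
  assumes "w \<in> signed_perms n"
  shows "orbit w (- x) = uminus ` orbit w x"
  by (rule orbit_inverse[OF self_in_orbit[OF assms], symmetric])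
    (rule signed_perms_uminus[OF assms])

lemma signed_orbit_eq_Un:
  assumes "w \<in> signed_perms n"
  shows "signed_orbit w x = orbit w x \<union> uminus ` orbit w x"
proof (rule Set.set_eqI)
  fix y
  have "y \<in> uminus ` orbit w x \<longleftrightarrow> - y \<in> orbit w x" by force
  moreover have "\<bar>y\<bar> = \<bar>z\<bar> \<longleftrightarrow> z = y \<or> z = - y" for z by linarith
  ultimately show "y \<in> signed_orbit w x \<longleftrightarrow> y \<in> orbit w x \<union> uminus ` orbit w x"
    by (simp only: mem_signed_orbit_iff[OF assms] mem_orbit_iff[OF assms] Un_iff ex_disj_distrib)
qed

lemma self_conjugate_orbit:
  assumes "w \<in> signed_perms n" and "point_type w x = (k, Minus)"
  shows "uminus ` orbit w x = orbit w x"
proof -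
  have "(w ^^ k) x = - x" using point_type_funpow(2)[OF assms] by (simp add: sign_int_def)
  then have "- x \<in> orbit w x" unfolding mem_orbit_iff[OF assms(1)] by blast
  from orbit_eq_if_mem[OF self_in_orbit[OF assms(1)] this] show ?thesis
    by (simp only: orbit_uminus[OF assms(1)])
qed

lemma positive_orbit:
  assumes w: "w \<in> signed_perms n" and type: "point_type w x = (k, Plus)" and "x \<noteq> 0"
  shows "card (orbit w x) = k" and "uminus ` orbit w x \<noteq> orbit w x"
proof -
  note cycle = point_type_funpow[OF w type]
  have "(w ^^ k) x = x" using cycle(2) by (simp add: sign_int_def)
  then have orbit: "orbit w x = (\<lambda>j. (w ^^ j) x) ` {..<k}"
    unfolding orbit_altdef_bounded[OF \<open>(w ^^ k) x = x\<close> cycle(1)] by blast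
  have "inj_on (\<lambda>j. (w ^^ j) x) {..<k}"
    using cycle(3) by (auto simp: inj_on_def)
  then show "card (orbit w x) = k" by (simp add: orbit card_image)
  show "uminus ` orbit w x \<noteq> orbit w x"
  proof
    assume "uminus ` orbit w x = orbit w x"
    then have "- x \<in> orbit w x" using self_in_orbit[OF w] by blast
    then obtain j where j: "j < k" "- x = (w ^^ j) x" by (auto simp: orbit)
    then have "\<bar>(w ^^ j) x\<bar> = \<bar>(w ^^ 0) x\<bar>" by (metis abs_minus_cancel funpow_0)
    then have "j = 0" using j(1) cycle(1) inj_onD[OF cycle(3), of j 0] by auto
    with j(2) \<open>x \<noteq> 0\<close> show False by simp
  qed
qed

lemma self_conjugate_orbit_iff:
  assumes "w \<in> signed_perms n" and "x \<in> Omega n"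
  shows "uminus ` orbit w x = orbit w x \<longleftrightarrow> snd (point_type w x) = Minus"
proof (cases "snd (point_type w x)")
  case Plus
  then have "point_type w x = (fst (point_type w x), Plus)" by (simp add: prod_eq_iff)
  from positive_orbit(2)[OF assms(1) this] Plus show ?thesis
    using assms(2) by (simp add: mem_Omega_iff)
next
  case Minus
  then have "point_type w x = (fst (point_type w x), Minus)" by (simp add: prod_eq_iff)
  from self_conjugate_orbit[OF assms(1) this] Minus show ?thesis by simp
qed

abbreviation points_of_sign :: "nat \<Rightarrow> (int \<Rightarrow> int) \<Rightarrow> sign \<Rightarrow> int set" where
  "points_of_sign n w e \<equiv> {x \<in> Omega n. snd (point_type w x) = e}"

lemma signed_orbits_of_sign:
  assumes "w \<in> signed_perms n"
  shows "{d \<in> signed_orbits n w. snd (orbit_type w d) = e} = signed_orbit w ` points_of_sign n w e"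
proof -
  have "{d \<in> signed_orbits n w. snd (orbit_type w d) = e} =
      signed_orbit w ` {x \<in> Omega n. snd (orbit_type w (signed_orbit w x)) = e}"
    unfolding signed_orbits_def by blast
  then show ?thesis by (simp add: orbit_type_signed_orbit[OF assms] cong: conj_cong)
qed

lemma negative_lengths_eq:
  assumes w: "w \<in> signed_perms n"
  shows "negative_lengths n w = image_mset (\<lambda>d. fst (orbit_type w d))
    (mset_set {d \<in> signed_orbits n w. snd (orbit_type w d) = Minus})"
proof -
  have "{c \<in> cycles n w. c = uminus ` c} = orbit w ` {x \<in> Omega n. uminus ` orbit w x = orbit w x}"
    unfolding cycles_def by blast
  also have "\<dots> = orbit w ` points_of_sign n w Minus"
    by (simp add: self_conjugate_orbit_iff[OF w] cong: conj_cong)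
  also have "\<dots> = signed_orbit w ` points_of_sign n w Minus"
  proof (rule image_cong[OF refl])
    fix x assume "x \<in> points_of_sign n w Minus"
    then have "uminus ` orbit w x = orbit w x" by (simp add: self_conjugate_orbit_iff[OF w])
    then show "orbit w x = signed_orbit w x" by (simp add: signed_orbit_eq_Un[OF w])
  qed
  also have "\<dots> = {d \<in> signed_orbits n w. snd (orbit_type w d) = Minus}"
    by (rule signed_orbits_of_sign[OF w, symmetric])
  finally show ?thesis
    unfolding negative_lengths_def
    by (auto intro!: image_mset_cong simp: card_signed_orbits_elem[OF w])
qed

lemma inj_on_Union_conjugate_pairs:
  assumes w: "w \<in> signed_perms n"
  shows "inj_on Union (range (\<lambda>x. {orbit w x, uminus ` orbit w x}))"
proof (rule inj_onI)
  let ?pair = "\<lambda>x. {orbit w x, uminus ` orbit w x}"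
  fix P Q assume "P \<in> range ?pair" "Q \<in> range ?pair" and eq: "\<Union> P = \<Union> Q"
  then obtain x y where P: "P = ?pair x" and Q: "Q = ?pair y" by blast
  have "y \<in> \<Union> P" using self_in_orbit[OF w, of y] unfolding eq Q by blast
  then have "y \<in> orbit w x \<or> y \<in> orbit w (- x)"
    by (simp add: P orbit_uminus[OF w])
  then have "orbit w y = orbit w x \<or> orbit w y = uminus ` orbit w x"
    unfolding orbit_uminus[OF w, symmetric] by (blast dest: orbit_eq_if_mem[OF self_in_orbit[OF w]])
  then show "P = Q"
    unfolding P Q by (auto simp: image_image)
qed

lemma conjugate_pairs_eq:
  assumes w: "w \<in> signed_perms n"
  shows "{{c, uminus ` c} | c. c \<in> cycles n w \<and> c \<noteq> uminus ` c} =
    (\<lambda>x. {orbit w x, uminus ` orbit w x}) ` points_of_sign n w Plus"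
proof -
  have "{f c | c. c \<in> g ` A \<and> Q c} = (\<lambda>x. f (g x)) ` {x \<in> A. Q (g x)}"
    for f :: "int set \<Rightarrow> int set set" and g :: "int \<Rightarrow> int set" and A Q
    by blast
  then have "{{c, uminus ` c} | c. c \<in> cycles n w \<and> c \<noteq> uminus ` c} =
      (\<lambda>x. {orbit w x, uminus ` orbit w x}) ` {x \<in> Omega n. orbit w x \<noteq> uminus ` orbit w x}"
    unfolding cycles_def .
  also have "{x \<in> Omega n. orbit w x \<noteq> uminus ` orbit w x} = points_of_sign n w Plus"
  proof (intro Collect_cong conj_cong refl)
    fix x assume "x \<in> Omega n"
    from self_conjugate_orbit_iff[OF w this]
    show "orbit w x \<noteq> uminus ` orbit w x \<longleftrightarrow> snd (point_type w x) = Plus"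
      by (metis sign.distinct(1) sign.exhaust)
  qed
  finally show ?thesis .
qed

lemma positive_lengths_eq:
  assumes w: "w \<in> signed_perms n"
  shows "positive_lengths n w = image_mset (\<lambda>d. fst (orbit_type w d))
    (mset_set {d \<in> signed_orbits n w. snd (orbit_type w d) = Plus})"
proof -
  let ?pair = "\<lambda>x. {orbit w x, uminus ` orbit w x}"
  let ?P = "?pair ` points_of_sign n w Plus"
  have "{d \<in> signed_orbits n w. snd (orbit_type w d) = Plus} = Union ` ?P"
    unfolding signed_orbits_of_sign[OF w] image_image by (simp add: signed_orbit_eq_Un[OF w])
  moreover have "inj_on Union ?P"
    using inj_on_Union_conjugate_pairs[OF w] by (rule inj_on_subset) blast
  ultimately have "image_mset (\<lambda>d. fst (orbit_type w d))
      (mset_set {d \<in> signed_orbits n w. snd (orbit_type w d) = Plus}) =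
      image_mset (\<lambda>P. fst (orbit_type w (\<Union> P))) (mset_set ?P)"
    by (simp add: multiset.map_comp o_def flip: image_mset_mset_set)
  also have "\<dots> = image_mset (\<lambda>P. the_elem (card ` P)) (mset_set ?P)"
  proof (rule image_mset_cong)
    fix P assume "P \<in># mset_set ?P"
    then obtain x where P: "P = ?pair x" and x: "x \<in> Omega n" "snd (point_type w x) = Plus"
      by (auto simp: elem_mset_set)
    have "card (uminus ` orbit w x) = card (orbit w x)" by (intro card_image inj_onI) simp
    then have "the_elem (card ` P) = card (orbit w x)" by (simp add: P)
    also have "\<dots> = fst (point_type w x)"
      using x by (intro positive_orbit(1)[OF w]) (auto simp: prod_eq_iff mem_Omega_iff)
    also have "\<dots> = fst (orbit_type w (\<Union> P))"
      using orbit_type_signed_orbit[OF w x(1)] by (simp add: P signed_orbit_eq_Un[OF w])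
    finally show "fst (orbit_type w (\<Union> P)) = the_elem (card ` P)" by (rule sym)
  qed
  finally show ?thesis unfolding positive_lengths_def conjugate_pairs_eq[OF w] by (rule sym)
qed

lemma signed_cycle_type_eq:
  assumes "w \<in> signed_perms n"
  shows "signed_cycle_type n w =
    split_by_sign (image_mset (orbit_type w) (mset_set (signed_orbits n w)))"
  by (simp add: signed_cycle_type_def split_by_sign_def positive_lengths_eq[OF assms]
      negative_lengths_eq[OF assms] multiset.map_comp o_def flip: image_mset_filter_mset_swap)

lemma power_sum_parts_of_signed_cycle_type:
  assumes "w \<in> signed_perms n"
  shows "(case signed_cycle_type n w of (\<alpha>, \<beta>) \<Rightarrow> power_sum_part Plus \<alpha> * power_sum_part Minus \<beta>) =
    power_sum_prod (orbit_type w) (signed_orbits n w)"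
  unfolding signed_cycle_type_eq[OF assms] power_sum_part_split_by_sign power_sum_prod_def
  by (simp add: prod_unfold_prod_mset multiset.map_comp o_def)

section \<open>Base points of the cycles\<close>

definition base_lists ::
    "(int \<Rightarrow> int) \<Rightarrow> signed_composition \<Rightarrow> int set set \<Rightarrow> int list set" where
  "base_lists w \<gamma> D = {b. distinct (map (signed_orbit w) b) \<and> set (map (signed_orbit w) b) = D \<and>
     map (point_type w) b = \<gamma>}"

lemma base_lists_Nil: "base_lists w [] D = (if D = {} then {[]} else {})"
  by (auto simp: base_lists_def)

lemma Cons_in_base_lists_iff:
  "x # b \<in> base_lists w (p # \<gamma>) D \<longleftrightarrow>
     signed_orbit w x \<in> D \<and> point_type w x = p \<and> b \<in> base_lists w \<gamma> (D - {signed_orbit w x})"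
  by (auto simp: base_lists_def)

lemma finite_base_lists:
  assumes w: "w \<in> signed_perms n" and D: "D \<subseteq> signed_orbits n w"
  shows "finite (base_lists w \<gamma> D)"
proof (rule finite_subset)
  show "base_lists w \<gamma> D \<subseteq> {b. set b \<subseteq> Omega n \<and> length b = length \<gamma>}"
    using D signed_orbit_in_signed_orbits_iff[OF w] by (auto simp: base_lists_def)
  show "finite {b. set b \<subseteq> Omega n \<and> length b = length \<gamma>}"
    by (rule finite_lists_length_eq[OF finite_Omega])
qed

lemma base_lists_Cons:
  assumes w: "w \<in> signed_perms n" and D: "D \<subseteq> signed_orbits n w"
  shows "base_lists w (p # \<gamma>) D = (\<lambda>(x, b). x # b) `
    (SIGMA x:\<Union> {d \<in> D. orbit_type w d = p}. base_lists w \<gamma> (D - {signed_orbit w x}))"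
proof -
  have mem: "signed_orbit w x \<in> D \<and> point_type w x = p \<longleftrightarrow> x \<in> \<Union> {d \<in> D. orbit_type w d = p}" for x
  proof
    assume x: "signed_orbit w x \<in> D \<and> point_type w x = p"
    then have "x \<in> Omega n" using D signed_orbit_in_signed_orbits_iff[OF w] by blast
    with x show "x \<in> \<Union> {d \<in> D. orbit_type w d = p}"
      using self_in_signed_orbit[OF w, of x] orbit_type_signed_orbit[OF w] by blast
  next
    assume "x \<in> \<Union> {d \<in> D. orbit_type w d = p}"
    then obtain d where d: "d \<in> D" "orbit_type w d = p" "x \<in> d" by blast
    then have "d \<in> signed_orbits n w" using D by blast
    from signed_orbits_memD(2)[OF w this d(3)] orbit_type_eq_point_type[OF w this d(3)] d
    show "signed_orbit w x \<in> D \<and> point_type w x = p" by simp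
  qed
  show ?thesis
  proof (rule Set.set_eqI)
    fix c
    show "c \<in> base_lists w (p # \<gamma>) D \<longleftrightarrow> c \<in> (\<lambda>(x, b). x # b) `
        (SIGMA x:\<Union> {d \<in> D. orbit_type w d = p}. base_lists w \<gamma> (D - {signed_orbit w x}))"
    proof (cases c)
      case Nil
      then show ?thesis by (auto simp: base_lists_def)
    next
      case (Cons x b)
      have "x # b \<in> (\<lambda>(x, b). x # b) ` Sigma A B \<longleftrightarrow> x \<in> A \<and> b \<in> B x" for A B
        by auto
      then show ?thesis
        by (simp only: Cons Cons_in_base_lists_iff conj_assoc[symmetric] mem)
    qed
  qed
qed

lemma card_base_lists_Cons:
  assumes w: "w \<in> signed_perms n" and D: "D \<subseteq> signed_orbits n w"
  shows "card (base_lists w ((k, e) # \<gamma>) D) =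
    (\<Sum>d | d \<in> D \<and> orbit_type w d = (k, e). 2 * k * card (base_lists w \<gamma> (D - {d})))"
proof -
  define T where "T = {d \<in> D. orbit_type w d = (k, e)}"
  have T: "d \<in> signed_orbits n w" if "d \<in> T" for d
    using that D by (auto simp: T_def)
  have orbit: "signed_orbit w x = d" if "d \<in> T" "x \<in> d" for d x
    using signed_orbits_memD(2)[OF w T] that by blast
  have fin: "finite T" "\<And>d. d \<in> T \<Longrightarrow> finite d"
    using finite_subset[OF D] finite_signed_orbits_elem[OF w T] by (auto simp: T_def)
  have "card (base_lists w ((k, e) # \<gamma>) D) =
      card (SIGMA x:\<Union> T. base_lists w \<gamma> (D - {signed_orbit w x}))"
    unfolding base_lists_Cons[OF assms] T_def[symmetric]
    by (rule card_image) (auto intro!: inj_onI)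
  also have "\<dots> = (\<Sum>x\<in>\<Union> T. card (base_lists w \<gamma> (D - {signed_orbit w x})))"
    using fin D by (intro card_SigmaI) (auto intro!: finite_base_lists[OF w])
  also have "\<dots> = (\<Sum>d\<in>T. \<Sum>x\<in>d. card (base_lists w \<gamma> (D - {signed_orbit w x})))"
    using fin orbit by (intro sum.Union_disjoint[unfolded comp_def]) blast+
  also have "\<dots> = (\<Sum>d\<in>T. 2 * k * card (base_lists w \<gamma> (D - {d})))"
  proof (rule sum.cong[OF refl])
    fix d assume d: "d \<in> T"
    then have "card d = 2 * k" using card_signed_orbits_elem[OF w T[OF d]] by (simp add: T_def)
    then show "(\<Sum>x\<in>d. card (base_lists w \<gamma> (D - {signed_orbit w x}))) =
        2 * k * card (base_lists w \<gamma> (D - {d}))"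
      using orbit[OF d] by simp
  qed
  finally show ?thesis by (simp add: T_def)
qed

lemma weight_functional_eq_card_base_lists:
  assumes w: "w \<in> signed_perms n" and "D \<subseteq> signed_orbits n w" and "\<forall>p\<in>set \<gamma>. 0 < fst p"
  shows "weight_functional \<gamma> (\<lambda>\<tau>. coloring_sum (orbit_type w) \<tau> D) =
      of_nat (card (base_lists w \<gamma> D))"
  using assms(2,3)
proof (induction \<gamma> arbitrary: D)
  case Nil
  then show ?case by (simp add: base_lists_Nil)
next
  case (Cons p \<gamma>)
  obtain k e where p: "p = (k, e)" by force
  have "finite D" using Cons.prems(1) finite_signed_orbits finite_subset by blast
  moreover have "\<forall>d\<in>D. 0 < fst (orbit_type w d)" using Cons.prems(1) orbit_type_pos[OF w] by blast
  moreover have "weight_functional \<gamma> (\<lambda>\<tau>. coloring_sum (orbit_type w) \<tau> (D - {d})) =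
      of_nat (card (base_lists w \<gamma> (D - {d})))" for d
    using Cons.prems by (intro Cons.IH) auto
  ultimately show ?case
    using Cons.prems(2) unfolding p
    by (simp add: weight_functional_coloring_sum_Cons card_base_lists_Cons[OF w Cons.prems(1)]
        del: weight_functional.simps)
qed

abbreviation cycle_bases :: "nat \<Rightarrow> (int \<Rightarrow> int) \<Rightarrow> signed_composition \<Rightarrow> int list set" where
  "cycle_bases n w \<gamma> \<equiv> base_lists w \<gamma> (signed_orbits n w)"

lemma cycle_basesD:
  assumes w: "w \<in> signed_perms n" and b: "b \<in> cycle_bases n w \<gamma>"
  shows "length b = length \<gamma>" and "set b \<subseteq> Omega n" and "distinct (map (signed_orbit w) b)"
    and "signed_orbit w ` set b = signed_orbits n w"
    and "i < length \<gamma> \<Longrightarrow> point_type w (b ! i) = \<gamma> ! i"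
  using b signed_orbit_in_signed_orbits_iff[OF w] by (auto simp: base_lists_def)

lemma mset_eq_image_mset_imp_map:
  assumes "mset ys = image_mset f M"
  shows "\<exists>xs. mset xs = M \<and> map f xs = ys"
  using assms
proof (induction ys arbitrary: M)
  case (Cons y ys)
  then have "y \<in># image_mset f M" by (metis list.set_intros(1) set_mset_mset)
  then obtain x where x: "x \<in># M" "f x = y" by auto
  then obtain N where N: "M = add_mset x N" by (meson multi_member_split)
  with Cons.prems x have "mset ys = image_mset f N" by simp
  from Cons.IH[OF this] obtain xs where "mset xs = N" "map f xs = ys" by blast
  with x N show ?case by (intro exI[of _ "x # xs"]) simp
qed simp

lemma orbit_types_of_cycle_base:
  assumes w: "w \<in> signed_perms n" and b: "b \<in> cycle_bases n w \<gamma>"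
  shows "image_mset (orbit_type w) (mset_set (signed_orbits n w)) = mset \<gamma>"
proof -
  note bases = cycle_basesD[OF w b]
  have "mset_set (signed_orbits n w) = mset (map (signed_orbit w) b)"
    using mset_set_set[OF bases(3)] bases(4) by simp
  moreover have "map (orbit_type w) (map (signed_orbit w) b) = map (point_type w) b"
    using bases(2) orbit_type_signed_orbit[OF w] by auto
  moreover have "map (point_type w) b = \<gamma>"
    using b by (simp add: base_lists_def)
  ultimately show ?thesis by (metis mset_map)
qed

lemma cycle_base_exists:
  assumes w: "w \<in> signed_perms n"
    and "image_mset (orbit_type w) (mset_set (signed_orbits n w)) = mset \<gamma>"
  shows "cycle_bases n w \<gamma> \<noteq> {}"
proof -
  obtain ds where ds: "mset ds = mset_set (signed_orbits n w)" "map (orbit_type w) ds = \<gamma>"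
    using mset_eq_image_mset_imp_map assms(2) by metis
  have set_ds: "set ds = signed_orbits n w"
    using arg_cong[OF ds(1), of set_mset] by simp
  have "distinct ds"
    by (simp add: distinct_count_atmost_1 ds(1) set_ds)
  define b where "b = map (\<lambda>d. SOME x. x \<in> d) ds"
  have "(SOME x. x \<in> d) \<in> d" if "d \<in> set ds" for d
    using that signed_orbitsE[OF w, of d] unfolding set_ds by (metis someI)
  then have "signed_orbit w (SOME x. x \<in> d) = d" if "d \<in> set ds" for d
    using that signed_orbits_memD(2)[OF w] by (simp add: set_ds)
  then have "map (signed_orbit w) b = ds"
    by (simp add: b_def map_idI)
  moreover have "map (point_type w) b = \<gamma>"
    using ds(2) by (simp add: b_def o_def flip: orbit_type_def)
  ultimately have "b \<in> cycle_bases n w \<gamma>"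
    using \<open>distinct ds\<close> set_ds unfolding base_lists_def by (simp del: set_map)
  then show ?thesis by blast
qed

lemma cycle_bases_nonempty_iff:
  assumes "w \<in> signed_perms n"
  shows "cycle_bases n w \<gamma> \<noteq> {} \<longleftrightarrow> signed_cycle_type n w = bipartition_of \<gamma>"
  using orbit_types_of_cycle_base[OF assms] cycle_base_exists[OF assms]
  by (auto simp: signed_cycle_type_eq[OF assms] bipartition_of_eq split_by_sign_eq_iff)

section \<open>Conjugacy in the hyperoctahedral group\<close>

definition perm_conjugate :: "(int \<Rightarrow> int) \<Rightarrow> (int \<Rightarrow> int) \<Rightarrow> int \<Rightarrow> int" where
  "perm_conjugate u w = u \<circ> w \<circ> inv_into UNIV u"

lemma perm_conjugate_in_signed_perms:
  "u \<in> signed_perms n \<Longrightarrow> w \<in> signed_perms n \<Longrightarrow> perm_conjugate u w \<in> signed_perms n"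
  unfolding perm_conjugate_def by (intro comp_in_signed_perms inv_in_signed_perms)

lemma perm_conjugate_apply:
  assumes "u \<in> signed_perms n"
  shows "perm_conjugate u w (u x) = u (w x)"
  by (simp add: perm_conjugate_def permutes_inverses(2)[OF signed_perms_permutes[OF assms]])

lemma perm_conjugate_eqI:
  assumes "u \<in> signed_perms n" and "\<And>x. v (u x) = u (w x)"
  shows "perm_conjugate u w = v"
  by (simp add: perm_conjugate_def fun_eq_iff
      permutes_inverses(1)[OF signed_perms_permutes[OF assms(1)]] flip: assms(2))

lemma perm_conjugate_id: "u \<in> signed_perms n \<Longrightarrow> perm_conjugate u id = id"
  by (rule perm_conjugate_eqI) simp_all

lemma perm_conjugate_funpow:
  assumes "u \<in> signed_perms n"
  shows "(perm_conjugate u w ^^ j) (u x) = u ((w ^^ j) x)"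
  by (induction j) (simp_all add: perm_conjugate_apply[OF assms])

lemma signed_orbit_conjugate:
  assumes u: "u \<in> signed_perms n" and w: "w \<in> signed_perms n"
  shows "signed_orbit (perm_conjugate u w) (u x) = u ` signed_orbit w x"
proof -
  have mem: "u y \<in> signed_orbit (perm_conjugate u w) (u x) \<longleftrightarrow> y \<in> signed_orbit w x" for y
    by (simp add: mem_signed_orbit_iff[OF w]
        mem_signed_orbit_iff[OF perm_conjugate_in_signed_perms[OF u w]]
        perm_conjugate_funpow[OF u] abs_signed_perms_eq_iff[OF u])
  have "z \<in> signed_orbit (perm_conjugate u w) (u x) \<longleftrightarrow> z \<in> u ` signed_orbit w x" for z
  proof -
    obtain y where "z = u y" using permutes_surj[OF signed_perms_permutes[OF u]] by (rule surjE)
    then show ?thesis by (simp add: mem image_iff signed_perms_eq_iff[OF u])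
  qed
  then show ?thesis by blast
qed

lemma point_type_conjugate:
  assumes u: "u \<in> signed_perms n" and w: "w \<in> signed_perms n" and "x \<in> Omega n"
  shows "point_type (perm_conjugate u w) (u x) = point_type w x"
proof -
  obtain k e where type: "point_type w x = (k, e)" by force
  note cycle = point_type_funpow[OF w type]
  show ?thesis
    unfolding type
  proof (rule point_type_eqI[OF perm_conjugate_in_signed_perms[OF u w] _ cycle(1)])
    show "u x \<noteq> 0"
      using permutes_in_image[OF signed_perms_permutes[OF u]] assms(3) by (metis mem_Omega_iff)
    show "(perm_conjugate u w ^^ k) (u x) = sign_int e * u x"
      by (simp add: perm_conjugate_funpow[OF u] cycle(2) signed_perms_mult_sign[OF u sign_int_cases])
    fix j assume "0 < j" "j < k"
    then show "\<bar>(perm_conjugate u w ^^ j) (u x)\<bar> \<noteq> \<bar>u x\<bar>"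
      using inj_onD[OF cycle(3), of j 0]
      by (auto simp: perm_conjugate_funpow[OF u] abs_signed_perms_eq_iff[OF u])
  qed
qed

lemma signed_orbits_conjugate:
  assumes u: "u \<in> signed_perms n" and w: "w \<in> signed_perms n"
  shows "signed_orbits n (perm_conjugate u w) = (`) u ` signed_orbits n w"
proof -
  have "signed_orbits n (perm_conjugate u w) = signed_orbit (perm_conjugate u w) ` u ` Omega n"
    by (simp only: signed_orbits_def permutes_image[OF signed_perms_permutes[OF u]])
  then show ?thesis by (simp add: signed_orbit_conjugate[OF u w] signed_orbits_def image_image)
qed

lemma map_in_cycle_bases_conjugate:
  assumes u: "u \<in> signed_perms n" and w: "w \<in> signed_perms n" and b: "b \<in> cycle_bases n w \<gamma>"
  shows "map u b \<in> cycle_bases n (perm_conjugate u w) \<gamma>"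
proof -
  note bases = cycle_basesD[OF w b]
  have orbits: "map (signed_orbit (perm_conjugate u w)) (map u b) =
      map ((`) u) (map (signed_orbit w) b)"
    by (simp add: signed_orbit_conjugate[OF u w])
  have "inj ((`) u)"
    using permutes_inj[OF signed_perms_permutes[OF u]] by (simp add: inj_image_eq_iff inj_def)
  then have "distinct (map (signed_orbit (perm_conjugate u w)) (map u b))"
    unfolding orbits using bases(3) by (metis distinct_map inj_on_subset subset_UNIV)
  moreover have "set (map (signed_orbit (perm_conjugate u w)) (map u b)) =
      signed_orbits n (perm_conjugate u w)"
    unfolding orbits by (simp add: signed_orbits_conjugate[OF u w] image_image flip: bases(4))
  moreover have "map (point_type (perm_conjugate u w)) (map u b) = map (point_type w) b"
    using bases(2) point_type_conjugate[OF u w] by auto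
  ultimately show ?thesis
    using b unfolding base_lists_def by (simp del: map_map list.set_map)
qed

lemma signed_perm_transport:
  assumes f: "bij_betw f I (Omega n)" and g: "bij_betw g I (Omega n)"
    and odd: "\<And>p. p \<in> I \<Longrightarrow> neg p \<in> I \<and> f (neg p) = - f p \<and> g (neg p) = - g p"
  shows "\<exists>u\<in>signed_perms n. \<forall>p\<in>I. u (f p) = g p"
proof -
  define u where "u x = (if x \<in> Omega n then g (inv_into I f x) else x)" for x
  have apply_f: "u (f p) = g p" if "p \<in> I" for p
    using that bij_betwE[OF f] bij_betw_inv_into_left[OF f] by (simp add: u_def)
  moreover have "u \<in> signed_perms n"
  proof (rule signed_permsI)
    have "bij_betw (g \<circ> inv_into I f) (Omega n) (Omega n)"
      by (rule bij_betw_trans[OF bij_betw_inv_into[OF f] g])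
    then have "bij_betw u (Omega n) (Omega n)"
      by (rule bij_betw_cong[THEN iffD1, rotated]) (simp add: u_def)
    then show "u permutes Omega n" by (rule bij_imp_permutes) (simp add: u_def)
    show "u (- x) = - u x" for x
    proof (cases "x \<in> Omega n")
      case True
      then obtain p where "p \<in> I" "x = f p" using bij_betw_imp_surj_on[OF f] by blast
      then show ?thesis using apply_f[of p] apply_f[of "neg p"] odd[of p] by simp
    qed (simp add: u_def)
  qed
  ultimately show ?thesis by blast
qed

text \<open>
  The index \<open>(i, j, s)\<close> stands for \<open>s\<close> times the \<open>j\<close>-th successor of the base point of cycle \<open>i\<close>.
\<close>

definition frame_indices :: "signed_composition \<Rightarrow> (nat \<times> nat \<times> int) set" where
  "frame_indices \<gamma> = (SIGMA i:{..<length \<gamma>}. {..<fst (\<gamma> ! i)} \<times> {1, - 1})"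

fun frame_neg :: "nat \<times> nat \<times> int \<Rightarrow> nat \<times> nat \<times> int" where
  "frame_neg (i, j, s) = (i, j, - s)"

fun frame_succ :: "signed_composition \<Rightarrow> nat \<times> nat \<times> int \<Rightarrow> nat \<times> nat \<times> int" where
  "frame_succ \<gamma> (i, j, s) =
     (if Suc j < fst (\<gamma> ! i) then (i, Suc j, s) else (i, 0, s * sign_int (snd (\<gamma> ! i))))"

lemma mem_frame_indices_iff:
  "(i, j, s) \<in> frame_indices \<gamma> \<longleftrightarrow> i < length \<gamma> \<and> j < fst (\<gamma> ! i) \<and> s \<in> {1, - 1}"
  by (simp add: frame_indices_def)

lemma finite_frame_indices: "finite (frame_indices \<gamma>)"
  by (simp add: frame_indices_def)

lemma card_frame_indices: "card (frame_indices \<gamma>) = 2 * sum_list (map fst \<gamma>)"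
  by (simp add: frame_indices_def card_cartesian_product sum_list_sum_nth atLeast0LessThan
      mult_2 sum.distrib)

lemma frame_neg_mem: "p \<in> frame_indices \<gamma> \<Longrightarrow> frame_neg p \<in> frame_indices \<gamma>"
  by (cases p) (auto simp: mem_frame_indices_iff)

lemma frame_succ_mem: "p \<in> frame_indices \<gamma> \<Longrightarrow> frame_succ \<gamma> p \<in> frame_indices \<gamma>"
  using sign_int_cases[of "snd (\<gamma> ! fst p)"] by (cases p) (auto simp: mem_frame_indices_iff)

lemma frame_succ_neg: "frame_succ \<gamma> (frame_neg p) = frame_neg (frame_succ \<gamma> p)"
  by (cases p) simp

lemma frame_succ_bij: "bij_betw (frame_succ \<gamma>) (frame_indices \<gamma>) (frame_indices \<gamma>)"
proof -
  have "inj_on (frame_succ \<gamma>) (frame_indices \<gamma>)"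
  proof (rule inj_onI)
    fix p q assume "p \<in> frame_indices \<gamma>" "q \<in> frame_indices \<gamma>" "frame_succ \<gamma> p = frame_succ \<gamma> q"
    then show "p = q"
      using sign_int_cases[of "snd (\<gamma> ! fst p)"]
      by (cases p; cases q) (auto simp: mem_frame_indices_iff split: if_splits)
  qed
  moreover have "frame_succ \<gamma> ` frame_indices \<gamma> \<subseteq> frame_indices \<gamma>"
    using frame_succ_mem by blast
  ultimately show ?thesis
    by (simp add: bij_betw_def endo_inj_surj finite_frame_indices)
qed

locale cycle_frame =
  fixes n :: nat and w :: "int \<Rightarrow> int" and \<gamma> :: signed_composition and f :: "nat \<times> nat \<times> int \<Rightarrow> int"
  assumes signed_perm: "w \<in> signed_perms n"
    and bij: "bij_betw f (frame_indices \<gamma>) (Omega n)"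
    and neg: "\<And>p. f (frame_neg p) = - f p"
    and succ: "\<And>p. p \<in> frame_indices \<gamma> \<Longrightarrow> w (f p) = f (frame_succ \<gamma> p)"
begin

lemma mult_sign: "s \<in> {1, - 1} \<Longrightarrow> f (i, j, s) = s * f (i, j, 1)"
  using neg[of "(i, j, 1)"] by auto

lemma mem_Omega: "p \<in> frame_indices \<gamma> \<Longrightarrow> f p \<in> Omega n"
  using bij_betwE[OF bij] by blast

lemma exists_index:
  assumes "x \<in> Omega n"
  obtains p where "p \<in> frame_indices \<gamma>" "x = f p"
  using assms unfolding bij_betw_imp_surj_on[OF bij, symmetric] by (rule imageE)

lemma eq_iff: "p \<in> frame_indices \<gamma> \<Longrightarrow> q \<in> frame_indices \<gamma> \<Longrightarrow> f p = f q \<longleftrightarrow> p = q"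
  using bij_betw_imp_inj_on[OF bij] by (auto dest: inj_onD)

lemma funpow_base:
  assumes "i < length \<gamma>" and "j < fst (\<gamma> ! i)"
  shows "(w ^^ j) (f (i, 0, 1)) = f (i, j, 1)"
  using assms(2)
proof (induction j)
  case (Suc j)
  then show ?case using succ[of "(i, j, 1)"] assms(1) by (simp add: mem_frame_indices_iff)
qed simp

lemma point_type_base:
  assumes i: "i < length \<gamma>" and pos: "0 < fst (\<gamma> ! i)"
  shows "point_type w (f (i, 0, 1)) = \<gamma> ! i"
proof -
  obtain k e where type: "\<gamma> ! i = (k, e)" by force
  obtain m where m: "k = Suc m" using pos type gr0_implies_Suc by auto
  show ?thesis
    unfolding type
  proof (rule point_type_eqI[OF signed_perm])
    show "0 < k" using pos type by simp
    show "f (i, 0, 1) \<noteq> 0"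
      using mem_Omega[of "(i, 0, 1)"] i pos by (simp add: mem_Omega_iff mem_frame_indices_iff)
    have "(w ^^ k) (f (i, 0, 1)) = w (f (i, m, 1))"
      using funpow_base[OF i, of m] by (simp add: m type)
    also have "\<dots> = f (i, 0, sign_int e)"
      using i by (subst succ) (simp_all add: mem_frame_indices_iff m type)
    also have "\<dots> = sign_int e * f (i, 0, 1)"
      by (rule mult_sign[OF sign_int_cases])
    finally show "(w ^^ k) (f (i, 0, 1)) = sign_int e * f (i, 0, 1)" .
    fix j assume j: "0 < j" "j < k"
    then have "f (i, j, 1) \<noteq> f (i, 0, s)" if "s \<in> {1, - 1}" for s
      using that i pos type by (subst eq_iff) (auto simp: mem_frame_indices_iff)
    from this[of 1] this[of "- 1"] show "\<bar>(w ^^ j) (f (i, 0, 1))\<bar> \<noteq> \<bar>f (i, 0, 1)\<bar>"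
      using funpow_base[OF i, of j] j type mult_sign[of "- 1" i 0] by (auto simp: abs_eq_iff)
  qed
qed

lemma signed_orbit_base:
  assumes p: "(i, j, s) \<in> frame_indices \<gamma>"
  shows "signed_orbit w (f (i, j, s)) = signed_orbit w (f (i, 0, 1))"
proof (rule signed_orbit_eq_if_mem[OF signed_perm])
  have "\<bar>f (i, j, s)\<bar> = \<bar>f (i, j, 1)\<bar>"
    using p by (subst mult_sign) (auto simp: mem_frame_indices_iff abs_mult)
  also have "\<dots> = \<bar>(w ^^ j) (f (i, 0, 1))\<bar>"
    using p by (simp add: funpow_base mem_frame_indices_iff)
  finally show "f (i, j, s) \<in> signed_orbit w (f (i, 0, 1))"
    unfolding mem_signed_orbit_iff[OF signed_perm] by blast
qed

lemma signed_orbit_base_eq_iff: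
  assumes i: "i < length \<gamma>" "0 < fst (\<gamma> ! i)" and i': "i' < length \<gamma>" "0 < fst (\<gamma> ! i')"
  shows "signed_orbit w (f (i, 0, 1)) = signed_orbit w (f (i', 0, 1)) \<longleftrightarrow> i = i'"
proof
  assume eq: "signed_orbit w (f (i, 0, 1)) = signed_orbit w (f (i', 0, 1))"
  have type: "point_type w (f (i', 0, 1)) = (fst (\<gamma> ! i'), snd (\<gamma> ! i'))"
    using point_type_base[OF i'] by simp
  have "f (i', 0, 1) \<noteq> 0"
    using mem_Omega[of "(i', 0, 1)"] i' by (simp add: mem_Omega_iff mem_frame_indices_iff)
  note orbit = signed_orbit_bij_betw[OF signed_perm type this]
  have "f (i, 0, 1) \<in> (\<lambda>(j, s). s * (w ^^ j) (f (i', 0, 1))) ` ({..<fst (\<gamma> ! i')} \<times> {1, - 1})"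
    using self_in_signed_orbit[OF signed_perm, of "f (i, 0, 1)"]
    by (simp only: eq bij_betw_imp_surj_on[OF orbit])
  then obtain q where q: "q \<in> {..<fst (\<gamma> ! i')} \<times> {1, - 1}"
    and fq: "f (i, 0, 1) = (case q of (j, s) \<Rightarrow> s * (w ^^ j) (f (i', 0, 1)))"
    by (elim imageE)
  obtain j s where js: "q = (j, s)" "j < fst (\<gamma> ! i')" "s \<in> {1, - 1}"
    using q by blast
  then have "f (i, 0, 1) = f (i', j, s)"
    using fq funpow_base[OF i'(1) js(2)] mult_sign[OF js(3), of i' j] by simp
  then show "i = i'"
    using eq_iff[of "(i, 0, 1)" "(i', j, s)"] i i' js by (simp add: mem_frame_indices_iff)
qed simp

lemma base_points_in_cycle_bases:
  assumes pos: "\<forall>p\<in>set \<gamma>. 0 < fst p"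
  shows "map (\<lambda>i. f (i, 0, 1)) [0..<length \<gamma>] \<in> cycle_bases n w \<gamma>"
proof -
  let ?b = "map (\<lambda>i. f (i, 0, 1)) [0..<length \<gamma>]"
  have pos_nth: "0 < fst (\<gamma> ! i)" if "i < length \<gamma>" for i using pos that by simp
  have "distinct (map (signed_orbit w) ?b)"
    using signed_orbit_base_eq_iff pos_nth by (auto simp: distinct_conv_nth)
  moreover have "map (point_type w) ?b = \<gamma>"
    by (rule nth_equalityI) (simp_all add: point_type_base pos_nth)
  moreover have "set (map (signed_orbit w) ?b) = signed_orbits n w"
  proof (intro equalityI subsetI)
    fix d assume "d \<in> set (map (signed_orbit w) ?b)"
    then obtain i where "i < length \<gamma>" "d = signed_orbit w (f (i, 0, 1))" by auto
    then show "d \<in> signed_orbits n w"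
      using mem_Omega[of "(i, 0, 1)"] pos_nth
      by (simp add: signed_orbit_in_signed_orbits_iff[OF signed_perm] mem_frame_indices_iff)
  next
    fix d assume "d \<in> signed_orbits n w"
    then obtain x where x: "x \<in> Omega n" "d = signed_orbit w x" unfolding signed_orbits_def by blast
    from x(1) obtain p where p: "p \<in> frame_indices \<gamma>" "x = f p" by (rule exists_index)
    obtain i j s where ijs: "p = (i, j, s)" by (rule prod_cases3)
    have "d = signed_orbit w (f (i, 0, 1))"
      using x(2) p signed_orbit_base unfolding ijs by simp
    moreover have "i < length \<gamma>" using p(1) by (simp add: ijs mem_frame_indices_iff)
    ultimately show "d \<in> set (map (signed_orbit w) ?b)" by simp
  qed
  ultimately show ?thesis unfolding base_lists_def by blast
qed

end

lemma odd_bijection_exists: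
  assumes "\<gamma> \<in> signed_compositions n"
  shows "\<exists>f. bij_betw f (frame_indices \<gamma>) (Omega n) \<and> (\<forall>p. f (frame_neg p) = - f p)"
proof -
  let ?P = "SIGMA i:{..<length \<gamma>}. {..<fst (\<gamma> ! i)}"
  have "card ?P = n"
    using assms by (simp add: signed_compositions_def sum_list_sum_nth atLeast0LessThan)
  then obtain h where h: "bij_betw h ?P {1..n}"
    using finite_same_card_bij[of ?P "{1..n}"] by auto
  define f where "f = (\<lambda>(i, j, s). s * int (h (i, j)))"
  have h_mem: "h (i, j) \<in> {1..n}" if "(i, j, s) \<in> frame_indices \<gamma>" for i j and s :: int
    using that bij_betwE[OF h] by (auto simp: mem_frame_indices_iff)
  have "inj_on f (frame_indices \<gamma>)"
  proof (rule inj_onI)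
    fix p q assume p: "p \<in> frame_indices \<gamma>" and q: "q \<in> frame_indices \<gamma>" and eq: "f p = f q"
    obtain i j s i' j' s' where pq: "p = (i, j, s)" "q = (i', j', s')"
      by (cases p; cases q) blast
    then have st: "s \<in> {1, - 1}" "s' \<in> {1, - 1}" and P: "(i, j) \<in> ?P" "(i', j') \<in> ?P"
      using p q by (auto simp: mem_frame_indices_iff)
    have "h (i, j) = h (i', j')" using arg_cong[OF eq, of abs] st by (auto simp: f_def pq abs_mult)
    then have "(i, j) = (i', j')" using P by (rule inj_onD[OF bij_betw_imp_inj_on[OF h]])
    then show "p = q" using eq h_mem[of i j s] p by (auto simp: f_def pq)
  qed
  moreover have "f ` frame_indices \<gamma> = Omega n"
  proof (rule card_subset_eq)
    show "f ` frame_indices \<gamma> \<subseteq> Omega n"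
      using h_mem by (force simp: f_def mem_Omega_iff mem_frame_indices_iff)
    show "card (f ` frame_indices \<gamma>) = card (Omega n)"
      using assms card_image[OF \<open>inj_on f (frame_indices \<gamma>)\<close>]
      by (simp add: card_frame_indices card_Omega signed_compositions_def)
  qed simp
  ultimately have "bij_betw f (frame_indices \<gamma>) (Omega n)" by (rule bij_betw_imageI)
  moreover have "f (frame_neg p) = - f p" for p by (cases p) (simp add: f_def)
  ultimately show ?thesis by blast
qed

lemma cycle_frame_exists:
  assumes "\<gamma> \<in> signed_compositions n"
  shows "\<exists>w f. cycle_frame n w \<gamma> f"
proof -
  obtain f where f: "bij_betw f (frame_indices \<gamma>) (Omega n)" "\<forall>p. f (frame_neg p) = - f p"
    using odd_bijection_exists[OF assms] by blast
  have "bij_betw (f \<circ> frame_succ \<gamma>) (frame_indices \<gamma>) (Omega n)"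
    using frame_succ_bij f(1) by (rule bij_betw_trans)
  with f(1) have "\<exists>w\<in>signed_perms n. \<forall>p\<in>frame_indices \<gamma>. w (f p) = (f \<circ> frame_succ \<gamma>) p"
    by (rule signed_perm_transport[where neg = frame_neg])
      (simp add: frame_neg_mem f(2) frame_succ_neg)
  then obtain w where "w \<in> signed_perms n" "\<forall>p\<in>frame_indices \<gamma>. w (f p) = f (frame_succ \<gamma> p)"
    by auto
  with f have "cycle_frame n w \<gamma> f" by unfold_locales auto
  then show ?thesis by blast
qed

lemma exists_signed_cycle_type:
  assumes "\<gamma> \<in> signed_compositions n"
  shows "\<exists>w\<in>signed_perms n. signed_cycle_type n w = bipartition_of \<gamma>"
proof -
  obtain w f where "cycle_frame n w \<gamma> f" using cycle_frame_exists[OF assms] by blast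
  then have "w \<in> signed_perms n" "cycle_bases n w \<gamma> \<noteq> {}"
    using cycle_frame.base_points_in_cycle_bases[of n w \<gamma> f] assms
    by (auto simp: cycle_frame_def signed_compositions_def)
  then show ?thesis using cycle_bases_nonempty_iff by blast
qed

definition frame :: "(int \<Rightarrow> int) \<Rightarrow> int list \<Rightarrow> nat \<times> nat \<times> int \<Rightarrow> int" where
  "frame w b = (\<lambda>(i, j, s). s * (w ^^ j) (b ! i))"

lemma frame_bij_betw_signed_orbit:
  assumes w: "w \<in> signed_perms n" and b: "b \<in> cycle_bases n w \<gamma>" and i: "i < length \<gamma>"
  shows "bij_betw (\<lambda>q. frame w b (i, q)) ({..<fst (\<gamma> ! i)} \<times> {1, - 1}) (signed_orbit w (b ! i))"
proof -
  note bases = cycle_basesD[OF w b]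
  have "b ! i \<in> Omega n" using i bases(1,2) nth_mem[of i b] by auto
  then have "b ! i \<noteq> 0" by (simp add: mem_Omega_iff)
  then show ?thesis
    using signed_orbit_bij_betw[OF w, of "b ! i" "fst (\<gamma> ! i)" "snd (\<gamma> ! i)"] bases(5)[OF i]
    by (simp add: frame_def)
qed

lemma frame_bij_betw:
  assumes w: "w \<in> signed_perms n" and b: "b \<in> cycle_bases n w \<gamma>"
  shows "bij_betw (frame w b) (frame_indices \<gamma>) (Omega n)"
proof (rule bij_betw_imageI)
  note bases = cycle_basesD[OF w b] and block = frame_bij_betw_signed_orbit[OF w b]
  show "inj_on (frame w b) (frame_indices \<gamma>)"
  proof (rule inj_onI)
    fix p p' assume "p \<in> frame_indices \<gamma>" "p' \<in> frame_indices \<gamma>"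
      and eq: "frame w b p = frame w b p'"
    then obtain i q i' q' where p: "p = (i, q)" "i < length \<gamma>" "q \<in> {..<fst (\<gamma> ! i)} \<times> {1, - 1}"
      and p': "p' = (i', q')" "i' < length \<gamma>" "q' \<in> {..<fst (\<gamma> ! i')} \<times> {1, - 1}"
      unfolding frame_indices_def by blast
    have "frame w b p \<in> signed_orbit w (b ! i)" "frame w b p \<in> signed_orbit w (b ! i')"
      using bspec[OF bij_betwE[OF block[OF p(2)]] p(3)]
        bspec[OF bij_betwE[OF block[OF p'(2)]] p'(3)]
        p(1) p'(1) eq by simp_all
    then have "signed_orbit w (b ! i) = signed_orbit w (b ! i')"
      using signed_orbit_eq_if_mem[OF w] by metis
    then have "i = i'"
      using nth_eq_iff_index_eq[OF bases(3), of i i'] p(2) p'(2) bases(1) by simp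
    moreover from this have "q = q'"
      using bij_betw_imp_inj_on[OF block[OF p(2)]] p p' eq by (auto dest: inj_onD)
    ultimately show "p = p'" using p(1) p'(1) by simp
  qed
  have "frame w b ` frame_indices \<gamma> =
      (\<Union>i<length \<gamma>. (\<lambda>q. frame w b (i, q)) ` ({..<fst (\<gamma> ! i)} \<times> {1, - 1}))"
    unfolding frame_indices_def by blast
  also have "\<dots> = (\<Union>i<length b. signed_orbit w (b ! i))"
    using bij_betw_imp_surj_on[OF block] bases(1) by simp
  also have "\<dots> = \<Union> (signed_orbit w ` set b)"
    by (auto simp: set_conv_nth)
  finally show "frame w b ` frame_indices \<gamma> = Omega n"
    by (simp add: bases(4) Union_signed_orbits[OF w])
qed

lemma cycle_frame_frame:
  assumes w: "w \<in> signed_perms n" and b: "b \<in> cycle_bases n w \<gamma>"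
  shows "cycle_frame n w \<gamma> (frame w b)"
proof
  show "frame w b (frame_neg p) = - frame w b p" for p
    by (cases p) (simp add: frame_def)
  fix p assume "p \<in> frame_indices \<gamma>"
  then obtain i j s where p: "p = (i, j, s)" "i < length \<gamma>" "j < fst (\<gamma> ! i)" "s \<in> {1, - 1}"
    unfolding frame_indices_def by blast
  have "point_type w (b ! i) = (fst (\<gamma> ! i), snd (\<gamma> ! i))"
    using cycle_basesD(5)[OF w b p(2)] by simp
  note return = point_type_funpow(2)[OF w this]
  have "w (frame w b p) = s * (w ^^ Suc j) (b ! i)"
    by (simp add: p(1) frame_def signed_perms_mult_sign[OF w p(4)])
  also have "\<dots> = frame w b (frame_succ \<gamma> p)"
  proof (cases "Suc j < fst (\<gamma> ! i)")
    case False
    then have "Suc j = fst (\<gamma> ! i)" using p(3) by simp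
    with return False show ?thesis by (simp add: p(1) frame_def del: funpow.simps)
  qed (simp add: p(1) frame_def)
  finally show "w (frame w b p) = frame w b (frame_succ \<gamma> p)" .
qed (fact w frame_bij_betw[OF w b])+

lemma cycle_frame_conjugator:
  assumes f: "cycle_frame n w \<gamma> f" and g: "cycle_frame n v \<gamma> g"
  shows "\<exists>u\<in>signed_perms n. perm_conjugate u w = v \<and> (\<forall>p\<in>frame_indices \<gamma>. u (f p) = g p)"
proof -
  interpret f: cycle_frame n w \<gamma> f by (fact f)
  interpret g: cycle_frame n v \<gamma> g by (fact g)
  have "\<exists>u\<in>signed_perms n. \<forall>p\<in>frame_indices \<gamma>. u (f p) = g p"
    by (rule signed_perm_transport[OF f.bij g.bij, of frame_neg])
      (simp add: frame_neg_mem f.neg g.neg)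
  then obtain u where u: "u \<in> signed_perms n" and uf: "\<forall>p\<in>frame_indices \<gamma>. u (f p) = g p"
    by blast
  have "v (u x) = u (w x)" for x
  proof (cases "x \<in> Omega n")
    case True
    then obtain p where p: "p \<in> frame_indices \<gamma>" "x = f p" by (rule f.exists_index)
    then show ?thesis by (simp add: uf f.succ g.succ frame_succ_mem)
  next
    case False
    then show ?thesis
      by (simp add: signed_perms_not_in[OF u] signed_perms_not_in[OF f.signed_perm]
          signed_perms_not_in[OF g.signed_perm])
  qed
  then have "perm_conjugate u w = v" by (rule perm_conjugate_eqI[OF u])
  with u uf show ?thesis by blast
qed

lemma cycle_bases_conjugator:
  assumes w: "w \<in> signed_perms n" "b \<in> cycle_bases n w \<gamma>"
    and v: "v \<in> signed_perms n" "c \<in> cycle_bases n v \<gamma>"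
  shows "\<exists>u\<in>signed_perms n. perm_conjugate u w = v \<and> map u b = c"
proof -
  obtain u where u: "u \<in> signed_perms n" "perm_conjugate u w = v"
    and uf: "\<forall>p\<in>frame_indices \<gamma>. u (frame w b p) = frame v c p"
    using cycle_frame_conjugator[OF cycle_frame_frame[OF w] cycle_frame_frame[OF v]] by blast
  have "map u b = c"
  proof (rule nth_equalityI)
    show "length (map u b) = length c"
      using cycle_basesD(1)[OF w] cycle_basesD(1)[OF v] by simp
    fix i assume "i < length (map u b)"
    then have i: "i < length b" "i < length \<gamma>" using cycle_basesD(1)[OF w] by simp_all
    have "0 < fst (\<gamma> ! i)"
      using cycle_basesD(5)[OF w i(2)] point_type_funpow(1)[OF w(1), of "b ! i"]
      by (metis prod.collapse)
    with bspec[OF uf, of "(i, 0, 1)"] i show "map u b ! i = c ! i"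
      by (simp add: frame_def mem_frame_indices_iff)
  qed
  with u show ?thesis by (intro bexI conjI)
qed

lemma cycle_bases_conjugator_unique:
  assumes w: "w \<in> signed_perms n" "b \<in> cycle_bases n w \<gamma>"
    and u: "u \<in> signed_perms n" and v: "v \<in> signed_perms n"
    and eq: "perm_conjugate u w = perm_conjugate v w" "map u b = map v b"
  shows "u = v"
proof
  fix x
  show "u x = v x"
  proof (cases "x \<in> Omega n")
    case True
    then obtain p where p: "p \<in> frame_indices \<gamma>" "x = frame w b p"
      by (rule cycle_frame.exists_index[OF cycle_frame_frame[OF w]])
    obtain i j s where "p = (i, j, s)" by (rule prod_cases3)
    with p have x: "x = s * (w ^^ j) (b ! i)" "i < length \<gamma>" "s \<in> {1, - 1}"
      by (simp_all add: frame_def mem_frame_indices_iff)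
    have "u (b ! i) = v (b ! i)"
      using eq(2) x(2) cycle_basesD(1)[OF w] by (metis nth_map)
    then have "u ((w ^^ j) (b ! i)) = v ((w ^^ j) (b ! i))"
      using eq(1) by (metis perm_conjugate_funpow[OF u] perm_conjugate_funpow[OF v])
    then show ?thesis
      by (simp add: x(1) signed_perms_mult_sign[OF u x(3)] signed_perms_mult_sign[OF v x(3)])
  next
    case False
    then show ?thesis by (simp add: signed_perms_not_in[OF u] signed_perms_not_in[OF v])
  qed
qed

text \<open>Counting with this simply transitive action makes class sizes superfluous.\<close>

lemma conjugation_bij_betw:
  assumes w: "w \<in> signed_perms n" and b: "b \<in> cycle_bases n w \<gamma>"
  shows "bij_betw (\<lambda>u. (perm_conjugate u w, map u b)) (signed_perms n)
    (SIGMA v:signed_perms n. cycle_bases n v \<gamma>)"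
proof (rule bij_betw_imageI)
  show "inj_on (\<lambda>u. (perm_conjugate u w, map u b)) (signed_perms n)"
    by (rule inj_onI) (blast intro: cycle_bases_conjugator_unique[OF assms])
  show "(\<lambda>u. (perm_conjugate u w, map u b)) ` signed_perms n =
      (SIGMA v:signed_perms n. cycle_bases n v \<gamma>)"
  proof (intro equalityI subsetI)
    fix q assume "q \<in> (\<lambda>u. (perm_conjugate u w, map u b)) ` signed_perms n"
    then show "q \<in> (SIGMA v:signed_perms n. cycle_bases n v \<gamma>)"
      using map_in_cycle_bases_conjugate[OF _ assms] perm_conjugate_in_signed_perms[OF _ w] by blast
  next
    fix q assume "q \<in> (SIGMA v:signed_perms n. cycle_bases n v \<gamma>)"
    then show "q \<in> (\<lambda>u. (perm_conjugate u w, map u b)) ` signed_perms n"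
      using cycle_bases_conjugator[OF assms] by fastforce
  qed
qed

lemma orbit_type_id:
  assumes "d \<in> signed_orbits n id"
  shows "orbit_type id d = (1, Plus)"
proof -
  obtain x where x: "x \<in> d" "x \<in> Omega n"
    using signed_orbitsE[OF id_in_signed_perms assms] by blast
  have "point_type id x = (1, Plus)"
    using x(2)
    by (intro point_type_eqI[OF id_in_signed_perms]) (auto simp: sign_int_def mem_Omega_iff)
  with orbit_type_eq_point_type[OF id_in_signed_perms assms x(1)] show ?thesis by simp
qed

lemma card_signed_orbits_id: "card (signed_orbits n id) = n"
  using type_size_signed_orbits[OF id_in_signed_perms, of n]
  by (simp add: type_size_def orbit_type_id)

lemma card_base_lists_id:
  assumes "D \<subseteq> signed_orbits n id"
  shows "card (base_lists id (replicate (card D) (1, Plus)) D) = 2 ^ card D * fact (card D)"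
  using assms
proof (induction "card D" arbitrary: D)
  case 0
  then have "D = {}" using finite_subset[OF \<open>D \<subseteq> signed_orbits n id\<close>] by simp
  then show ?case by (simp add: base_lists_Nil)
next
  case (Suc m)
  have D: "{d. d \<in> D \<and> orbit_type id d = (1, Plus)} = D"
    using Suc.prems orbit_type_id by blast
  have "card (base_lists id (replicate m (1, Plus)) (D - {d})) = 2 ^ m * fact m" if "d \<in> D" for d
    using Suc.hyps(1)[of "D - {d}"] Suc.hyps(2)[symmetric] Suc.prems that by auto
  then show ?case
    unfolding Suc.hyps(2)[symmetric] replicate_Suc
      card_base_lists_Cons[OF id_in_signed_perms Suc.prems] D
    by (simp add: algebra_simps flip: Suc.hyps(2))
qed

lemma card_signed_perms: "card (signed_perms n) = 2 ^ n * fact n"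
proof -
  let ?\<gamma> = "replicate n (1, Plus)"
  have card: "card (cycle_bases n id ?\<gamma>) = 2 ^ n * fact n"
    using card_base_lists_id[OF order_refl, of n] by (simp add: card_signed_orbits_id)
  then have "cycle_bases n id ?\<gamma> \<noteq> {}" by (intro notI) simp
  then obtain b where b: "b \<in> cycle_bases n id ?\<gamma>" by blast
  have "v = id" if "v \<in> signed_perms n" "c \<in> cycle_bases n v ?\<gamma>" for v c
    using cycle_bases_conjugator[OF id_in_signed_perms b that] perm_conjugate_id by auto
  then have "(SIGMA v:signed_perms n. cycle_bases n v ?\<gamma>) = {id} \<times> cycle_bases n id ?\<gamma>"
    using id_in_signed_perms[of n] by blast
  then show ?thesis
    using bij_betw_same_card[OF conjugation_bij_betw[OF id_in_signed_perms b]] card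
    by (simp add: card_cartesian_product)
qed

section \<open>Characters\<close>

lemma trace_mat_commute:
  assumes "A \<in> carrier_mat d d" and "B \<in> carrier_mat d d"
  shows "trace_mat (A * B) = trace_mat (B * A)"
proof -
  have "trace_mat (A * B) = (\<Sum>i<d. \<Sum>j<d. A $$ (i, j) * B $$ (j, i))"
    using assms by (auto simp: trace_mat_def scalar_prod_def lessThan_atLeast0 intro!: sum.cong)
  also have "\<dots> = (\<Sum>j<d. \<Sum>i<d. B $$ (j, i) * A $$ (i, j))"
    by (subst sum.swap) (simp add: mult.commute)
  also have "\<dots> = trace_mat (B * A)"
    using assms by (auto simp: trace_mat_def scalar_prod_def lessThan_atLeast0 intro!: sum.cong)
  finally show ?thesis .
qed

lemma character_conjugate:
  assumes "is_character n \<chi>" and u: "u \<in> signed_perms n" and w: "w \<in> signed_perms n"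
  shows "\<chi> (perm_conjugate u w) = \<chi> w"
proof -
  obtain d \<rho> where \<rho>: "is_representation n d \<rho>"
    and \<chi>: "\<And>w. w \<in> signed_perms n \<Longrightarrow> \<chi> w = trace_mat (\<rho> w)"
    using assms(1) unfolding is_character_def by blast
  let ?v = "inv_into UNIV u"
  note group = u w inv_in_signed_perms[OF u] comp_in_signed_perms[OF u w]
  have mult: "\<rho> (x \<circ> y) = \<rho> x * \<rho> y" if "x \<in> signed_perms n" "y \<in> signed_perms n" for x y
    using \<rho> that unfolding is_representation_def by blast
  have carrier: "\<rho> x \<in> carrier_mat d d" if "x \<in> signed_perms n" for x
    using \<rho> that unfolding is_representation_def by blast
  have "?v \<circ> (u \<circ> w) = w"
    using permutes_inverses(2)[OF signed_perms_permutes[OF u]] by (simp add: fun_eq_iff)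
  have "\<chi> (perm_conjugate u w) = trace_mat (\<rho> (u \<circ> w) * \<rho> ?v)"
    using \<chi>[OF perm_conjugate_in_signed_perms[OF u w]] mult[OF group(4,3)]
    by (simp add: perm_conjugate_def)
  also have "\<dots> = trace_mat (\<rho> ?v * \<rho> (u \<circ> w))"
    by (rule trace_mat_commute[OF carrier[OF group(4)] carrier[OF group(3)]])
  also have "\<dots> = trace_mat (\<rho> w)"
    using mult[OF group(3,4)] \<open>?v \<circ> (u \<circ> w) = w\<close> by simp
  finally show ?thesis using \<chi>[OF w] by simp
qed

lemma sum_class_function_card_cycle_bases:
  fixes \<chi> :: "(int \<Rightarrow> int) \<Rightarrow> complex"
  assumes class_fun: "\<And>u. u \<in> signed_perms n \<Longrightarrow> \<chi> (perm_conjugate u w) = \<chi> w"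
    and w: "w \<in> signed_perms n" and "cycle_bases n w \<gamma> \<noteq> {}"
  shows "(\<Sum>v\<in>signed_perms n. \<chi> v * of_nat (card (cycle_bases n v \<gamma>))) = 2 ^ n * fact n * \<chi> w"
proof -
  obtain b where b: "b \<in> cycle_bases n w \<gamma>" using assms(3) by blast
  have "(\<Sum>v\<in>signed_perms n. \<chi> v * of_nat (card (cycle_bases n v \<gamma>))) =
      (\<Sum>v\<in>signed_perms n. \<Sum>c\<in>cycle_bases n v \<gamma>. \<chi> v)"
    by (simp add: mult.commute)
  also have "\<dots> = (\<Sum>q\<in>(SIGMA v:signed_perms n. cycle_bases n v \<gamma>). \<chi> (fst q))"
    by (subst sum.Sigma) (auto simp: finite_signed_perms case_prod_unfold intro: finite_base_lists)
  also have "\<dots> = (\<Sum>u\<in>signed_perms n. \<chi> (perm_conjugate u w))"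
    using sum.reindex_bij_betw[OF conjugation_bij_betw[OF w b], of "\<lambda>q. \<chi> (fst q)"] by simp
  also have "\<dots> = 2 ^ n * fact n * \<chi> w"
    by (simp add: class_fun card_signed_perms)
  finally show ?thesis .
qed

lemma sum_character_weight_functional:
  assumes \<chi>: "is_character n \<chi>" and \<gamma>: "\<gamma> \<in> signed_compositions n"
  shows "(\<Sum>w\<in>signed_perms n. \<chi> w *
      weight_functional \<gamma> (\<lambda>\<tau>. coloring_sum (orbit_type w) \<tau> (signed_orbits n w))) =
    2 ^ n * fact n * value_at n \<chi> \<gamma>"
proof -
  define w where "w = (SOME w. w \<in> signed_perms n \<and> signed_cycle_type n w = bipartition_of \<gamma>)"
  have "\<exists>w. w \<in> signed_perms n \<and> signed_cycle_type n w = bipartition_of \<gamma>"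
    using exists_signed_cycle_type[OF \<gamma>] by blast
  then have "w \<in> signed_perms n \<and> signed_cycle_type n w = bipartition_of \<gamma>"
    unfolding w_def by (rule someI_ex)
  then have w: "w \<in> signed_perms n" "cycle_bases n w \<gamma> \<noteq> {}"
    using cycle_bases_nonempty_iff by blast+
  have "(\<Sum>v\<in>signed_perms n. \<chi> v *
      weight_functional \<gamma> (\<lambda>\<tau>. coloring_sum (orbit_type v) \<tau> (signed_orbits n v))) =
      (\<Sum>v\<in>signed_perms n. \<chi> v * of_nat (card (cycle_bases n v \<gamma>)))"
    using \<gamma>
    by (intro sum.cong refl)
      (simp add: weight_functional_eq_card_base_lists signed_compositions_def)
  also have "\<dots> = 2 ^ n * fact n * \<chi> w"
    by (rule sum_class_function_card_cycle_bases[OF character_conjugate[OF \<chi> _ w(1)] w])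
  finally show ?thesis by (simp add: value_at_def w_def)
qed

section \<open>Fine sets\<close>

lemma ch_eq_quasisym:
  "ch n \<chi> = quasisym n (\<lambda>\<tau>. \<Sum>w\<in>signed_perms n.
     \<chi> w / (2 ^ n * fact n) * coloring_sum (orbit_type w) \<tau> (signed_orbits n w))"
proof -
  have "mps_const (1 / (2 ^ n * fact n)) * (case signed_cycle_type n w of (\<alpha>, \<beta>) \<Rightarrow>
        mps_const (\<chi> w) * power_sum_part Plus \<alpha> * power_sum_part Minus \<beta>) =
      quasisym n (\<lambda>\<tau>. \<chi> w / (2 ^ n * fact n) * coloring_sum (orbit_type w) \<tau> (signed_orbits n w))"
    if w: "w \<in> signed_perms n" for w
  proof -
    have "mps_const (1 / (2 ^ n * fact n)) * (case signed_cycle_type n w of (\<alpha>, \<beta>) \<Rightarrow>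
          mps_const (\<chi> w) * power_sum_part Plus \<alpha> * power_sum_part Minus \<beta>) =
        mps_const (1 / (2 ^ n * fact n)) * mps_const (\<chi> w) *
          (case signed_cycle_type n w of (\<alpha>, \<beta>) \<Rightarrow> power_sum_part Plus \<alpha> * power_sum_part Minus \<beta>)"
      by (simp add: case_prod_unfold mult.assoc)
    also have "\<dots> =
        mps_const (\<chi> w / (2 ^ n * fact n)) * power_sum_prod (orbit_type w) (signed_orbits n w)"
      unfolding power_sum_parts_of_signed_cycle_type[OF w] mps_const_mult by simp
    also have "power_sum_prod (orbit_type w) (signed_orbits n w) =
        quasisym n (\<lambda>\<tau>. coloring_sum (orbit_type w) \<tau> (signed_orbits n w))"
      using power_sum_prod_eq_quasisym[of "signed_orbits n w" "orbit_type w"] orbit_type_pos[OF w]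
      by (simp add: type_size_signed_orbits[OF w])
    finally show ?thesis by (simp add: mps_const_times_quasisym)
  qed
  then show ?thesis
    unfolding ch_def sum_distrib_left quasisym_sum[symmetric] by (rule sum.cong[OF refl])
qed

lemma sum_F_eq_quasisym:
  assumes "sDes \<in> B \<rightarrow> signed_sets n"
  shows "(\<Sum>b\<in>B. F n (sDes b)) =
    quasisym n (\<lambda>\<tau>. \<Sum>b\<in>B. F_coeff (fst (sDes b)) (sign_vector (sDes b)) 0 \<tau>)"
  unfolding quasisym_sum[symmetric] using assms by (intro sum.cong refl F_eq_quasisym) auto

lemma fine_set_iff_ch:
  assumes \<chi>: "is_character n \<chi>" and B: "sDes \<in> B \<rightarrow> signed_sets n"
  shows "fine_set n \<chi> B sDes \<longleftrightarrow> ch n \<chi> = (\<Sum>b\<in>B. F n (sDes b))"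
proof -
  define p where "p \<tau> = (\<Sum>w\<in>signed_perms n.
    \<chi> w / (2 ^ n * fact n) * coloring_sum (orbit_type w) \<tau> (signed_orbits n w))" for \<tau>
  define q where "q \<tau> = (\<Sum>b\<in>B. F_coeff (fst (sDes b)) (sign_vector (sDes b)) 0 \<tau>)" for \<tau>
  have p: "weight_functional \<gamma> p = value_at n \<chi> \<gamma>" if "\<gamma> \<in> signed_compositions n" for \<gamma>
  proof -
    have "weight_functional \<gamma> p = (\<Sum>w\<in>signed_perms n. \<chi> w *
        weight_functional \<gamma> (\<lambda>\<tau>. coloring_sum (orbit_type w) \<tau> (signed_orbits n w))) /
        (2 ^ n * fact n)"
      unfolding p_def weight_functional_linear by (simp add: sum_divide_distrib)
    then show ?thesis by (simp add: sum_character_weight_functional[OF \<chi> that])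
  qed
  have q: "weight_functional \<gamma> q = (\<Sum>b\<in>B. of_int (wt \<gamma> (sDes b)))"
    if "\<gamma> \<in> signed_compositions n" for \<gamma>
    unfolding q_def weight_functional_sum
    using B by (intro sum.cong refl weight_functional_eq_wt[OF that]) auto
  have "ch n \<chi> = (\<Sum>b\<in>B. F n (sDes b)) \<longleftrightarrow> (\<forall>\<tau>\<in>signed_compositions n. p \<tau> = q \<tau>)"
    by (simp add: ch_eq_quasisym sum_F_eq_quasisym[OF B] quasisym_eq_iff p_def q_def)
  also have "\<dots> \<longleftrightarrow> (\<forall>\<gamma>\<in>signed_compositions n. weight_functional \<gamma> p = weight_functional \<gamma> q)"
    by (rule weight_functional_eq_iff[symmetric])
  also have "\<dots> \<longleftrightarrow> fine_set n \<chi> B sDes"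
    by (simp add: fine_set_def p q)
  finally show ?thesis by blast
qed

theorem theorem3p6:
  fixes n :: nat
    and \<chi> :: "(int \<Rightarrow> int) \<Rightarrow> complex"
    and B :: "'b set"
    and sDes :: "'b \<Rightarrow> signed_set"
  assumes "is_character n \<chi>"
    and "finite B"
    and "sDes \<in> B \<rightarrow> signed_sets n"
  shows "(fine_set n \<chi> B sDes \<longleftrightarrow> ch n \<chi> = (\<Sum>b\<in>B. F n (sDes b))) \<and>
    (\<forall>(B' :: 'c set) sDes'.
       finite B' \<and> sDes' \<in> B' \<rightarrow> signed_sets n \<and>
       fine_set n \<chi> B sDes \<and> fine_set n \<chi> B' sDes' \<longrightarrow>
       (\<forall>\<sigma>\<in>signed_sets n. card {b \<in> B. sDes b = \<sigma>} = card {b \<in> B'. sDes' b = \<sigma>}))"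
proof (intro conjI allI impI ballI)
  show "fine_set n \<chi> B sDes \<longleftrightarrow> ch n \<chi> = (\<Sum>b\<in>B. F n (sDes b))"
    by (rule fine_set_iff_ch[OF assms(1,3)])
  fix B' :: "'c set" and sDes' \<sigma>
  assume "finite B' \<and> sDes' \<in> B' \<rightarrow> signed_sets n \<and> fine_set n \<chi> B sDes \<and> fine_set n \<chi> B' sDes'"
    and \<sigma>: "\<sigma> \<in> signed_sets n"
  then have B': "finite B'" "sDes' \<in> B' \<rightarrow> signed_sets n"
    and fine: "fine_set n \<chi> B sDes" "fine_set n \<chi> B' sDes'" by auto
  have "(\<Sum>b\<in>B. F n (sDes b)) = (\<Sum>b\<in>B'. F n (sDes' b))"
    using fine fine_set_iff_ch[OF assms(1,3)] fine_set_iff_ch[OF assms(1) B'(2)] by simp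
  then show "card {b \<in> B. sDes b = \<sigma>} = card {b \<in> B'. sDes' b = \<sigma>}"
    by (rule sum_F_determines_distribution[OF assms(2,3) B' _ \<sigma>])
qed

end
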